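(* Let $N=3$, $T>0$, and let $u_0$ satisfy $B_{k_1}(x,0)\le u_0(x)\le B_{k_2}(x,0)$ in $\mathbb{R}^3$ for some constants $k_1>k_2>0$. Suppose $u$ is a solution of $$u_t=\Delta\log u\ \text{ in }\mathbb{R}^N\times(0,T),\qquad u(x,0)=u_0(x)\ \text{ in }\mathbb{R}^N,$$ which satisfies $B_{k_1}(x,t)\le u(x,t)\le B_{k_2}(x,t)$ in $\mathbb{R}^N\times(0,T)$. Then there is a unique constant $k_0>0$ such that $$\int_{\mathbb{R}^N}\bigl(u_0(x)-B_{k_0}(x,0)\bigr)\,dx=0,$$ and, for this $k_0$, the rescaled function $\widetilde u(\cdot,s)$ converges, uniformly on $\mathbb{R}^3$ and also in $L^1(\mathbb{R}^3)$, to the rescaled Barenblatt solution $\widetilde B_{k_0}$ as $s\to\infty$.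
   Context: For $k>0$ the Barenblatt solution is $$B_k(x,t)=\frac{2(N-2)(T-t)_+^{\frac{N}{N-2}}}{k+(T-t)_+^{\frac{2}{N-2}}|x|^2},\qquad a_+=\max(a,0),$$ and the rescaled Barenblatt solution is $\widetilde B_k(x)=\dfrac{2(N-2)}{k+|x|^2}$. A solution of the Cauchy problem $u_t=\Delta\log u$ in $\mathbb{R}^N\times(0,T)$, $u(x,0)=u_0(x)$ (with $u_0\ge 0$ locally integrable) is a function $u>0$ in $\mathbb{R}^N\times(0,T)$ satisfying the equation in the classical sense, with $u(\cdot,t)\to u_0$ in $L^1_{loc}(\mathbb{R}^N)$ as $t\to0$. The rescaled function is $$\widetilde u(x,s)=\frac{1}{(T-t)^{\frac{N}{N-2}}}\,u\!\left(\frac{x}{(T-t)^{\frac1{N-2}}},t\right),\qquad s=-\log(T-t),\quad s>-\log T.$$ *)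

theory Defs
  imports "HOL-Analysis.Analysis"
begin

(* The space dimension N is DIM('a); the formulas involving N - 2 are meant for N >= 3.
   Since 0 powr a = 0, the Barenblatt solution vanishes for t >= T, as it should. *)

definition barenblatt :: "real \<Rightarrow> real \<Rightarrow> 'a::euclidean_space \<Rightarrow> real \<Rightarrow> real" where
  "barenblatt T k x t =
     (let N = real DIM('a); p = max (T - t) 0 in
        2 * (N - 2) * p powr (N / (N - 2)) / (k + p powr (2 / (N - 2)) * (norm x)\<^sup>2))"

definition rescaled_barenblatt :: "real \<Rightarrow> 'a::euclidean_space \<Rightarrow> real" where
  "rescaled_barenblatt k x = 2 * (real DIM('a) - 2) / (k + (norm x)\<^sup>2)"

(* exp (- s) is T - t, because s = - log (T - t). *)
definition rescaled :: "real \<Rightarrow> ('a::euclidean_space \<Rightarrow> real \<Rightarrow> real) \<Rightarrow> 'a \<Rightarrow> real \<Rightarrow> real" where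
  "rescaled T u x s =
     (let N = real DIM('a); t = T - exp (- s) in
        1 / (T - t) powr (N / (N - 2)) * u (x /\<^sub>R (T - t) powr (1 / (N - 2))) t)"

definition pderiv_dir :: "'a::euclidean_space \<Rightarrow> ('a \<Rightarrow> real) \<Rightarrow> 'a \<Rightarrow> real" where
  "pderiv_dir b f x = deriv (\<lambda>h. f (x + h *\<^sub>R b)) 0"

definition pdiff_dir :: "'a::euclidean_space \<Rightarrow> ('a \<Rightarrow> real) \<Rightarrow> 'a \<Rightarrow> bool" where
  "pdiff_dir b f x \<longleftrightarrow> (\<lambda>h. f (x + h *\<^sub>R b)) differentiable (at 0)"

definition laplacian :: "('a::euclidean_space \<Rightarrow> real) \<Rightarrow> 'a \<Rightarrow> real" where
  "laplacian f x = (\<Sum>b\<in>Basis. pderiv_dir b (pderiv_dir b f) x)"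

(* The regularity class C^{2,1} on R^N x (0,T): the partial derivatives u_t, D_b u and D_c D_b u
   exist there and are jointly continuous in (x,t), as is u.  (deriv and pderiv_dir are
   unspecified where a derivative does not exist, so existence is demanded separately.) *)
definition C21 :: "real \<Rightarrow> ('a::euclidean_space \<Rightarrow> real \<Rightarrow> real) \<Rightarrow> bool" where
  "C21 T u \<longleftrightarrow>
     (\<forall>x. \<forall>t\<in>{0<..<T}.
        u x differentiable (at t) \<and>
        (\<forall>b\<in>Basis. pdiff_dir b (\<lambda>y. u y t) x \<and>
           (\<forall>c\<in>Basis. pdiff_dir c (pderiv_dir b (\<lambda>y. u y t)) x))) \<and>
     continuous_on (UNIV \<times> {0<..<T}) (\<lambda>(x, t). u x t) \<and>
     continuous_on (UNIV \<times> {0<..<T}) (\<lambda>(x, t). deriv (u x) t) \<and>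
     (\<forall>b\<in>Basis.
        continuous_on (UNIV \<times> {0<..<T}) (\<lambda>(x, t). pderiv_dir b (\<lambda>y. u y t) x) \<and>
        (\<forall>c\<in>Basis. continuous_on (UNIV \<times> {0<..<T})
           (\<lambda>(x, t). pderiv_dir c (pderiv_dir b (\<lambda>y. u y t)) x)))"

definition locally_integrable :: "('a::euclidean_space \<Rightarrow> real) \<Rightarrow> bool" where
  "locally_integrable f \<longleftrightarrow> (\<forall>K. compact K \<longrightarrow> set_integrable lebesgue K f)"

definition tendsto_L1 ::
    "'a measure \<Rightarrow> ('b \<Rightarrow> 'a \<Rightarrow> real) \<Rightarrow> ('a \<Rightarrow> real) \<Rightarrow> 'b filter \<Rightarrow> bool" where
  "tendsto_L1 M f g F \<longleftrightarrow>
     (\<forall>\<^sub>F s in F. integrable M (\<lambda>x. f s x - g x)) \<and>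
     ((\<lambda>s. LINT x|M. \<bar>f s x - g x\<bar>) \<longlongrightarrow> 0) F"

definition tendsto_L1_loc ::
    "('b \<Rightarrow> 'a::euclidean_space \<Rightarrow> real) \<Rightarrow> ('a \<Rightarrow> real) \<Rightarrow> 'b filter \<Rightarrow> bool" where
  "tendsto_L1_loc f g F \<longleftrightarrow> (\<forall>K. compact K \<longrightarrow> tendsto_L1 (lebesgue_on K) f g F)"

definition log_diffusion_solution ::
    "real \<Rightarrow> ('a::euclidean_space \<Rightarrow> real) \<Rightarrow> ('a \<Rightarrow> real \<Rightarrow> real) \<Rightarrow> bool" where
  "log_diffusion_solution T u0 u \<longleftrightarrow>
     (\<forall>x. 0 \<le> u0 x) \<and> locally_integrable u0 \<and>
     (\<forall>x. \<forall>t\<in>{0<..<T}. 0 < u x t) \<and>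
     C21 T u \<and>
     (\<forall>x. \<forall>t\<in>{0<..<T}. deriv (u x) t = laplacian (\<lambda>y. ln (u y t)) x) \<and>
     tendsto_L1_loc (\<lambda>t x. u x t) u0 (at_right 0)"

end

theory Submission
  imports Defs
begin

text \<open>The rescaled solution \<open>v\<close> lies between two rescaled Barenblatt solutions and satisfies
  \<open>v\<^sub>s = - div (v * grad a)\<close> with the bounded quantity \<open>a = 1 / B - 1 / v\<close>, where \<open>B\<close> is the rescaled Barenblatt solution
  of the same mass. The mass of \<open>v - B\<close>, which is integrable because \<open>N = 3\<close>, is conserved, and the relative entropy, the integral
  of \<open>h (v / B)\<close> with \<open>h y = y - 1 - ln y\<close>, decreases at the rate \<open>\<integral> v * (norm (grad a))\<^sup>2\<close>. Hence the dissipation is small at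
  some late time; as \<open>v - B = a * v * B\<close> has integral zero, a weighted Poincare inequality makes \<open>v - B\<close> small in the mean at that
  time, and the monotone entropy, which is equivalent to this distance, keeps it small afterwards. For uniform convergence no parabolic regularity
  theory is needed: by scaling and comparison \<open>u / t\<close> is nonincreasing in \<open>t\<close>. This bounds the Laplacian of \<open>ln u\<close> by \<open>u / t\<close>, which
  is negligible in the rescaled variables, and the mean value property bounds \<open>ln v\<close> from below by its averages; averaging also over a short time
  interval, over which the Laplacian of \<open>ln u\<close> integrates to the bounded difference of two values of \<open>u\<close>, gives the bound from above.\<close>

section \<open>Directional derivatives and integration by parts\<close>

text \<open>The gap \<open>a\<close> is the variational derivative of the entropy, since the
  \<open>v\<close>-derivative of \<open>h (v / B)\<close> is \<open>1 / B - 1 / v\<close>. As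
  \<open>grad (1 / B) = x\<close>, the rescaled equation
  \<open>v_s = Laplacian (ln v) + div (x * v)\<close> becomes \<open>v_s = div (v * grad a)\<close>,
  with a plus sign, and testing it with \<open>a\<close> produces the dissipation. The trap supplies
  all bounds: the quadratic growth of \<open>1 / v\<close> cancels in \<open>a\<close>, while
  \<open>v / B - 1\<close> and \<open>ln v - ln B\<close> decay like \<open>1 / (norm x)^2\<close>.
  The obstacle is infinity, where mass could escape. Identities are therefore tested with a cutoff
  of radius \<open>R\<close>, whose Laplacian is of order \<open>R^(-2)\<close>; the integral of
  \<open>1 / (norm x)^2\<close> over the ball grows more slowly than \<open>R^2\<close>, so the
  errors vanish as \<open>R\<close> grows, uniformly up to any fixed time before extinction. The
  estimates are carried out for \<open>u\<close> itself; powers of the remaining time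
  \<open>p = T - t\<close> stand for the change of variables. Comparison bounds \<open>u_t\<close>
  from one side only, which is why the lower and the upper bound of \<open>ln u\<close> have
  different proofs.\<close>

definition has_dd :: "('a::euclidean_space \<Rightarrow> real) \<Rightarrow> 'a \<Rightarrow> ('a \<Rightarrow> real) \<Rightarrow> bool" where
  "has_dd f b f' \<longleftrightarrow> (\<forall>x. ((\<lambda>h. f (x + h *\<^sub>R b)) has_real_derivative f' x) (at 0))"

text \<open>The base point in \<open>has_dd\<close> is arbitrary, so the derivative at 0 along a
  line gives the derivative at every point of it; one-variable theorems then apply along
  lines.\<close>

lemma has_dd_at:
  assumes "has_dd f b f'"
  shows "((\<lambda>h. f (x + h *\<^sub>R b)) has_real_derivative f' (x + s *\<^sub>R b)) (at s)"
proof -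
  have "((\<lambda>h. f ((x + s *\<^sub>R b) + h *\<^sub>R b)) has_real_derivative f' (x + s *\<^sub>R b)) (at 0)"
    using assms unfolding has_dd_def by blast
  then have "((\<lambda>h. f (x + (h + s) *\<^sub>R b)) has_real_derivative f' (x + s *\<^sub>R b)) (at 0)"
    by (simp add: algebra_simps)
  then show ?thesis
    using DERIV_shift[of "\<lambda>h. f (x + h *\<^sub>R b)" "f' (x + s *\<^sub>R b)" 0 s] by simp
qed

lemma has_dd_add: "has_dd f b f' \<Longrightarrow> has_dd g b g' \<Longrightarrow> has_dd (\<lambda>x. f x + g x) b (\<lambda>x. f' x + g' x)"
  unfolding has_dd_def by (auto intro!: DERIV_add)

lemma has_dd_diff: "has_dd f b f' \<Longrightarrow> has_dd g b g' \<Longrightarrow> has_dd (\<lambda>x. f x - g x) b (\<lambda>x. f' x - g' x)"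
  unfolding has_dd_def by (auto intro!: DERIV_diff)

lemma has_dd_mult:
  "has_dd f b f' \<Longrightarrow> has_dd g b g' \<Longrightarrow> has_dd (\<lambda>x. f x * g x) b (\<lambda>x. f' x * g x + g' x * f x)"
  unfolding has_dd_def by (auto intro!: derivative_eq_intros)

lemma has_dd_const: "has_dd (\<lambda>x. c) b (\<lambda>x. 0)"
  unfolding has_dd_def by auto

lemma has_dd_chain:
  assumes "has_dd f b f'" "\<And>x. (\<phi> has_real_derivative \<phi>' (f x)) (at (f x))"
  shows "has_dd (\<lambda>x. \<phi> (f x)) b (\<lambda>x. \<phi>' (f x) * f' x)"
  unfolding has_dd_def
proof
  fix x
  have "((\<lambda>h. f (x + h *\<^sub>R b)) has_real_derivative f' x) (at 0)"
    using assms unfolding has_dd_def by blast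
  then show "((\<lambda>h. \<phi> (f (x + h *\<^sub>R b))) has_real_derivative \<phi>' (f x) * f' x) (at 0)"
    using DERIV_chain2[of \<phi> "\<phi>' (f x)" "\<lambda>h. f (x + h *\<^sub>R b)" 0 "f' x" UNIV] assms(2)[of x] by simp
qed

lemma has_dd_shift: "has_dd f b f' \<Longrightarrow> has_dd (\<lambda>x. f (a + x)) b (\<lambda>x. f' (a + x))"
  unfolding has_dd_def by (simp add: add.assoc[symmetric])

lemma has_dd_scale:
  assumes "has_dd f b f'"
  shows "has_dd (\<lambda>x. f (c *\<^sub>R x)) b (\<lambda>x. c * f' (c *\<^sub>R x))"
  unfolding has_dd_def
proof
  fix x
  have 1: "((\<lambda>h. f (c *\<^sub>R x + h *\<^sub>R b)) has_real_derivative f' (c *\<^sub>R x)) (at (c * 0))"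
    using assms unfolding has_dd_def by simp
  have "((\<lambda>h. f (c *\<^sub>R x + (c * h) *\<^sub>R b)) has_real_derivative f' (c *\<^sub>R x) * c) (at 0)"
    by (rule DERIV_chain2[of "\<lambda>h. f (c *\<^sub>R x + h *\<^sub>R b)" _ "\<lambda>h. c * h", OF 1])
       (auto intro!: derivative_eq_intros)
  then show "((\<lambda>h. f (c *\<^sub>R (x + h *\<^sub>R b))) has_real_derivative c * f' (c *\<^sub>R x)) (at 0)"
    by (simp add: algebra_simps)
qed

lemma has_dd_inner: "has_dd (\<lambda>x. x \<bullet> c) b (\<lambda>x. b \<bullet> c)"
  unfolding has_dd_def by (auto intro!: derivative_eq_intros simp: inner_simps)

lemma has_dd_norm2: "has_dd (\<lambda>x. (norm x)\<^sup>2) b (\<lambda>x. 2 * (x \<bullet> b))"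
  unfolding has_dd_def power2_norm_eq_inner
  by (auto intro!: derivative_eq_intros simp: inner_simps inner_commute)

section \<open>Integrals of compactly supported functions\<close>

lemma borel_of_continuous: "continuous_on UNIV f \<Longrightarrow> f \<in> borel_measurable borel"
  by (rule borel_measurable_continuous_onI)

lemma integrable_continuous_cball:
  fixes f :: "'a::euclidean_space \<Rightarrow> real"
  assumes "continuous_on UNIV f" "\<And>x. norm x > R \<Longrightarrow> f x = 0"
  shows "integrable lborel f"
proof -
  have "integrable lborel (\<lambda>x. indicator (cball 0 R) x *\<^sub>R f x)"
    using borel_integrable_compact[OF compact_cball continuous_on_subset[OF assms(1) subset_UNIV]] .
  moreover have "(\<lambda>x. indicator (cball 0 R) x *\<^sub>R f x) = f"
    using assms(2) by (force simp: indicator_def)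
  ultimately show ?thesis by simp
qed

lemma integrable_indicator_cball:
  fixes a :: "'a::euclidean_space"
  shows "integrable lborel (\<lambda>x. C * indicator (cball a r) x :: real)"
  using emeasure_bounded_finite[OF bounded_cball, of a r]
  by (intro integrable_mult_right integrable_real_indicator) auto

lemma bounded_continuous_cball:
  fixes f :: "'a::euclidean_space \<Rightarrow> real"
  assumes "continuous_on UNIV f"
  obtains C where "C \<ge> 0" "\<And>x. norm x \<le> R \<Longrightarrow> \<bar>f x\<bar> \<le> C"
proof -
  have "compact (f ` cball 0 R)"
    by (intro compact_continuous_image continuous_on_subset[OF assms]) auto
  then obtain C where "\<forall>y\<in>f ` cball 0 R. norm y \<le> C"
    using compact_imp_bounded bounded_iff by metis
  then have "\<And>x. norm x \<le> R \<Longrightarrow> \<bar>f x\<bar> \<le> max C 0" by force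
  then show ?thesis using that[of "max C 0"] by simp
qed

lemma lborel_nn_integral_affine:
  fixes f :: "'a::euclidean_space \<Rightarrow> ennreal"
  assumes [measurable]: "f \<in> borel_measurable borel" and "c \<noteq> 0"
  shows "(\<integral>\<^sup>+x. f x \<partial>lborel) = ennreal (\<bar>c\<bar> ^ DIM('a)) * (\<integral>\<^sup>+x. f (t + c *\<^sub>R x) \<partial>lborel)"
  by (subst lborel_affine[OF assms(2), of t])
     (simp add: nn_integral_density nn_integral_distr nn_integral_cmult)

lemma lborel_integral_affine:
  fixes f :: "'a::euclidean_space \<Rightarrow> real"
  assumes [measurable]: "f \<in> borel_measurable borel" and "c \<noteq> 0"
  shows "(LINT x|lborel. f x) = \<bar>c\<bar> ^ DIM('a) * (LINT x|lborel. f (t + c *\<^sub>R x))"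
  by (subst lborel_affine[OF assms(2), of t])
     (simp add: integral_density integral_distr)

lemma lborel_integrable_affine:
  fixes f :: "'a::euclidean_space \<Rightarrow> real"
  assumes f: "integrable lborel f" and c: "c \<noteq> 0"
  shows "integrable lborel (\<lambda>x. f (t + c *\<^sub>R x))"
proof -
  have [measurable]: "f \<in> borel_measurable borel" using f by auto
  have "integrable (density (distr lborel borel (\<lambda>x. t + c *\<^sub>R x)) (\<lambda>_. \<bar>c\<bar>^DIM('a))) f"
    using f lborel_affine[OF c, of t] by metis
  then have "integrable lborel (\<lambda>x. \<bar>c\<bar>^DIM('a) * f (t + c *\<^sub>R x))"
    by (simp add: integrable_density integrable_distr_eq ennreal_power)
  then show ?thesis using c by simp
qed

lemma lborel_integral_shift:
  fixes f :: "'a::euclidean_space \<Rightarrow> real"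
  assumes "f \<in> borel_measurable borel"
  shows "(LINT x|lborel. f (a + x)) = (LINT x|lborel. f x)"
  using lborel_integral_affine[OF assms, of 1 a] by simp

text \<open>A sequence of difference quotients, because dominated convergence is applied to
  sequences.\<close>

lemma real_derivative_LIMSEQ:
  fixes f :: "real \<Rightarrow> real"
  assumes "(f has_real_derivative d) (at 0)"
  shows "(\<lambda>n. (f (1 / Suc n) - f 0) * Suc n) \<longlonglongrightarrow> d"
proof -
  have lim: "((\<lambda>h. (f h - f 0) / h) \<longlongrightarrow> d) (at 0)"
    using assms unfolding DERIV_def by simp
  have "filterlim (\<lambda>n. 1 / real (Suc n)) (at 0) sequentially"
    unfolding filterlim_at using LIMSEQ_inverse_real_of_nat by (auto simp: inverse_eq_divide)
  from filterlim_compose[OF lim this] show ?thesis by simp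
qed

text \<open>By translation invariance every difference quotient of \<open>f\<close> in direction
  \<open>b\<close> has integral zero. The mean value theorem bounds the quotients by the maximum of
  \<open>\<bar>f'\<bar>\<close>, and steps of size at most 1 keep them supported in the ball
  enlarged by \<open>norm b\<close>, so dominated convergence passes to \<open>f'\<close>.\<close>

lemma integral_dd_zero:
  assumes dd: "has_dd f b f'" and cont: "continuous_on UNIV f" "continuous_on UNIV f'"
    and supp: "\<And>x. norm x > R \<Longrightarrow> f x = 0" "\<And>x. norm x > R \<Longrightarrow> f' x = 0"
  shows "(LINT x|lborel. f' x) = 0"
proof -
  define s where "s n x = (f (x + (1 / Suc n) *\<^sub>R b) - f x) * Suc n" for n :: nat and x
  obtain C where C: "C \<ge> 0" "\<And>x. norm x \<le> R \<Longrightarrow> \<bar>f' x\<bar> \<le> C"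
    using bounded_continuous_cball[OF cont(2)] by metis
  have bd: "\<bar>f' x\<bar> \<le> C" for x using C supp(2)[of x] by (cases "norm x \<le> R") auto
  have sbd: "\<bar>s n x\<bar> \<le> C * indicator (cball 0 (R + norm b)) x" for n x
  proof (cases "norm x \<le> R + norm b")
    case True
    obtain z where "f (x + (1 / Suc n) *\<^sub>R b) - f (x + 0 *\<^sub>R b) = (1 / Suc n - 0) * f' (x + z *\<^sub>R b)"
      using MVT2[of 0 "1 / Suc n" "\<lambda>h. f (x + h *\<^sub>R b)" "\<lambda>z. f' (x + z *\<^sub>R b)"] has_dd_at[OF dd, of x]
      by auto
    then have "s n x = f' (x + z *\<^sub>R b)" unfolding s_def by simp
    with bd True show ?thesis by simp
  next
    case False
    have "norm ((1 / Suc n) *\<^sub>R b) \<le> norm b" by (simp add: divide_le_eq mult_le_cancel_left1)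
    moreover have "norm x \<le> norm (x + (1 / Suc n) *\<^sub>R b) + norm ((1 / Suc n) *\<^sub>R b)"
      by (metis add_diff_cancel norm_triangle_ineq4)
    ultimately have "norm (x + (1 / Suc n) *\<^sub>R b) > R" "norm x > R"
      using False norm_ge_zero[of b] by linarith+
    then show ?thesis using supp C(1) unfolding s_def by simp
  qed
  have fi: "integrable lborel f" using integrable_continuous_cball[OF cont(1) supp(1)] .
  have fb[measurable]: "f \<in> borel_measurable borel" "f' \<in> borel_measurable borel"
    using cont borel_of_continuous by auto
  have "(\<lambda>n. LINT x|lborel. s n x) \<longlonglongrightarrow> (LINT x|lborel. f' x)"
  proof (rule integral_dominated_convergence[where w="\<lambda>x. C * indicator (cball 0 (R + norm b)) x"])
    show "AE x in lborel. (\<lambda>n. s n x) \<longlonglongrightarrow> f' x"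
      using real_derivative_LIMSEQ dd unfolding has_dd_def s_def by fastforce
    show "integrable lborel (\<lambda>x. C * indicator (cball (0::'a) (R + norm b)) x)"
      by (rule integrable_indicator_cball)
  qed (use sbd in \<open>auto simp: s_def\<close>)
  moreover have "(LINT x|lborel. s n x) = 0" for n
  proof -
    have "integrable lborel (\<lambda>x. f ((1 / Suc n) *\<^sub>R b + x))"
      using lborel_integrable_affine[OF fi, of 1] by simp
    then have "(LINT x|lborel. s n x) = ((LINT x|lborel. f ((1 / Suc n) *\<^sub>R b + x)) - (LINT x|lborel. f x)) * Suc n"
      using fi unfolding s_def by (simp add: add.commute)
    then show ?thesis by (simp add: lborel_integral_shift)
  qed
  ultimately show ?thesis by (simp add: LIMSEQ_const_iff)
qed

lemma integral_by_parts_dd: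
  assumes "has_dd f b f'" "has_dd \<phi> b \<phi>'"
    and "continuous_on UNIV f" "continuous_on UNIV f'" "continuous_on UNIV \<phi>" "continuous_on UNIV \<phi>'"
    and "\<And>x. norm x > R \<Longrightarrow> \<phi> x = 0" "\<And>x. norm x > R \<Longrightarrow> \<phi>' x = 0"
  shows "(LINT x|lborel. \<phi> x * f' x) = - (LINT x|lborel. f x * \<phi>' x)"
proof -
  have i: "integrable lborel (\<lambda>x. \<phi> x * f' x)" "integrable lborel (\<lambda>x. f x * \<phi>' x)"
    by (rule integrable_continuous_cball[where R=R], use assms in \<open>auto intro!: continuous_intros\<close>)+
  have "(LINT x|lborel. f' x * \<phi> x + \<phi>' x * f x) = 0"
    by (rule integral_dd_zero[OF has_dd_mult[OF assms(1,2)], where R=R])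
       (use assms in \<open>auto intro!: continuous_intros\<close>)
  with i show ?thesis by (simp add: mult.commute)
qed

lemma green_identity:
  fixes f \<phi> :: "'a::euclidean_space \<Rightarrow> real"
  assumes f: "\<And>b. b \<in> Basis \<Longrightarrow> has_dd f b (f1 b)" "\<And>b. b \<in> Basis \<Longrightarrow> has_dd (f1 b) b (f2 b)"
    and \<phi>: "\<And>b. b \<in> Basis \<Longrightarrow> has_dd \<phi> b (p1 b)" "\<And>b. b \<in> Basis \<Longrightarrow> has_dd (p1 b) b (p2 b)"
    and cf: "continuous_on UNIV f" "\<And>b. b \<in> Basis \<Longrightarrow> continuous_on UNIV (f1 b)" "\<And>b. b \<in> Basis \<Longrightarrow> continuous_on UNIV (f2 b)"
    and cp: "continuous_on UNIV \<phi>" "\<And>b. b \<in> Basis \<Longrightarrow> continuous_on UNIV (p1 b)" "\<And>b. b \<in> Basis \<Longrightarrow> continuous_on UNIV (p2 b)"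
    and supp: "\<And>x. norm x > R \<Longrightarrow> \<phi> x = 0" "\<And>x b. b \<in> Basis \<Longrightarrow> norm x > R \<Longrightarrow> p1 b x = 0"
      "\<And>x b. b \<in> Basis \<Longrightarrow> norm x > R \<Longrightarrow> p2 b x = 0"
  shows "(LINT x|lborel. \<phi> x * (\<Sum>b\<in>Basis. f2 b x)) = (LINT x|lborel. f x * (\<Sum>b\<in>Basis. p2 b x))"
proof -
  have 1: "(LINT x|lborel. \<phi> x * f2 b x) = (LINT x|lborel. f x * p2 b x)" if b: "b \<in> Basis" for b
  proof -
    have "(LINT x|lborel. \<phi> x * f2 b x) = - (LINT x|lborel. f1 b x * p1 b x)"
      by (rule integral_by_parts_dd[where R=R]) (use assms b in auto)
    moreover have "(LINT x|lborel. p1 b x * f1 b x) = - (LINT x|lborel. f x * p2 b x)"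
      by (rule integral_by_parts_dd[where R=R]) (use assms b in auto)
    ultimately show ?thesis by (simp add: mult.commute)
  qed
  have i: "integrable lborel (\<lambda>x. \<phi> x * f2 b x)" "integrable lborel (\<lambda>x. f x * p2 b x)" if "b \<in> Basis" for b
    by (rule integrable_continuous_cball[where R=R], use assms that in \<open>auto intro!: continuous_intros\<close>)+
  show ?thesis using 1 i by (simp add: sum_distrib_left)
qed

text \<open>All the supports lie in one compact box, where the Leibniz rule for parametric integrals
  applies.\<close>

lemma leibniz_lborel:
  fixes F F' :: "'a::euclidean_space \<Rightarrow> real \<Rightarrow> real"
  assumes d: "\<And>x t. t \<in> {a<..<b} \<Longrightarrow> ((\<lambda>t. F x t) has_real_derivative F' x t) (at t)"
    and c: "\<And>t. t \<in> {a<..<b} \<Longrightarrow> continuous_on UNIV (\<lambda>x. F x t)"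
      "continuous_on (UNIV \<times> {a<..<b}) (\<lambda>(x, t). F' x t)"
    and supp: "\<And>x t. norm x > R \<Longrightarrow> F x t = 0" "\<And>x t. norm x > R \<Longrightarrow> F' x t = 0"
    and t: "t \<in> {a<..<b}"
  shows "((\<lambda>t. LINT x|lborel. F x t) has_real_derivative (LINT x|lborel. F' x t)) (at t)"
proof -
  obtain c where c2: "cball (0::'a) R \<subseteq> cbox (-c) c"
    using bounded_subset_cbox_symmetric[OF bounded_cball] by metis
  have c': "continuous_on UNIV (\<lambda>x. F' x t)" if "t \<in> {a<..<b}" for t
  proof -
    have "continuous_on UNIV (\<lambda>x. (\<lambda>(x, t). F' x t) (x, t))"
      by (rule continuous_on_compose2[OF c(2)]) (use that in \<open>auto intro!: continuous_intros\<close>)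
    then show ?thesis by simp
  qed
  have eq: "(LINT x|lborel. f x) = integral (cbox (-c) c) f" if f: "continuous_on UNIV f" "\<And>x. norm x > R \<Longrightarrow> f x = 0"
    for f :: "'a \<Rightarrow> real"
  proof -
    have "(LINT x|lborel. f x) = integral UNIV f"
      using integral_lborel[OF integrable_continuous_cball[OF f]] by simp
    also have "\<dots> = integral UNIV (\<lambda>x. if x \<in> cbox (-c) c then f x else 0)"
      by (rule arg_cong[where f="integral UNIV"]) (use c2 f(2) in \<open>force simp: fun_eq_iff\<close>)
    finally show ?thesis by (simp add: integral_restrict_UNIV)
  qed
  have "((\<lambda>t. integral (cbox (-c) c) (\<lambda>x. F x t)) has_field_derivative integral (cbox (-c) c) (\<lambda>x. F' x t)) (at t within {a<..<b})"
  proof (rule leibniz_rule_field_derivative)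
    show "((\<lambda>t. F x t) has_real_derivative F' x s) (at s within {a<..<b})" if "s \<in> {a<..<b}" for x s
      using d[OF that] by (rule has_field_derivative_at_within)
    show "(\<lambda>x. F x s) integrable_on cbox (-c) c" if "s \<in> {a<..<b}" for s
      using c(1)[OF that] by (intro integrable_continuous) (auto intro: continuous_on_subset)
    have "continuous_on ({a<..<b} \<times> cbox (-c) c) ((\<lambda>(x, t). F' x t) \<circ> (\<lambda>z. (snd z, fst z)))"
      by (intro continuous_on_compose continuous_on_subset[OF c(2)] continuous_intros) auto
    then show "continuous_on ({a<..<b} \<times> cbox (-c) c) (\<lambda>(t, x). F' x t)"
      by (simp add: comp_def split_beta)
  qed (use t in auto)
  then have "((\<lambda>t. integral (cbox (-c) c) (\<lambda>x. F x t)) has_real_derivative integral (cbox (-c) c) (\<lambda>x. F' x t)) (at t)"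
    unfolding at_within_open[OF t open_greaterThanLessThan] .
  then have "((\<lambda>t. integral (cbox (-c) c) (\<lambda>x. F x t)) has_real_derivative (LINT x|lborel. F' x t)) (at t)"
    using eq[OF c'[OF t]] supp(2) by simp
  note D = this
  \<comment> \<open>The two integrals are known to agree only for times in the interval, where the
    slices are continuous; this suffices, since a derivative depends on a neighbourhood of
    \<open>t\<close> alone.\<close>
  have "\<forall>\<^sub>F s in nhds t. s \<in> {a<..<b}" using t by (intro eventually_nhds_in_open) auto
  then have "\<forall>\<^sub>F s in nhds t. (LINT x|lborel. F x s) = integral (cbox (-c) c) (\<lambda>x. F x s)"
    by (rule eventually_mono) (rule eq[OF c(1) supp(1)])
  from DERIV_cong_ev[OF refl this refl] D show ?thesis by blast
qed

text \<open>The exterior of a closed ball is open, so \<open>f\<close> vanishes along the line near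
  \<open>x\<close>. Applied twice, it confines the second derivatives of a test function to the ball
  as well.\<close>

lemma has_dd_zero_outside:
  assumes dd: "has_dd f b f'" and f: "\<And>x. norm x > R \<Longrightarrow> f x = 0" and x: "norm x > R"
  shows "f' x = 0"
proof -
  have "continuous_on UNIV (\<lambda>h. norm (x + h *\<^sub>R b))" by (intro continuous_intros)
  then have "open {h. R < norm (x + h *\<^sub>R b)}"
    by (intro open_Collect_less continuous_intros)
  then have "\<forall>\<^sub>F h in nhds 0. h \<in> {h. R < norm (x + h *\<^sub>R b)}"
    using x by (intro eventually_nhds_in_open) auto
  then have ev: "\<forall>\<^sub>F h in nhds 0. f (x + h *\<^sub>R b) = 0"
    by eventually_elim (use f in auto)
  have "((\<lambda>h. f (x + h *\<^sub>R b)) has_real_derivative f' x) (at 0)"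
    using dd unfolding has_dd_def by blast
  then have "((\<lambda>h::real. 0::real) has_real_derivative f' x) (at 0)"
    using DERIV_cong_ev[OF refl ev refl] by blast
  then show ?thesis by (metis DERIV_const DERIV_unique)
qed

section \<open>Radial test functions of class C^2\<close>

lemma has_real_derivative_glue:
  fixes f g :: "real \<Rightarrow> real"
  assumes "(f has_real_derivative d) (at c)" "(g has_real_derivative d) (at c)" "f c = g c"
  shows "((\<lambda>s. if s \<ge> c then f s else g s) has_real_derivative d) (at c)"
proof -
  let ?F = "\<lambda>s. if s \<ge> c then f s else g s"
  have 1: "((\<lambda>y. (f y - f c) / (y - c)) \<longlongrightarrow> d) (at c)" "((\<lambda>y. (g y - g c) / (y - c)) \<longlongrightarrow> d) (at c)"
    using assms(1,2) unfolding has_field_derivative_iff by auto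
  have "((\<lambda>y. (?F y - ?F c) / (y - c)) \<longlongrightarrow> d) (at_right c)"
    by (rule Lim_transform_eventually[OF filterlim_mono[OF 1(1) order_refl at_le]])
       (auto simp: eventually_at_right_less eventually_at_filter intro!: always_eventually)
  moreover have "((\<lambda>y. (?F y - ?F c) / (y - c)) \<longlongrightarrow> d) (at_left c)"
    by (rule Lim_transform_eventually[OF filterlim_mono[OF 1(2) order_refl at_le]])
       (use assms(3) in \<open>auto simp: eventually_at_filter intro!: always_eventually\<close>)
  ultimately show ?thesis
    unfolding has_field_derivative_iff by (simp add: filterlim_at_split)
qed

lemma has_real_derivative_glue_everywhere:
  fixes f g f' g' :: "real \<Rightarrow> real"
  assumes f: "\<And>s. s \<ge> c \<Longrightarrow> (f has_real_derivative f' s) (at s)"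
    and g: "\<And>s. s \<le> c \<Longrightarrow> (g has_real_derivative g' s) (at s)"
    and eq: "f c = g c" "f' c = g' c"
  shows "((\<lambda>s. if s \<ge> c then f s else g s) has_real_derivative (if s \<ge> c then f' s else g' s)) (at s)"
proof -
  consider "s > c" | "s < c" | "s = c" by linarith
  then show ?thesis
  proof cases
    case 1
    then have "\<forall>\<^sub>F y in nhds s. y \<in> {c<..}" by (intro eventually_nhds_in_open) auto
    then have "\<forall>\<^sub>F y in nhds s. (if y \<ge> c then f y else g y) = f y" by eventually_elim auto
    from DERIV_cong_ev[OF refl this refl] f[of s] 1 show ?thesis by auto
  next
    case 2
    then have "\<forall>\<^sub>F y in nhds s. y \<in> {..<c}" by (intro eventually_nhds_in_open) auto
    then have "\<forall>\<^sub>F y in nhds s. (if y \<ge> c then f y else g y) = g y" by eventually_elim auto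
    from DERIV_cong_ev[OF refl this refl] g[of s] 2 show ?thesis by auto
  next
    case 3
    then show ?thesis using has_real_derivative_glue[of f "f' c" c g] f[of c] g[of c] eq by auto
  qed
qed

lemma has_dd_radial:
  fixes g :: "real \<Rightarrow> real"
  assumes g: "\<And>s. (g has_real_derivative g' s) (at s)" and g': "\<And>s. (g' has_real_derivative g'' s) (at s)"
  shows "has_dd (\<lambda>x. g ((norm x)\<^sup>2 / R\<^sup>2)) b (\<lambda>x. g' ((norm x)\<^sup>2 / R\<^sup>2) * (2 * (x \<bullet> b) / R\<^sup>2))"
    and "norm b = 1 \<Longrightarrow> has_dd (\<lambda>x. g' ((norm x)\<^sup>2 / R\<^sup>2) * (2 * (x \<bullet> b) / R\<^sup>2)) b
      (\<lambda>x. g'' ((norm x)\<^sup>2 / R\<^sup>2) * (2 * (x \<bullet> b) / R\<^sup>2)\<^sup>2 + g' ((norm x)\<^sup>2 / R\<^sup>2) * (2 / R\<^sup>2))"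
proof -
  have n: "has_dd (\<lambda>x. (norm x)\<^sup>2 / R\<^sup>2) b (\<lambda>x. 2 * (x \<bullet> b) / R\<^sup>2)"
    using has_dd_mult[OF has_dd_norm2 has_dd_const[of "1 / R\<^sup>2"]] by simp
  show 1: "has_dd (\<lambda>x. g ((norm x)\<^sup>2 / R\<^sup>2)) b (\<lambda>x. g' ((norm x)\<^sup>2 / R\<^sup>2) * (2 * (x \<bullet> b) / R\<^sup>2))"
    by (rule has_dd_chain[OF n g])
  assume b: "norm b = 1"
  have n': "has_dd (\<lambda>x. 2 * (x \<bullet> b) / R\<^sup>2) b (\<lambda>x. 2 / R\<^sup>2)"
    using has_dd_mult[OF has_dd_inner[of b] has_dd_const[of "2 / R\<^sup>2"], of b] b
    by (simp add: dot_square_norm mult.commute)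
  show "has_dd (\<lambda>x. g' ((norm x)\<^sup>2 / R\<^sup>2) * (2 * (x \<bullet> b) / R\<^sup>2)) b
      (\<lambda>x. g'' ((norm x)\<^sup>2 / R\<^sup>2) * (2 * (x \<bullet> b) / R\<^sup>2)\<^sup>2 + g' ((norm x)\<^sup>2 / R\<^sup>2) * (2 / R\<^sup>2))"
  proof -
    have "g'' s * (2 * c / R\<^sup>2)\<^sup>2 + g' s * (2 / R\<^sup>2) = g'' s * (2 * c / R\<^sup>2) * (2 * c / R\<^sup>2) + 2 / R\<^sup>2 * g' s" for s c
      by (simp add: power2_eq_square mult_ac)
    then show ?thesis using has_dd_mult[OF has_dd_chain[OF n g'] n'] by simp
  qed
qed

lemma sum_inner_Basis_square: "(\<Sum>b\<in>Basis. (x \<bullet> b)\<^sup>2) = (norm (x::'a::euclidean_space))\<^sup>2"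
  unfolding power2_norm_eq_inner by (subst euclidean_inner) (simp add: power2_eq_square)

text \<open>For \<open>p\<close> and \<open>q\<close> the values of \<open>g''\<close> and
  \<open>g'\<close> at \<open>(norm x)\<^sup>2 / R\<^sup>2\<close> the summands are the second
  derivatives from \<open>has_dd_radial\<close>, so this is the Laplacian of the radial
  function.\<close>

lemma laplacian_radial:
  fixes x :: "'a::euclidean_space"
  assumes "R \<noteq> 0"
  shows "(\<Sum>b\<in>Basis. p * (2 * (x \<bullet> b) / R\<^sup>2)\<^sup>2 + q * (2 / R\<^sup>2))
    = (4 * p * ((norm x)\<^sup>2 / R\<^sup>2) + 2 * real DIM('a) * q) / R\<^sup>2"
proof -
  have "(\<Sum>b\<in>Basis. p * (2 * (x \<bullet> b) / R\<^sup>2)\<^sup>2) = p * 4 * (norm x)\<^sup>2 / (R\<^sup>2)\<^sup>2"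
    by (simp add: power_divide power_mult_distrib sum_inner_Basis_square flip: sum_distrib_left sum_divide_distrib)
  moreover have "p * 4 * (norm x)\<^sup>2 / (R\<^sup>2)\<^sup>2 = 4 * p * ((norm x)\<^sup>2 / R\<^sup>2) / R\<^sup>2"
    by (simp add: power2_eq_square)
  ultimately show ?thesis by (simp add: sum.distrib add_divide_distrib mult_ac)
qed

lemma pos_part_power_derivative:
  "((\<lambda>s::real. max 0 (1 - s) ^ Suc (Suc n)) has_real_derivative - (real n + 2) * max 0 (1 - s) ^ Suc n) (at s)"
proof -
  have "((\<lambda>s::real. if s \<ge> 1 then 0 else (1 - s) ^ Suc (Suc n)) has_real_derivative
      (if s \<ge> 1 then 0 else - (real n + 2) * (1 - s) ^ Suc n)) (at s)"
    by (rule has_real_derivative_glue_everywhere)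
       (auto intro!: derivative_eq_intros simp: algebra_simps simp del: power_Suc)
  moreover have "(\<lambda>s::real. max 0 (1 - s) ^ Suc (Suc n)) = (\<lambda>s. if s \<ge> 1 then 0 else (1 - s) ^ Suc (Suc n))"
    by (auto simp: fun_eq_iff max_def)
  moreover have "(if s \<ge> 1 then 0 else - (real n + 2) * (1 - s) ^ Suc n) = - (real n + 2) * max 0 (1 - s) ^ Suc n"
    by (auto simp: max_def)
  ultimately show ?thesis by simp
qed

text \<open>The cube is the least integer power of the positive part that is of class C^2. It also
  makes the squared gradient a multiple of the cutoff itself (\<open>cutoff1_square\<close>), and
  the dependence on \<open>(norm x)\<^sup>2\<close> avoids a singularity at the origin.\<close>

definition cutoff :: "real \<Rightarrow> 'a::euclidean_space \<Rightarrow> real" where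
  "cutoff R x = max 0 (1 - (norm x)\<^sup>2 / R\<^sup>2) ^ 3"

definition cutoff1 :: "real \<Rightarrow> 'a::euclidean_space \<Rightarrow> 'a \<Rightarrow> real" where
  "cutoff1 R b x = - 3 * max 0 (1 - (norm x)\<^sup>2 / R\<^sup>2) ^ 2 * (2 * (x \<bullet> b) / R\<^sup>2)"

definition cutoff2 :: "real \<Rightarrow> 'a::euclidean_space \<Rightarrow> 'a \<Rightarrow> real" where
  "cutoff2 R b x = 6 * max 0 (1 - (norm x)\<^sup>2 / R\<^sup>2) * (2 * (x \<bullet> b) / R\<^sup>2)\<^sup>2
     + - 3 * max 0 (1 - (norm x)\<^sup>2 / R\<^sup>2) ^ 2 * (2 / R\<^sup>2)"

lemma has_dd_cutoff:
  shows "has_dd (cutoff R) b (cutoff1 R b)"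
    and "norm b = 1 \<Longrightarrow> has_dd (cutoff1 R b) b (cutoff2 R b)"
proof -
  have d: "((\<lambda>s::real. max 0 (1 - s) ^ 3) has_real_derivative (- 3 * max 0 (1 - s) ^ 2)) (at s)"
    "((\<lambda>s::real. - 3 * max 0 (1 - s) ^ 2) has_real_derivative (6 * max 0 (1 - s))) (at s)" for s :: real
    using pos_part_power_derivative[of 1 s] DERIV_cmult[OF pos_part_power_derivative[of 0 s], of "-3"]
    by (simp_all add: numeral_eq_Suc)
  show "has_dd (cutoff R) b (cutoff1 R b)" "norm b = 1 \<Longrightarrow> has_dd (cutoff1 R b) b (cutoff2 R b)"
    using has_dd_radial[OF d, where R=R and b=b] unfolding cutoff_def cutoff1_def cutoff2_def by simp_all
qed

lemma continuous_on_cutoff: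
  "continuous_on UNIV (cutoff R)" "continuous_on UNIV (cutoff1 R b)" "continuous_on UNIV (cutoff2 R b)"
  unfolding cutoff_def cutoff1_def cutoff2_def divide_inverse by (intro continuous_intros)+

lemma cutoff_supp:
  assumes "R > 0" "norm x > R"
  shows "cutoff R x = 0" "cutoff1 R b x = 0" "cutoff2 R b x = 0"
proof -
  have "(norm x)\<^sup>2 / R\<^sup>2 > 1" using assms by (simp add: power_strict_mono)
  then show "cutoff R x = 0" "cutoff1 R b x = 0" "cutoff2 R b x = 0"
    unfolding cutoff_def cutoff1_def cutoff2_def by (simp_all add: max_def)
qed

lemma cutoff_range: "0 \<le> cutoff R x" "cutoff R x \<le> 1"
  unfolding cutoff_def by (auto intro!: power_le_one zero_le_power)

lemma cutoff_tendsto_1: "(\<lambda>n. cutoff (real n) x) \<longlonglongrightarrow> 1"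
proof -
  have "(\<lambda>n. max 0 (1 - (norm x)\<^sup>2 * (1 / real n)\<^sup>2) ^ 3) \<longlonglongrightarrow> max 0 (1 - (norm x)\<^sup>2 * 0\<^sup>2) ^ 3"
    by (intro tendsto_intros lim_1_over_n)
  then show ?thesis unfolding cutoff_def by (simp add: power_divide)
qed

text \<open>For \<open>norm x \<le> R / 3\<close> the base is at least 8/9, and the cube of 8/9 is
  above 1/2. This keeps half of the dissipation on any fixed ball once \<open>R\<close> is
  large.\<close>

lemma cutoff_ge_half:
  assumes "R > 0" "3 * norm x \<le> R"
  shows "cutoff R x \<ge> 1 / 2"
proof -
  have "(3 * norm x)\<^sup>2 \<le> R\<^sup>2" using assms by (intro power_mono) auto
  then have "(norm x)\<^sup>2 / R\<^sup>2 \<le> 1 / 9" using assms by (simp add: field_simps power_mult_distrib)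
  then have "8 / 9 \<le> max 0 (1 - (norm x)\<^sup>2 / R\<^sup>2)" by linarith
  then have "(8 / 9) ^ 3 \<le> max 0 (1 - (norm x)\<^sup>2 / R\<^sup>2) ^ 3" by (rule power_mono) simp
  moreover have "(1 / 2::real) \<le> (8 / 9) ^ 3" by (simp add: power3_eq_cube)
  ultimately show ?thesis unfolding cutoff_def by (rule order_trans[rotated])
qed

lemma laplacian_cutoff_bound:
  fixes x :: "real^3"
  assumes "R > 0"
  shows "\<bar>\<Sum>b\<in>Basis. cutoff2 R b x\<bar> \<le> 42 / R\<^sup>2 * indicator (cball 0 R) x"
proof (cases "norm x \<le> R")
  case False
  then show ?thesis using cutoff_supp[OF assms, of x] by simp
next
  case True
  let ?s = "(norm x)\<^sup>2 / R\<^sup>2" let ?w = "max 0 (1 - ?s)"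
  have s: "0 \<le> ?s" "?s \<le> 1" using True assms by (auto simp: power_mono)
  have w: "0 \<le> ?w" "?w \<le> 1" using s by auto
  \<comment> \<open>In dimension 3 the radial formula gives \<open>4 * 6 * w * s\<close> and
    \<open>2 * 3 * (- 3 * w^2)\<close>; as \<open>w * s\<close> and \<open>w^2\<close> lie between 0
    and 1, the sum is at most 24 + 18 = 42 in absolute value.\<close>
  have eq: "(\<Sum>b\<in>Basis. cutoff2 R b x) = (24 * ?w * ?s - 18 * ?w ^ 2) / R\<^sup>2"
    unfolding cutoff2_def using laplacian_radial[of R "6 * ?w" x "- 3 * ?w ^ 2"] assms by simp
  have "0 \<le> ?w * ?s" "?w * ?s \<le> 1" "0 \<le> ?w ^ 2" "?w ^ 2 \<le> 1"
    using mult_nonneg_nonneg[OF w(1) s(1)] mult_le_one[OF w(2) s(1) s(2)] power_le_one[OF w] zero_le_power2 by blast+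
  then have "\<bar>24 * ?w * ?s - 18 * ?w ^ 2\<bar> \<le> 42" unfolding mult.assoc by linarith
  then show ?thesis unfolding eq using True assms by (simp add: abs_divide divide_right_mono)
qed

section \<open>Integrable decay in dimension 3\<close>

lemma integrable_inverse_quartic:
  "integrable lborel (\<lambda>x::real^3. 1 / (1 + (norm x)\<^sup>2)\<^sup>2)"
proof (rule integrableI_bounded)
  show "(\<lambda>x::real^3. 1 / (1 + (norm x)\<^sup>2)\<^sup>2) \<in> borel_measurable lborel" by simp
  define V where "V = unit_ball_vol 3"
  have V: "V \<ge> 0" unfolding V_def by simp
  \<comment> \<open>On the n-th dyadic shell the integrand is at most 16 / 16^n, where the factor 16
    pays for using the inner radius of the shell. The ball of radius 2^n has volume V * 8^n: the
    fourth power of the radius beats the third and leaves a geometric series with ratio 1/2.\<close>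
  have "ennreal (norm (1 / (1 + (norm x)\<^sup>2)\<^sup>2)) \<le> (\<Sum>n. ennreal (16 / 16 ^ n) * indicator (cball 0 (2 ^ n)) x)"
    for x :: "real^3"
  proof -
    obtain n0 where n0: "norm x < 2 ^ n0" using real_arch_pow[of 2 "norm x"] by auto
    define n where "n = (LEAST n. norm x \<le> 2 ^ n)"
    have n: "norm x \<le> 2 ^ n" unfolding n_def by (rule LeastI[of _ n0]) (use n0 in simp)
    have "1 / (1 + (norm x)\<^sup>2)\<^sup>2 \<le> 16 / 16 ^ n"
    proof (cases n)
      case 0
      have "1 \<le> (1 + (norm x)\<^sup>2)\<^sup>2" by (intro one_le_power) simp
      then have "1 / (1 + (norm x)\<^sup>2)\<^sup>2 \<le> 1" by (simp add: divide_le_eq)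
      then show ?thesis using 0 by simp
    next
      case (Suc m)
      have "\<not> norm x \<le> 2 ^ m" using Suc not_less_Least[of m "\<lambda>n. norm x \<le> 2 ^ n"] unfolding n_def by auto
      then have "(2 ^ m) ^ 4 \<le> (norm x) ^ 4" by (intro power_mono) auto
      also have "\<dots> = ((norm x)\<^sup>2)\<^sup>2" by simp
      also have "\<dots> \<le> (1 + (norm x)\<^sup>2)\<^sup>2" by (intro power_mono) auto
      finally have "(16::real) ^ m \<le> (1 + (norm x)\<^sup>2)\<^sup>2" by (simp add: power_mult[symmetric] power_mult mult.commute[of m])
      then have "1 / (1 + (norm x)\<^sup>2)\<^sup>2 \<le> 1 / 16 ^ m" by (intro divide_left_mono mult_pos_pos zero_less_power add_pos_nonneg) auto
      then show ?thesis using Suc by simp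
    qed
    then have "ennreal (norm (1 / (1 + (norm x)\<^sup>2)\<^sup>2)) \<le> ennreal (16 / 16 ^ n) * indicator (cball 0 (2 ^ n)) x"
      using n by (simp add: ennreal_leI)
    also have "\<dots> \<le> (\<Sum>n. ennreal (16 / 16 ^ n) * indicator (cball 0 (2 ^ n)) x)"
      using sum_le_suminf[of "\<lambda>n. ennreal (16 / 16 ^ n) * indicator (cball 0 (2 ^ n)) x" "{n}"]
      by (simp del: sum_mult_indicator)
    finally show ?thesis .
  qed
  then have "(\<integral>\<^sup>+x. ennreal (norm (1 / (1 + (norm (x::real^3))\<^sup>2)\<^sup>2)) \<partial>lborel)
      \<le> (\<integral>\<^sup>+(x::real^3). (\<Sum>n. ennreal (16 / 16 ^ n) * indicator (cball 0 (2 ^ n)) x) \<partial>lborel)"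
    by (intro nn_integral_mono)
  also have "\<dots> = (\<Sum>n. \<integral>\<^sup>+(x::real^3). ennreal (16 / 16 ^ n) * indicator (cball 0 (2 ^ n)) x \<partial>lborel)"
    by (intro nn_integral_suminf borel_measurable_times_ennreal borel_measurable_const borel_measurable_indicator) auto
  also have "\<dots> = (\<Sum>n. ennreal (16 * V * (1 / 2) ^ n))"
  proof (rule suminf_cong)
    fix n
    have p: "((2::real) ^ n) ^ 3 = 8 ^ n" by (simp add: power_mult[symmetric] power_mult mult.commute[of n])
    have h: "(16::real) ^ n = 8 ^ n * 2 ^ n" by (simp flip: power_mult_distrib)
    have "(\<integral>\<^sup>+(x::real^3). ennreal (16 / 16 ^ n) * indicator (cball 0 (2 ^ n)) x \<partial>lborel)
        = ennreal (16 / 16 ^ n) * ennreal (V * (2 ^ n) ^ 3)"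
      by (subst nn_integral_cmult_indicator) (auto simp: emeasure_cball V_def)
    also have "\<dots> = ennreal (16 / 16 ^ n * (V * (2 ^ n) ^ 3))" using V by (subst ennreal_mult) auto
    also have "16 / 16 ^ n * (V * (2 ^ n) ^ 3) = 16 * V * (1 / 2) ^ n"
      unfolding p h by (simp add: field_simps power_divide)
    finally show "(\<integral>\<^sup>+(x::real^3). ennreal (16 / 16 ^ n) * indicator (cball 0 (2 ^ n)) x \<partial>lborel) = ennreal (16 * V * (1 / 2) ^ n)" .
  qed
  also have "\<dots> < \<infinity>"
    using V by (subst suminf_ennreal2) (auto intro!: summable_mult summable_geometric)
  finally show "(\<integral>\<^sup>+x. ennreal (norm (1 / (1 + (norm (x::real^3))\<^sup>2)\<^sup>2)) \<partial>lborel) < \<infinity>" .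
qed

lemma inverse_quadratic_le:
  fixes x :: "'a::euclidean_space"
  assumes "k > 0" "c > 0"
  shows "1 / (k + c * (norm x)\<^sup>2) \<le> 1 / min k c * (1 / (1 + (norm x)\<^sup>2))"
proof -
  have "min k c * (norm x)\<^sup>2 \<le> c * (norm x)\<^sup>2" by (intro mult_right_mono) auto
  then have "min k c * (1 + (norm x)\<^sup>2) \<le> k + c * (norm x)\<^sup>2" by (simp add: algebra_simps add_mono)
  moreover have "0 < min k c * (1 + (norm x)\<^sup>2)" using assms by (intro mult_pos_pos) (auto simp: add_pos_nonneg)
  ultimately have "1 / (k + c * (norm x)\<^sup>2) \<le> 1 / (min k c * (1 + (norm x)\<^sup>2))" by (intro divide_left_mono) auto
  then show ?thesis by simp
qed

lemma pos_quad: "k > 0 \<Longrightarrow> c \<ge> 0 \<Longrightarrow> (k::real) + c * (norm x)\<^sup>2 > 0"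
  by (simp add: add_pos_nonneg)

lemma integrable_inverse_quartic_scaled:
  assumes "k > 0" "c > 0"
  shows "integrable lborel (\<lambda>x::real^3. 1 / (k + c * (norm x)\<^sup>2)\<^sup>2)"
proof (rule Bochner_Integration.integrable_bound[OF integrable_mult_right[OF integrable_inverse_quartic, of "(1 / min k c)\<^sup>2"]])
  show "AE x::real^3 in lborel. norm (1 / (k + c * (norm x)\<^sup>2)\<^sup>2) \<le> norm ((1 / min k c)\<^sup>2 * (1 / (1 + (norm x)\<^sup>2)\<^sup>2))"
  proof (rule AE_I2)
    fix x :: "real^3"
    have "(1 / (k + c * (norm x)\<^sup>2))\<^sup>2 \<le> (1 / min k c * (1 / (1 + (norm x)\<^sup>2)))\<^sup>2"
      using inverse_quadratic_le[OF assms] assms by (intro power_mono) (auto intro!: add_nonneg_nonneg)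
    then show "norm (1 / (k + c * (norm x)\<^sup>2)\<^sup>2) \<le> norm ((1 / min k c)\<^sup>2 * (1 / (1 + (norm x)\<^sup>2)\<^sup>2))"
      by (simp add: power_mult_distrib power_divide)
  qed
qed simp

text \<open>With \<open>y\<close> the integrand,
  \<open>y \<le> 1 / (2 * q) + q * y\<^sup>2 / 2\<close>, and the integral of
  \<open>y\<^sup>2\<close> is finite. The first term integrates to a multiple of
  \<open>R^3 / q\<close>, the second to a multiple of \<open>q\<close>, so
  \<open>q = R * sqrt R\<close> balances them. The true order is \<open>R\<close>, but any order
  below \<open>R^2\<close> is enough against the Laplacian of the cutoff.\<close>

lemma integral_inverse_quadratic_growth:
  assumes "k > 0" "c > 0"
  obtains C where "C \<ge> 0"
    "\<And>R. R > 0 \<Longrightarrow> (LINT x::real^3|lborel. indicator (cball 0 R) x * (1 / (k + c * (norm x)\<^sup>2))) \<le> C * (R * sqrt R)"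
proof -
  define J where "J = (LINT x::real^3|lborel. 1 / (k + c * (norm x)\<^sup>2)\<^sup>2)"
  define V where "V = unit_ball_vol 3"
  have J0: "J \<ge> 0" unfolding J_def by (intro integral_nonneg_AE) auto
  have V: "V \<ge> 0" unfolding V_def by simp
  have "(LINT x::real^3|lborel. indicator (cball 0 R) x * (1 / (k + c * (norm x)\<^sup>2))) \<le> (V + J) / 2 * (R * sqrt R)"
    if R: "R > 0" for R
  proof -
    define q where "q = R * sqrt R"
    have q: "q > 0" using R unfolding q_def by simp
    have qq: "q * q = R ^ 3" unfolding q_def using R by (simp add: power3_eq_cube algebra_simps)
    have bd: "indicator (cball 0 R) x * (1 / (k + c * (norm x)\<^sup>2))
        \<le> (1 / (2 * q)) * indicator (cball 0 R) x + (q / 2) * (1 / (k + c * (norm x)\<^sup>2)\<^sup>2)" for x :: "real^3"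
    proof -
      define y where "y = 1 / (k + c * (norm x)\<^sup>2)"
      have "0 \<le> (1 - q * y)\<^sup>2" by simp
      then have "2 * q * y \<le> 1 + (q * y)\<^sup>2" by (simp add: power2_diff)
      then have "y \<le> 1 / (2 * q) + (q / 2) * y\<^sup>2" using q by (simp add: field_simps power2_eq_square)
      moreover have "y\<^sup>2 = 1 / (k + c * (norm x)\<^sup>2)\<^sup>2" unfolding y_def by (simp add: power_divide)
      ultimately show ?thesis using q unfolding y_def by (auto simp: indicator_def)
    qed
    have i1: "integrable lborel (\<lambda>x::real^3. (1 / (2 * q)) * indicator (cball 0 R) x)"
      by (rule integrable_indicator_cball)
    have i2: "integrable lborel (\<lambda>x::real^3. (q / 2) * (1 / (k + c * (norm x)\<^sup>2)\<^sup>2))"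
      by (intro integrable_mult_right integrable_inverse_quartic_scaled assms)
    have "(LINT x::real^3|lborel. indicator (cball 0 R) x * (1 / (k + c * (norm x)\<^sup>2)))
      \<le> (LINT x::real^3|lborel. (1 / (2 * q)) * indicator (cball 0 R) x + (q / 2) * (1 / (k + c * (norm x)\<^sup>2)\<^sup>2))"
    proof (rule integral_mono[OF _ Bochner_Integration.integrable_add[OF i1 i2]])
      show "integrable lborel (\<lambda>x::real^3. indicator (cball 0 R) x * (1 / (k + c * (norm x)\<^sup>2)))"
        by (rule Bochner_Integration.integrable_bound[OF Bochner_Integration.integrable_add[OF i1 i2]])
           (measurable, use bd pos_quad[OF assms(1)] assms in \<open>auto intro!: AE_I2 order_trans[OF _ abs_ge_self] simp: abs_mult less_imp_le\<close>)
    qed (use bd in auto)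
    also have "\<dots> = (1 / (2 * q)) * (V * R ^ 3) + (q / 2) * J"
      using R unfolding J_def by (subst Bochner_Integration.integral_add[OF i1 i2], subst (1 2) integral_mult_right_zero) (simp add: V_def content_cball)
    also have "\<dots> = (V + J) / 2 * q" using q by (simp add: qq[symmetric] field_simps)
    finally show ?thesis unfolding q_def .
  qed
  then show ?thesis using that[of "(V + J) / 2"] V J0 by simp
qed

section \<open>A regularised Newton kernel and the mean value property\<close>

text \<open>The second-order Taylor polynomial of \<open>s powr (-1/2)\<close> at 1 replaces the singularity, so that
  \<open>newton_reg \<sigma>\<close> is a \<open>C\<^sup>2\<close> regularisation of the Newton kernel \<open>1 / norm x\<close>, equal to it for \<open>norm x \<ge> \<sigma>\<close>.\<close>

definition reg0 :: "real \<Rightarrow> real" where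
  "reg0 s = (if s \<ge> 1 then s powr (- 1 / 2) else 15 / 8 - 5 / 4 * s + 3 / 8 * s\<^sup>2)"

definition reg1 :: "real \<Rightarrow> real" where
  "reg1 s = (if s \<ge> 1 then - 1 / 2 * s powr (- 3 / 2) else - 5 / 4 + 3 / 4 * s)"

definition reg2 :: "real \<Rightarrow> real" where
  "reg2 s = (if s \<ge> 1 then 3 / 4 * s powr (- 5 / 2) else 3 / 4)"

lemma reg_derivatives:
  "(reg0 has_real_derivative reg1 s) (at s)" "(reg1 has_real_derivative reg2 s) (at s)"
proof -
  have e: "- 1 / 2 - 1 = - 3 / (2::real)" "- 3 / 2 - 1 = - 5 / (2::real)" by auto
  show "(reg0 has_real_derivative reg1 s) (at s)"
    unfolding reg0_def[abs_def] reg1_def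
    by (rule has_real_derivative_glue_everywhere)
       (auto intro!: derivative_eq_intros simp flip: e)
  show "(reg1 has_real_derivative reg2 s) (at s)"
    unfolding reg1_def[abs_def] reg2_def
    by (rule has_real_derivative_glue_everywhere)
       (auto intro!: derivative_eq_intros simp flip: e)
qed

lemma continuous_on_glue:
  fixes f g :: "real \<Rightarrow> real"
  assumes "continuous_on {c..} f" "continuous_on {..c} g" "f c = g c"
  shows "continuous_on UNIV (\<lambda>s. if s \<ge> c then f s else g s)"
proof -
  have "continuous_on ({c..} \<union> {..c}) (\<lambda>s. if s \<ge> c then f s else g s)"
    by (intro continuous_on_If) (use assms in auto)
  moreover have "{c..} \<union> {..c} = UNIV" by auto
  ultimately show ?thesis by simp
qed

lemma continuous_on_reg: "continuous_on UNIV reg0" "continuous_on UNIV reg1" "continuous_on UNIV reg2"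
proof -
  show "continuous_on UNIV reg0" "continuous_on UNIV reg1"
    using reg_derivatives by (auto intro!: DERIV_continuous_on)
  show "continuous_on UNIV reg2"
    unfolding reg2_def[abs_def] by (rule continuous_on_glue) (auto intro!: continuous_intros)
qed

definition newton_reg :: "real \<Rightarrow> 'a::euclidean_space \<Rightarrow> real" where
  "newton_reg \<sigma> x = reg0 ((norm x)\<^sup>2 / \<sigma>\<^sup>2) / \<sigma>"

definition newton_reg1 :: "real \<Rightarrow> 'a::euclidean_space \<Rightarrow> 'a \<Rightarrow> real" where
  "newton_reg1 \<sigma> b x = reg1 ((norm x)\<^sup>2 / \<sigma>\<^sup>2) * (2 * (x \<bullet> b) / \<sigma>\<^sup>2) / \<sigma>"

definition newton_reg2 :: "real \<Rightarrow> 'a::euclidean_space \<Rightarrow> 'a \<Rightarrow> real" where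
  "newton_reg2 \<sigma> b x = (reg2 ((norm x)\<^sup>2 / \<sigma>\<^sup>2) * (2 * (x \<bullet> b) / \<sigma>\<^sup>2)\<^sup>2
     + reg1 ((norm x)\<^sup>2 / \<sigma>\<^sup>2) * (2 / \<sigma>\<^sup>2)) / \<sigma>"

text \<open>Minus the Laplacian of \<open>newton_reg \<sigma>\<close> in dimension 3, that is, the
  point mass of the Newton kernel smeared over the ball of radius \<open>\<sigma>\<close>; its total
  mass does not depend on \<open>\<sigma>\<close>.\<close>

definition bump :: "real \<Rightarrow> 'a::euclidean_space \<Rightarrow> real" where
  "bump \<sigma> x = 15 / (2 * \<sigma> ^ 3) * max 0 (1 - (norm x)\<^sup>2 / \<sigma>\<^sup>2)"

lemma has_dd_newton_reg:
  "has_dd (newton_reg \<sigma>) b (newton_reg1 \<sigma> b)"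
  "norm b = 1 \<Longrightarrow> has_dd (newton_reg1 \<sigma> b) b (newton_reg2 \<sigma> b)"
  using has_dd_mult[OF has_dd_radial(1)[OF reg_derivatives] has_dd_const[of "1 / \<sigma>"], of \<sigma> b]
    has_dd_mult[OF has_dd_radial(2)[OF reg_derivatives] has_dd_const[of "1 / \<sigma>"], of b \<sigma>]
  unfolding newton_reg_def[abs_def] newton_reg1_def[abs_def] newton_reg2_def[abs_def] by simp_all

lemma continuous_on_newton_reg:
  fixes b :: "'z::euclidean_space"
  shows "continuous_on UNIV (newton_reg \<sigma> :: 'z \<Rightarrow> real)" "continuous_on UNIV (newton_reg1 \<sigma> b)" "continuous_on UNIV (newton_reg2 \<sigma> b)"
proof -
  have c: "continuous_on UNIV (\<lambda>x::'z::euclidean_space. (norm x)\<^sup>2 / \<sigma>\<^sup>2)"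
    unfolding divide_inverse by (intro continuous_intros)
  have r: "continuous_on UNIV (\<lambda>x::'z::euclidean_space. reg0 ((norm x)\<^sup>2 / \<sigma>\<^sup>2))"
    "continuous_on UNIV (\<lambda>x::'z::euclidean_space. reg1 ((norm x)\<^sup>2 / \<sigma>\<^sup>2))"
    "continuous_on UNIV (\<lambda>x::'z::euclidean_space. reg2 ((norm x)\<^sup>2 / \<sigma>\<^sup>2))"
    using continuous_on_compose2[OF continuous_on_reg(1) c subset_UNIV]
      continuous_on_compose2[OF continuous_on_reg(2) c subset_UNIV]
      continuous_on_compose2[OF continuous_on_reg(3) c subset_UNIV] by auto
  have "continuous_on UNIV (newton_reg \<sigma> :: 'z \<Rightarrow> real)"
    "continuous_on UNIV (newton_reg1 \<sigma> b' :: 'z \<Rightarrow> real)"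
    "continuous_on UNIV (newton_reg2 \<sigma> b' :: 'z \<Rightarrow> real)" for b'
    unfolding newton_reg_def[abs_def] newton_reg1_def[abs_def] newton_reg2_def[abs_def] divide_inverse[of _ \<sigma>] divide_inverse[of "2 * _"]
    by (intro continuous_intros r)+
  then show "continuous_on UNIV (newton_reg \<sigma> :: 'z \<Rightarrow> real)"
    "continuous_on UNIV (newton_reg1 \<sigma> b :: 'z \<Rightarrow> real)"
    "continuous_on UNIV (newton_reg2 \<sigma> b :: 'z \<Rightarrow> real)" by auto
qed

lemma continuous_on_bump: "continuous_on UNIV (bump \<sigma>)"
  unfolding bump_def[abs_def] divide_inverse[of "(_)\<^sup>2"] by (intro continuous_intros)

lemma bump_nonneg: "\<sigma> > 0 \<Longrightarrow> 0 \<le> bump \<sigma> x"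
  unfolding bump_def by simp

lemma bump_le: "\<sigma> > 0 \<Longrightarrow> bump \<sigma> x \<le> 15 / (2 * \<sigma> ^ 3)"
  unfolding bump_def by (intro mult_right_le_one_le) auto

lemma bump_supp:
  assumes "\<sigma> > 0" "norm x > \<sigma>"
  shows "bump \<sigma> x = 0"
proof -
  have "(norm x)\<^sup>2 / \<sigma>\<^sup>2 > 1" using assms by (simp add: power_strict_mono)
  then show ?thesis unfolding bump_def by simp
qed

lemma integrable_bump: "\<sigma> > 0 \<Longrightarrow> integrable lborel (bump \<sigma>)"
  by (rule integrable_continuous_cball[OF continuous_on_bump bump_supp])

lemma laplacian_newton_reg:
  fixes x :: "real^3"
  assumes "\<sigma> > 0"
  shows "(\<Sum>b\<in>Basis. newton_reg2 \<sigma> b x) = - bump \<sigma> x"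
proof -
  let ?s = "(norm x)\<^sup>2 / \<sigma>\<^sup>2"
  have "(\<Sum>b\<in>Basis. newton_reg2 \<sigma> b x) = (4 * reg2 ?s * ?s + 6 * reg1 ?s) / \<sigma>\<^sup>2 / \<sigma>"
    unfolding newton_reg2_def sum_divide_distrib[symmetric]
    using laplacian_radial[of \<sigma> "reg2 ?s" x "reg1 ?s"] assms by simp
  \<comment> \<open>For \<open>s \<ge> 1\<close> the terms \<open>3 * s powr (- 3 / 2)\<close> and
    \<open>- 3 * s powr (- 3 / 2)\<close> cancel, as \<open>1 / norm x\<close> is harmonic in
    dimension 3; for \<open>s < 1\<close> the affine remainder is
    \<open>- 15 / 2 + 15 / 2 * s\<close>.\<close>
  also have "4 * reg2 s * s + 6 * reg1 s = - (15 / 2) * max 0 (1 - s)" for s :: real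
  proof (cases "s \<ge> 1")
    case True
    then have "s powr (- 5 / 2) * s = s powr (- 5 / 2 + 1)" unfolding powr_add by simp
    then show ?thesis using True unfolding reg1_def reg2_def by simp
  next
    case False
    then show ?thesis unfolding reg1_def reg2_def by (simp add: field_simps)
  qed
  finally show ?thesis using assms unfolding bump_def by (simp add: power2_eq_square power3_eq_cube)
qed

text \<open>In the variable \<open>a = 1 / \<sigma>\<close> the kernel is \<open>M a\<close>, with
  derivative \<open>reg0 s + 2 * s * reg1 s\<close>. This vanishes for \<open>s \<ge> 1\<close>,
  where the kernel is the exact Newton kernel, and equals \<open>15 / 8 * (1 - s)^2\<close>
  inside.\<close>

lemma newton_reg_antimono:
  assumes "0 < \<sigma>" "\<sigma> \<le> r"
  shows "newton_reg r x \<le> newton_reg \<sigma> x"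
proof -
  define M where "M a = reg0 ((norm x)\<^sup>2 * a\<^sup>2) * a" for a
  have "M (1 / r) \<le> M (1 / \<sigma>)"
  proof (rule DERIV_nonneg_imp_nondecreasing[where f=M])
    show "1 / r \<le> 1 / \<sigma>" using assms by (simp add: frac_le)
    fix a
    let ?s = "(norm x)\<^sup>2 * a\<^sup>2"
    have "((\<lambda>a. reg0 ((norm x)\<^sup>2 * a\<^sup>2)) has_real_derivative reg1 ?s * ((norm x)\<^sup>2 * (2 * a))) (at a)"
      by (rule DERIV_chain2[OF reg_derivatives(1)]) (auto intro!: derivative_eq_intros)
    then have D: "(M has_real_derivative reg1 ?s * ((norm x)\<^sup>2 * (2 * a)) * a + reg0 ?s) (at a)"
      unfolding M_def by (auto intro!: derivative_eq_intros)
    have "2 * s * reg1 s + reg0 s \<ge> 0" for s :: real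
    proof (cases "s \<ge> 1")
      case True
      then have "s powr (- 3 / 2) * s = s powr (- 3 / 2 + 1)" unfolding powr_add by simp
      then show ?thesis using True unfolding reg1_def reg0_def by (simp add: mult_ac)
    next
      case False
      then have "2 * s * reg1 s + reg0 s = 15 / 8 * (1 - s)\<^sup>2"
        unfolding reg1_def reg0_def by (simp add: algebra_simps power2_eq_square)
      moreover have "0 \<le> 15 / 8 * (1 - s)\<^sup>2" by simp
      ultimately show ?thesis by (simp only:)
    qed
    from this[of ?s] D show "\<exists>y. (M has_real_derivative y) (at a) \<and> 0 \<le> y"
      by (auto simp: power2_eq_square algebra_simps)
  qed
  then show ?thesis unfolding M_def newton_reg_def by (simp add: power_divide)
qed

lemma newton_reg_outside:
  assumes "\<sigma> > 0" "norm x \<ge> \<sigma>"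
  shows "newton_reg \<sigma> x = 1 / norm x"
proof -
  have "(norm x)\<^sup>2 / \<sigma>\<^sup>2 \<ge> 1" using assms by (simp add: power_mono)
  then have "newton_reg \<sigma> x = ((norm x / \<sigma>)\<^sup>2) powr (- 1 / 2) / \<sigma>"
    unfolding newton_reg_def reg0_def by (simp add: power_divide)
  also have "((norm x / \<sigma>)\<^sup>2) powr (- 1 / 2) = (norm x / \<sigma>) powr (2 * (- 1 / 2))"
    using assms by (subst powr_powr[symmetric]) simp
  also have "\<dots> = \<sigma> / norm x" using assms by (simp add: powr_minus)
  finally show ?thesis using assms by simp
qed

text \<open>A substitute for the Green function of the ball of radius \<open>r\<close>: for
  \<open>0 < \<sigma> \<le> r\<close> it is nonnegative, vanishes outside this ball, and in
  dimension 3 has Laplacian \<open>bump r - bump \<sigma>\<close>.\<close>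

definition newton_diff :: "real \<Rightarrow> real \<Rightarrow> 'a::euclidean_space \<Rightarrow> real" where
  "newton_diff \<sigma> r x = newton_reg \<sigma> x - newton_reg r x"

lemma newton_diff_supp: "0 < \<sigma> \<Longrightarrow> \<sigma> \<le> r \<Longrightarrow> norm x > r \<Longrightarrow> newton_diff \<sigma> r x = 0"
  unfolding newton_diff_def by (simp add: newton_reg_outside)

lemma newton_diff_nonneg: "0 < \<sigma> \<Longrightarrow> \<sigma> \<le> r \<Longrightarrow> 0 \<le> newton_diff \<sigma> r x"
  unfolding newton_diff_def by (simp add: newton_reg_antimono)

lemma continuous_on_newton_diff: "continuous_on UNIV (newton_diff \<sigma> r)"
  unfolding newton_diff_def[abs_def] by (intro continuous_intros continuous_on_newton_reg)

text \<open>Green's identity with \<open>newton_diff \<sigma> r\<close>. As \<open>\<sigma>\<close>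
  tends to 0 the last term tends to \<open>bump_mass * f 0\<close>, so this becomes a mean value
  formula with the continuous weight \<open>bump r\<close> and an explicit remainder in the
  Laplacian.\<close>

lemma mean_value_identity:
  fixes f :: "real^3 \<Rightarrow> real"
  assumes f: "\<And>b. b \<in> Basis \<Longrightarrow> has_dd f b (f1 b)" "\<And>b. b \<in> Basis \<Longrightarrow> has_dd (f1 b) b (f2 b)"
    and cf: "continuous_on UNIV f" "\<And>b. b \<in> Basis \<Longrightarrow> continuous_on UNIV (f1 b)" "\<And>b. b \<in> Basis \<Longrightarrow> continuous_on UNIV (f2 b)"
    and r: "0 < \<sigma>" "\<sigma> \<le> r"
  shows "(LINT x|lborel. newton_diff \<sigma> r x * (\<Sum>b\<in>Basis. f2 b x))
    = (LINT x|lborel. bump r x * f x) - (LINT x|lborel. bump \<sigma> x * f x)"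
proof -
  define p1 where "p1 b x = newton_reg1 \<sigma> b x - newton_reg1 r b x" for b x :: "real^3"
  define p2 where "p2 b x = newton_reg2 \<sigma> b x - newton_reg2 r b x" for b x :: "real^3"
  have d1: "has_dd (newton_diff \<sigma> r) b (p1 b)" for b
    unfolding newton_diff_def[abs_def] p1_def[abs_def] by (intro has_dd_diff has_dd_newton_reg)
  have d2: "has_dd (p1 b) b (p2 b)" if "b \<in> Basis" for b
    unfolding p2_def[abs_def] p1_def[abs_def] using that by (intro has_dd_diff has_dd_newton_reg) auto
  have s1: "p1 b x = 0" if "norm x > r" for b x
    using has_dd_zero_outside[OF d1 newton_diff_supp[OF r] that] by blast
  have s2: "p2 b x = 0" if "norm x > r" "b \<in> Basis" for b x
    using has_dd_zero_outside[OF d2 s1 that(1)] that(2) by blast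
  have r0: "r > 0" using r by simp
  have c: "continuous_on UNIV (p1 b)" "continuous_on UNIV (p2 b)" for b
    unfolding p1_def[abs_def] p2_def[abs_def] by (intro continuous_intros continuous_on_newton_reg)+
  have "(LINT x|lborel. newton_diff \<sigma> r x * (\<Sum>b\<in>Basis. f2 b x)) = (LINT x|lborel. f x * (\<Sum>b\<in>Basis. p2 b x))"
    by (rule green_identity[where R=r, OF f d1 d2 cf continuous_on_newton_diff c(1) c(2) newton_diff_supp[OF r] s1 s2])
  also have "(\<lambda>x. \<Sum>b\<in>Basis. p2 b x) = (\<lambda>x. bump r x - bump \<sigma> x)"
    unfolding p2_def by (simp add: sum_subtractf laplacian_newton_reg r r0)
  also have "(LINT x|lborel. f x * (bump r x - bump \<sigma> x)) = (LINT x|lborel. bump r x * f x - bump \<sigma> x * f x)"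
    by (simp add: algebra_simps)
  also have "\<dots> = (LINT x|lborel. bump r x * f x) - (LINT x|lborel. bump \<sigma> x * f x)"
    using bump_supp[OF r(1)] bump_supp[OF r0]
    by (intro Bochner_Integration.integral_diff integrable_continuous_cball)
       (auto intro!: continuous_intros continuous_on_bump cf)
  finally show ?thesis .
qed

text \<open>The value is 4 * \<pi>, kept symbolic.\<close>

definition bump_mass :: real where
  "bump_mass = (LINT x::real^3|lborel. bump 1 x)"

text \<open>The mean value identity for the constant function 1, whose Laplacian vanishes.\<close>

lemma integral_bump:
  assumes "\<sigma> > 0"
  shows "(LINT x::real^3|lborel. bump \<sigma> x) = bump_mass"
proof -
  have *: "(LINT x::real^3|lborel. bump r x) = (LINT x::real^3|lborel. bump \<sigma> x)" if r: "0 < \<sigma>" "\<sigma> \<le> r" for \<sigma> r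
    using mean_value_identity[OF has_dd_const[of 1] has_dd_const[of 0] _ _ _ r] by simp
  show ?thesis unfolding bump_mass_def using *[of 1 \<sigma>] *[of \<sigma> 1] assms by (cases "\<sigma> \<ge> 1") auto
qed

lemma bump_mass_pos: "bump_mass > 0"
proof -
  have "(LINT x::real^3|lborel. 5 * indicator (cball 0 (1 / 2)) x) \<le> bump_mass"
    unfolding bump_mass_def
  proof (rule integral_mono[OF integrable_indicator_cball integrable_bump])
    fix x :: "real^3"
    show "5 * indicator (cball 0 (1 / 2)) x \<le> bump 1 x"
    proof (cases "norm x \<le> 1 / 2")
      case True
      then have "(norm x)\<^sup>2 \<le> (1 / 2)\<^sup>2" by (intro power_mono) auto
      then show ?thesis using True unfolding bump_def by (simp add: power2_eq_square)
    qed (simp add: bump_nonneg)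
  qed simp
  moreover have "(LINT x::real^3|lborel. 5 * indicator (cball 0 (1 / 2)) x) > (0::real)"
    by simp
  ultimately show ?thesis by linarith
qed

text \<open>The mean value identity for \<open>(norm x)\<^sup>2\<close>, whose Laplacian is 6 in
  dimension 3, expresses the integral through second moments of the bumps; the one of
  \<open>bump r\<close> is at most \<open>r\<^sup>2 * bump_mass\<close>.\<close>

lemma integral_newton_diff_le:
  assumes r: "0 < \<sigma>" "\<sigma> \<le> r"
  shows "(LINT x::real^3|lborel. newton_diff \<sigma> r x) \<le> bump_mass * r\<^sup>2 / 6"
proof -
  have r0: "r > 0" using r by simp
  have d2: "has_dd (\<lambda>x::real^3. 2 * (x \<bullet> b)) b (\<lambda>x. 2)" if "b \<in> Basis" for b
    using has_dd_mult[OF has_dd_const[of 2] has_dd_inner[of b], of b] that by simp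
  have "6 * (LINT x::real^3|lborel. newton_diff \<sigma> r x) = (LINT x::real^3|lborel. newton_diff \<sigma> r x * (\<Sum>b\<in>(Basis::(real^3) set). 2))"
    by simp
  also have "\<dots> = (LINT x::real^3|lborel. bump r x * (norm x)\<^sup>2) - (LINT x::real^3|lborel. bump \<sigma> x * (norm x)\<^sup>2)"
    by (rule mean_value_identity[OF has_dd_norm2 d2 _ _ _ r]) (auto intro!: continuous_intros)
  also have "\<dots> \<le> (LINT x::real^3|lborel. bump r x * (norm x)\<^sup>2)"
    using r by (auto intro!: integral_nonneg_AE mult_nonneg_nonneg bump_nonneg)
  also have "\<dots> \<le> (LINT x::real^3|lborel. r\<^sup>2 * bump r x)"
  proof (rule integral_mono)
    show "integrable lborel (\<lambda>x::real^3. bump r x * (norm x)\<^sup>2)"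
      using bump_supp[OF r0] by (intro integrable_continuous_cball[where R=r]) (auto intro!: continuous_intros continuous_on_bump)
    show "integrable lborel (\<lambda>x::real^3. r\<^sup>2 * bump r x)" by (intro integrable_mult_right integrable_bump r0)
    show "bump r x * (norm x)\<^sup>2 \<le> r\<^sup>2 * bump r x" for x :: "real^3"
      using bump_supp[OF r0, of x] bump_nonneg[OF r0, of x]
      by (cases "norm x \<le> r") (auto simp: mult.commute intro!: mult_left_mono power_mono)
  qed
  also have "\<dots> = r\<^sup>2 * bump_mass" using integral_bump[OF r0] by simp
  finally show ?thesis by (simp add: mult.commute)
qed

section \<open>A weighted Poincare inequality\<close>

lemma has_dd_uminus_direction: "has_dd f b f' \<Longrightarrow> has_dd f (- b) (\<lambda>x. - f' x)"
  unfolding has_dd_def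
proof
  fix x assume "\<forall>x. ((\<lambda>h. f (x + h *\<^sub>R b)) has_real_derivative f' x) (at 0)"
  then have 1: "((\<lambda>h. f (x + h *\<^sub>R b)) has_real_derivative f' x) (at (- 0))" by simp
  have "((\<lambda>h. f (x + (- h) *\<^sub>R b)) has_real_derivative f' x * (- 1)) (at 0)"
    by (rule DERIV_chain2[where f="\<lambda>h. f (x + h *\<^sub>R b)" and g="\<lambda>h. - h", OF 1]) (auto intro!: derivative_eq_intros)
  then show "((\<lambda>h. f (x + h *\<^sub>R - b)) has_real_derivative - f' x) (at 0)" by simp
qed

lemma pred_in_cball [measurable]:
  fixes c :: "'a::euclidean_space"
  assumes [measurable]: "f \<in> borel_measurable M"
  shows "Measurable.pred M (\<lambda>x. f x \<in> cball c r)"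
  unfolding mem_cball by measurable

lemma nn_integral_shift_cball_le:
  fixes F :: "'a::euclidean_space \<Rightarrow> ennreal"
  assumes [measurable]: "F \<in> borel_measurable borel" and "norm c \<le> s"
  shows "(\<integral>\<^sup>+x. indicator (cball 0 r) x * F (x + c) \<partial>lborel) \<le> (\<integral>\<^sup>+x. indicator (cball 0 (r + s)) x * F x \<partial>lborel)"
proof -
  have "(\<integral>\<^sup>+x. indicator (cball 0 r) x * F (x + c) \<partial>lborel) \<le> (\<integral>\<^sup>+x. indicator (cball 0 (r + s)) (c + 1 *\<^sub>R x) * F (c + 1 *\<^sub>R x) \<partial>lborel)"
  proof (rule nn_integral_mono)
    fix x :: 'a
    have "norm (c + x) \<le> r + s" if "norm x \<le> r" using norm_triangle_ineq[of c x] that assms(2) by linarith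
    then show "indicator (cball 0 r) x * F (x + c) \<le> indicator (cball 0 (r + s)) (c + 1 *\<^sub>R x) * F (c + 1 *\<^sub>R x)"
      by (auto simp: indicator_def add.commute)
  qed
  also have "\<dots> = (\<integral>\<^sup>+x. indicator (cball 0 (r + s)) x * F x \<partial>lborel)"
  proof -
    have "(\<lambda>x. indicator (cball 0 (r + s)) x * F x) \<in> borel_measurable borel" by measurable
    from lborel_nn_integral_affine[OF this, of 1 c] show ?thesis by simp
  qed
  finally show ?thesis .
qed

text \<open>The fundamental theorem of calculus on the segment from \<open>x\<close> to
  \<open>x + s *\<^sub>R b\<close>, followed by Tonelli and a translation; the translated ball lies
  in the one enlarged by \<open>\<bar>s\<bar>\<close>. Nonnegative extended integrals avoid all
  questions of integrability.\<close>

lemma axis_shift_bound: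
  fixes a :: "'a::euclidean_space \<Rightarrow> real"
  assumes dd: "has_dd a b G" and cont: "continuous_on UNIV a" "continuous_on UNIV G" and b: "norm b = 1"
  shows "(\<integral>\<^sup>+x. indicator (cball 0 r) x * ennreal \<bar>a (x + s *\<^sub>R b) - a x\<bar> \<partial>lborel)
    \<le> ennreal \<bar>s\<bar> * (\<integral>\<^sup>+x. indicator (cball 0 (r + \<bar>s\<bar>)) x * ennreal \<bar>G x\<bar> \<partial>lborel)"
proof -
  have pos: "(\<integral>\<^sup>+x. indicator (cball 0 r) x * ennreal \<bar>a (x + s *\<^sub>R b) - a x\<bar> \<partial>lborel)
      \<le> ennreal s * (\<integral>\<^sup>+x. indicator (cball 0 (r + s)) x * ennreal \<bar>G x\<bar> \<partial>lborel)"
    if dd: "has_dd a b G" and cG: "continuous_on UNIV G" and b: "norm b = 1" and s: "s \<ge> 0" for b G s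
  proof -
    note [measurable] = borel_of_continuous[OF cont(1)] borel_of_continuous[OF cG]
    have pt: "ennreal \<bar>a (x + s *\<^sub>R b) - a x\<bar> \<le> (\<integral>\<^sup>+\<tau>. indicator {0..s} \<tau> * ennreal \<bar>G (x + \<tau> *\<^sub>R b)\<bar> \<partial>lborel)" for x
    proof -
      have "continuous_on {0..s} (\<lambda>\<tau>. G (x + \<tau> *\<^sub>R b))"
        by (intro continuous_on_compose2[OF cG] continuous_intros) auto
      then have "has_bochner_integral lborel (\<lambda>\<tau>. indicator {0..s} \<tau> *\<^sub>R G (x + \<tau> *\<^sub>R b)) (a (x + s *\<^sub>R b) - a (x + 0 *\<^sub>R b))"
        by (intro has_bochner_integral_FTC_Icc[where F="\<lambda>h. a (x + h *\<^sub>R b)"] s)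
           (auto intro!: has_field_derivative_at_within[OF has_dd_at[OF dd]] simp flip: has_real_derivative_iff_has_vector_derivative)
      then have "integrable lborel (\<lambda>\<tau>. indicator {0..s} \<tau> *\<^sub>R G (x + \<tau> *\<^sub>R b))"
        "(LINT \<tau>|lborel. indicator {0..s} \<tau> *\<^sub>R G (x + \<tau> *\<^sub>R b)) = a (x + s *\<^sub>R b) - a x"
        by (auto simp: has_bochner_integral_iff)
      then have "ennreal \<bar>a (x + s *\<^sub>R b) - a x\<bar> \<le> (\<integral>\<^sup>+\<tau>. norm (indicator {0..s} \<tau> *\<^sub>R G (x + \<tau> *\<^sub>R b)) \<partial>lborel)"
        using integral_norm_bound_ennreal[of lborel "\<lambda>\<tau>. indicator {0..s} \<tau> *\<^sub>R G (x + \<tau> *\<^sub>R b)"] by simp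
      also have "\<dots> = (\<integral>\<^sup>+\<tau>. indicator {0..s} \<tau> * ennreal \<bar>G (x + \<tau> *\<^sub>R b)\<bar> \<partial>lborel)"
        by (intro nn_integral_cong) (auto simp: indicator_def)
      finally show ?thesis .
    qed
    have "(\<integral>\<^sup>+x. indicator (cball 0 r) x * ennreal \<bar>a (x + s *\<^sub>R b) - a x\<bar> \<partial>lborel)
       \<le> (\<integral>\<^sup>+x. indicator (cball 0 r) x * (\<integral>\<^sup>+\<tau>. indicator {0..s} \<tau> * ennreal \<bar>G (x + \<tau> *\<^sub>R b)\<bar> \<partial>lborel) \<partial>lborel)"
      by (intro nn_integral_mono mult_left_mono pt) simp
    also have "\<dots> = (\<integral>\<^sup>+x. (\<integral>\<^sup>+\<tau>. indicator (cball 0 r) x * (indicator {0..s} \<tau> * ennreal \<bar>G (x + \<tau> *\<^sub>R b)\<bar>) \<partial>lborel) \<partial>lborel)"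
      by (intro nn_integral_cong nn_integral_cmult[symmetric]) measurable
    also have "\<dots> = (\<integral>\<^sup>+\<tau>. (\<integral>\<^sup>+x. indicator (cball 0 r) x * (indicator {0..s} \<tau> * ennreal \<bar>G (x + \<tau> *\<^sub>R b)\<bar>) \<partial>lborel) \<partial>lborel)"
      by (rule lborel_pair.Fubini'[symmetric]) measurable
    also have "\<dots> = (\<integral>\<^sup>+\<tau>. indicator {0..s} \<tau> * (\<integral>\<^sup>+x. indicator (cball 0 r) x * ennreal \<bar>G (x + \<tau> *\<^sub>R b)\<bar> \<partial>lborel) \<partial>lborel)"
      by (intro nn_integral_cong, subst nn_integral_cmult[symmetric], measurable)
         (simp add: mult_ac)
    also have "\<dots> \<le> (\<integral>\<^sup>+\<tau>. indicator {0..s} \<tau> * (\<integral>\<^sup>+x. indicator (cball 0 (r + s)) x * ennreal \<bar>G x\<bar> \<partial>lborel) \<partial>lborel)"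
    proof (rule nn_integral_mono)
      fix \<tau> :: real
      show "indicator {0..s} \<tau> * (\<integral>\<^sup>+x. indicator (cball 0 r) x * ennreal \<bar>G (x + \<tau> *\<^sub>R b)\<bar> \<partial>lborel)
        \<le> indicator {0..s} \<tau> * (\<integral>\<^sup>+x. indicator (cball 0 (r + s)) x * ennreal \<bar>G x\<bar> \<partial>lborel)"
      proof (cases "\<tau> \<in> {0..s}")
        case True
        then have "norm (\<tau> *\<^sub>R b) \<le> s" using b by simp
        then show ?thesis using True by (intro mult_left_mono nn_integral_shift_cball_le) auto
      qed simp
    qed
    also have "\<dots> = ennreal s * (\<integral>\<^sup>+x. indicator (cball 0 (r + s)) x * ennreal \<bar>G x\<bar> \<partial>lborel)"
      using s by (subst nn_integral_multc) auto
    finally show ?thesis .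
  qed
  show ?thesis
  proof (cases "s \<ge> 0")
    case True
    then show ?thesis using pos[OF dd cont(2) b True] by simp
  next
    case False
    then show ?thesis
      using pos[OF has_dd_uminus_direction[OF dd], of "- s"] cont(2) b by (simp add: continuous_on_minus)
  qed
qed

text \<open>The shift by \<open>h\<close> is carried out one coordinate at a time, by induction over
  the set of directions already used. Each of the \<open>DIM('a)\<close> steps is no longer than
  \<open>norm h\<close>, hence the condition on the radius \<open>\<rho>\<close>.\<close>

lemma shift_bound:
  fixes a :: "'a::euclidean_space \<Rightarrow> real"
  assumes dd: "\<And>b. b \<in> Basis \<Longrightarrow> has_dd a b (G b)" and cont: "continuous_on UNIV a" "\<And>b. b \<in> Basis \<Longrightarrow> continuous_on UNIV (G b)"
    and \<rho>: "r + real DIM('a) * norm h \<le> \<rho>"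
  shows "(\<integral>\<^sup>+x. indicator (cball 0 r) x * ennreal \<bar>a (x + h) - a x\<bar> \<partial>lborel)
    \<le> ennreal (norm h) * (\<Sum>b\<in>Basis. \<integral>\<^sup>+x. indicator (cball 0 \<rho>) x * ennreal \<bar>G b x\<bar> \<partial>lborel)"
proof -
  note [measurable] = borel_of_continuous[OF cont(1)]
  define N where "N b = (\<integral>\<^sup>+x. indicator (cball 0 \<rho>) x * ennreal \<bar>G b x\<bar> \<partial>lborel)" for b
  have "(\<integral>\<^sup>+x. indicator (cball 0 r) x * ennreal \<bar>a (x + (\<Sum>b\<in>S. (h \<bullet> b) *\<^sub>R b)) - a x\<bar> \<partial>lborel)
      \<le> ennreal (norm h) * (\<Sum>b\<in>S. N b)" if S: "S \<subseteq> Basis" for S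
    using finite_subset[OF S finite_Basis] S
  proof (induction S rule: finite_induct)
    case (insert b S)
    let ?c = "\<Sum>b\<in>S. (h \<bullet> b) *\<^sub>R b"
    have b: "b \<in> Basis" "norm b = 1" using insert.prems by auto
    have nS: "norm ?c \<le> real (card S) * norm h"
    proof -
      have "norm ?c \<le> (\<Sum>b\<in>S. norm h)"
      proof (rule sum_norm_le)
        fix b assume "b \<in> S"
        then have "b \<in> Basis" using insert.prems by auto
        then show "norm ((h \<bullet> b) *\<^sub>R b) \<le> norm h" using Basis_le_norm[of b h] by simp
      qed
      then show ?thesis by simp
    qed
    have "card (insert b S) \<le> DIM('a)" using insert.prems by (intro card_mono) auto
    then have "real (card S) + 1 \<le> real DIM('a)" using insert.hyps by simp
    then have "(real (card S) + 1) * norm h \<le> real DIM('a) * norm h" by (rule mult_right_mono) simp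
    then have rad: "r + real (card S) * norm h + norm h \<le> \<rho>" using \<rho> by (simp add: distrib_right)
    have hb: "\<bar>h \<bullet> b\<bar> \<le> norm h" using Basis_le_norm[OF b(1)] .
    have "(\<integral>\<^sup>+x. indicator (cball 0 r) x * ennreal \<bar>a (x + (\<Sum>b\<in>insert b S. (h \<bullet> b) *\<^sub>R b)) - a x\<bar> \<partial>lborel)
      \<le> (\<integral>\<^sup>+x. indicator (cball 0 r) x * ennreal \<bar>a ((x + ?c) + (h \<bullet> b) *\<^sub>R b) - a (x + ?c)\<bar>
           + indicator (cball 0 r) x * ennreal \<bar>a (x + ?c) - a x\<bar> \<partial>lborel)"
    proof (rule nn_integral_mono)
      fix x
      have "\<bar>a (x + (\<Sum>b\<in>insert b S. (h \<bullet> b) *\<^sub>R b)) - a x\<bar> \<le> \<bar>a ((x + ?c) + (h \<bullet> b) *\<^sub>R b) - a (x + ?c)\<bar> + \<bar>a (x + ?c) - a x\<bar>"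
        using insert.hyps by (simp add: add_ac)
      then have "ennreal \<bar>a (x + (\<Sum>b\<in>insert b S. (h \<bullet> b) *\<^sub>R b)) - a x\<bar> \<le> ennreal \<bar>a ((x + ?c) + (h \<bullet> b) *\<^sub>R b) - a (x + ?c)\<bar> + ennreal \<bar>a (x + ?c) - a x\<bar>"
        by (simp add: ennreal_leI flip: ennreal_plus)
      then show "indicator (cball 0 r) x * ennreal \<bar>a (x + (\<Sum>b\<in>insert b S. (h \<bullet> b) *\<^sub>R b)) - a x\<bar>
        \<le> indicator (cball 0 r) x * ennreal \<bar>a ((x + ?c) + (h \<bullet> b) *\<^sub>R b) - a (x + ?c)\<bar> + indicator (cball 0 r) x * ennreal \<bar>a (x + ?c) - a x\<bar>"
        unfolding distrib_left[symmetric] by (rule mult_left_mono) simp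
    qed
    also have "\<dots> = (\<integral>\<^sup>+x. indicator (cball 0 r) x * ennreal \<bar>a ((x + ?c) + (h \<bullet> b) *\<^sub>R b) - a (x + ?c)\<bar> \<partial>lborel)
        + (\<integral>\<^sup>+x. indicator (cball 0 r) x * ennreal \<bar>a (x + ?c) - a x\<bar> \<partial>lborel)"
      by (rule nn_integral_add) measurable
    also have "\<dots> \<le> ennreal (norm h) * N b + ennreal (norm h) * (\<Sum>b\<in>S. N b)"
    proof (rule add_mono)
      have "(\<integral>\<^sup>+x. indicator (cball 0 r) x * ennreal \<bar>a ((x + ?c) + (h \<bullet> b) *\<^sub>R b) - a (x + ?c)\<bar> \<partial>lborel)
        \<le> (\<integral>\<^sup>+x. indicator (cball 0 (r + real (card S) * norm h)) x * ennreal \<bar>a (x + (h \<bullet> b) *\<^sub>R b) - a x\<bar> \<partial>lborel)"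
        by (rule nn_integral_shift_cball_le[OF _ nS, where F="\<lambda>x. ennreal \<bar>a (x + (h \<bullet> b) *\<^sub>R b) - a x\<bar>"]) measurable
      also have "\<dots> \<le> ennreal \<bar>h \<bullet> b\<bar> * (\<integral>\<^sup>+x. indicator (cball 0 (r + real (card S) * norm h + \<bar>h \<bullet> b\<bar>)) x * ennreal \<bar>G b x\<bar> \<partial>lborel)"
        by (rule axis_shift_bound[OF dd[OF b(1)] cont(1) cont(2)[OF b(1)] b(2)])
      also have "\<dots> \<le> ennreal (norm h) * N b"
        unfolding N_def using hb rad
        by (intro mult_mono nn_integral_mono) (auto simp: indicator_def intro!: ennreal_leI)
      finally show "(\<integral>\<^sup>+x. indicator (cball 0 r) x * ennreal \<bar>a ((x + ?c) + (h \<bullet> b) *\<^sub>R b) - a (x + ?c)\<bar> \<partial>lborel) \<le> ennreal (norm h) * N b" .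
      show "(\<integral>\<^sup>+x. indicator (cball 0 r) x * ennreal \<bar>a (x + ?c) - a x\<bar> \<partial>lborel) \<le> ennreal (norm h) * (\<Sum>b\<in>S. N b)"
        using insert by auto
    qed
    also have "\<dots> = ennreal (norm h) * (\<Sum>b\<in>insert b S. N b)"
      using insert.hyps by (simp add: distrib_left)
    finally show ?case .
  qed simp
  from this[of Basis] show ?thesis unfolding N_def euclidean_representation by simp
qed

text \<open>Substituting \<open>y = x + h\<close> with \<open>norm h \<le> 2 * r\<close> and
  exchanging the integrals leaves the shift bound for each \<open>h\<close>, which is then
  integrated over the ball of radius \<open>2 * r\<close>.\<close>

lemma oscillation_bound:
  fixes a :: "'a::euclidean_space \<Rightarrow> real"
  assumes dd: "\<And>b. b \<in> Basis \<Longrightarrow> has_dd a b (G b)" and cont: "continuous_on UNIV a" "\<And>b. b \<in> Basis \<Longrightarrow> continuous_on UNIV (G b)"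
    and r: "r > 0" and \<rho>: "r + real DIM('a) * (2 * r) \<le> \<rho>"
  shows "(\<integral>\<^sup>+x. indicator (cball 0 r) x * (\<integral>\<^sup>+y. indicator (cball 0 r) y * ennreal \<bar>a x - a y\<bar> \<partial>lborel) \<partial>lborel)
    \<le> emeasure lborel (cball (0::'a) (2 * r)) * (ennreal (2 * r) * (\<Sum>b\<in>Basis. \<integral>\<^sup>+x. indicator (cball 0 \<rho>) x * ennreal \<bar>G b x\<bar> \<partial>lborel))"
proof -
  note [measurable] = borel_of_continuous[OF cont(1)]
  define S where "S = (\<Sum>b\<in>Basis. \<integral>\<^sup>+x. indicator (cball 0 \<rho>) x * ennreal \<bar>G b x\<bar> \<partial>lborel)"
  have "(\<integral>\<^sup>+x. indicator (cball 0 r) x * (\<integral>\<^sup>+y. indicator (cball 0 r) y * ennreal \<bar>a x - a y\<bar> \<partial>lborel) \<partial>lborel)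
     \<le> (\<integral>\<^sup>+x. (\<integral>\<^sup>+h. indicator (cball 0 r) x * (indicator (cball 0 (2 * r)) h * ennreal \<bar>a (x + h) - a x\<bar>) \<partial>lborel) \<partial>lborel)"
  proof (rule nn_integral_mono)
    fix x :: 'a
    show "indicator (cball 0 r) x * (\<integral>\<^sup>+y. indicator (cball 0 r) y * ennreal \<bar>a x - a y\<bar> \<partial>lborel)
      \<le> (\<integral>\<^sup>+h. indicator (cball 0 r) x * (indicator (cball 0 (2 * r)) h * ennreal \<bar>a (x + h) - a x\<bar>) \<partial>lborel)"
    proof (cases "norm x \<le> r")
      case True
      have "(\<integral>\<^sup>+y. indicator (cball 0 r) y * ennreal \<bar>a x - a y\<bar> \<partial>lborel) = (\<integral>\<^sup>+h. indicator (cball 0 r) (x + 1 *\<^sub>R h) * ennreal \<bar>a x - a (x + 1 *\<^sub>R h)\<bar> \<partial>lborel)"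
      proof -
        have "(\<lambda>y. indicator (cball 0 r) y * ennreal \<bar>a x - a y\<bar>) \<in> borel_measurable borel" by measurable
        from lborel_nn_integral_affine[OF this, of 1 x] show ?thesis by simp
      qed
      also have "\<dots> \<le> (\<integral>\<^sup>+h. indicator (cball 0 (2 * r)) h * ennreal \<bar>a (x + h) - a x\<bar> \<partial>lborel)"
      proof (rule nn_integral_mono)
        fix h :: 'a
        have "norm h \<le> 2 * r" if "norm (x + h) \<le> r"
          using that True norm_triangle_ineq4[of "x + h" x] by simp
        then show "indicator (cball 0 r) (x + 1 *\<^sub>R h) * ennreal \<bar>a x - a (x + 1 *\<^sub>R h)\<bar> \<le> indicator (cball 0 (2 * r)) h * ennreal \<bar>a (x + h) - a x\<bar>"
          by (auto simp: indicator_def abs_minus_commute)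
      qed
      finally show ?thesis using True by simp
    qed simp
  qed
  also have "\<dots> = (\<integral>\<^sup>+h. (\<integral>\<^sup>+x. indicator (cball 0 r) x * (indicator (cball 0 (2 * r)) h * ennreal \<bar>a (x + h) - a x\<bar>) \<partial>lborel) \<partial>lborel)"
    by (rule lborel_pair.Fubini'[symmetric]) measurable
  also have "\<dots> \<le> (\<integral>\<^sup>+(h::'a). indicator (cball 0 (2 * r)) h * (ennreal (2 * r) * S) \<partial>lborel)"
  proof (rule nn_integral_mono)
    fix h :: 'a
    show "(\<integral>\<^sup>+x. indicator (cball 0 r) x * (indicator (cball 0 (2 * r)) h * ennreal \<bar>a (x + h) - a x\<bar>) \<partial>lborel) \<le> indicator (cball 0 (2 * r)) h * (ennreal (2 * r) * S)"
    proof (cases "norm h \<le> 2 * r")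
      case True
      have "real DIM('a) * norm h \<le> real DIM('a) * (2 * r)" using True by (intro mult_left_mono) auto
      then have rad: "r + real DIM('a) * norm h \<le> \<rho>" using \<rho> by linarith
      have "(\<integral>\<^sup>+x. indicator (cball 0 r) x * ennreal \<bar>a (x + h) - a x\<bar> \<partial>lborel) \<le> ennreal (norm h) * S"
        unfolding S_def by (intro shift_bound dd cont rad)
      also have "\<dots> \<le> ennreal (2 * r) * S" using True by (intro mult_right_mono ennreal_leI) auto
      finally show ?thesis using True by simp
    qed simp
  qed
  also have "\<dots> = emeasure lborel (cball (0::'a) (2 * r)) * (ennreal (2 * r) * S)"
    by (subst nn_integral_multc) auto
  finally show ?thesis unfolding S_def .
qed

text \<open>The common order of decay of the products of two rescaled Barenblatt solutions
  (\<open>bb_product_decay\<close>); the weight \<open>v * B\<close> of the Poincare inequality is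
  trapped between two such products.\<close>

definition decay4 :: "real^3 \<Rightarrow> real" where
  "decay4 x = 1 / (1 + (norm x)\<^sup>2)\<^sup>2"

lemma decay4_pos: "decay4 x > 0"
  unfolding decay4_def by (intro divide_pos_pos zero_less_power add_pos_nonneg) auto

lemma decay4_le_1: "decay4 x \<le> 1"
proof -
  have "1 \<le> (1 + (norm x)\<^sup>2)\<^sup>2" by (intro one_le_power) simp
  then show ?thesis unfolding decay4_def by (simp add: divide_le_eq)
qed

lemma integrable_decay4: "integrable lborel decay4"
  unfolding decay4_def[abs_def] by (rule integrable_inverse_quartic)

lemma borel_decay4 [measurable]: "decay4 \<in> borel_measurable borel"
  unfolding decay4_def[abs_def] by simp

lemma decay4_integral_pos: "(LINT x|lborel. decay4 x) > 0"
proof -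
  have "(LINT x::real^3|lborel. 1 / 4 * indicator (cball 0 1) x) \<le> (LINT x|lborel. decay4 x)"
  proof (rule integral_mono[OF integrable_indicator_cball integrable_decay4])
    fix x :: "real^3"
    show "1 / 4 * indicator (cball 0 1) x \<le> decay4 x"
    proof (cases "norm x \<le> 1")
      case True
      then have "1 + (norm x)\<^sup>2 \<le> 2" by (simp add: power_le_one)
      then have "(1 + (norm x)\<^sup>2)\<^sup>2 \<le> 2\<^sup>2" by (intro power_mono) auto
      moreover have "0 < (1 + (norm x)\<^sup>2)\<^sup>2" by (intro zero_less_power add_pos_nonneg) auto
      ultimately have "1 / 2\<^sup>2 \<le> decay4 x" unfolding decay4_def by (intro divide_left_mono mult_pos_pos) auto
      then show ?thesis using True by simp
    qed (use decay4_pos[of x] in simp)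
  qed
  moreover have "(LINT x::real^3|lborel. 1 / 4 * indicator (cball 0 1) x) > (0::real)" by simp
  ultimately show ?thesis by linarith
qed

lemma decay4_tail:
  assumes "\<epsilon> > 0"
  obtains r where "r \<ge> 1" "(LINT x|lborel. indicator (- cball 0 r) x * decay4 x) < \<epsilon>"
proof -
  have "(\<lambda>n. LINT x|lborel. indicator (- cball 0 (real n)) x * decay4 x) \<longlonglongrightarrow> (LINT x::real^3|lborel. 0)"
  proof (rule integral_dominated_convergence[where w=decay4])
    show "AE x in lborel. (\<lambda>n. indicator (- cball 0 (real n)) x * decay4 x) \<longlonglongrightarrow> 0"
    proof (rule AE_I2)
      fix x :: "real^3"
      obtain N where N: "norm x \<le> real N" using real_arch_simple by blast
      have "\<forall>n\<ge>N. indicator (- cball 0 (real n)) x * decay4 x = 0" using N by (auto simp: indicator_def)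
      then show "(\<lambda>n. indicator (- cball 0 (real n)) x * decay4 x) \<longlonglongrightarrow> 0"
        by (intro tendsto_eventually) (auto simp: eventually_sequentially)
    qed
    show "AE x in lborel. norm (indicator (- cball 0 (real n)) x * decay4 x) \<le> decay4 x" for n
      using decay4_pos by (intro AE_I2) (auto simp: indicator_def less_imp_le abs_mult)
    show "(\<lambda>x. indicator (- cball 0 (real n)) x * decay4 x) \<in> borel_measurable lborel" for n
      by (intro borel_measurable_times borel_measurable_indicator) auto
  qed (auto simp: integrable_decay4)
  then have "\<forall>\<^sub>F n in sequentially. (LINT x|lborel. indicator (- cball 0 (real n)) x * decay4 x) < \<epsilon>"
    using assms by (intro order_tendstoD) auto
  moreover have "\<forall>\<^sub>F n in sequentially. n \<ge> 1" by (rule eventually_ge_at_top)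
  ultimately have ev: "\<forall>\<^sub>F n in sequentially. real n \<ge> 1 \<and> (LINT x|lborel. indicator (- cball 0 (real n)) x * decay4 x) < \<epsilon>"
    by eventually_elim auto
  obtain n where "real n \<ge> 1" "(LINT x|lborel. indicator (- cball 0 (real n)) x * decay4 x) < \<epsilon>"
    using eventually_happens[OF ev] by auto
  then show ?thesis by (rule that)
qed

text \<open>Young's inequality without its best constant; it trades the first power of the gradient
  in the oscillation bound for the square in the dissipation.\<close>

lemma abs_le_weighted_square: "\<eta> > 0 \<Longrightarrow> \<bar>g\<bar> \<le> \<eta> + g\<^sup>2 / (\<eta>::real)"
proof -
  assume "\<eta> > 0"
  have "0 \<le> (\<bar>g\<bar> - \<eta>)\<^sup>2" by simp
  then have "2 * (\<bar>g\<bar> * \<eta>) \<le> g\<^sup>2 + \<eta>\<^sup>2" by (simp add: power2_diff)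
  moreover have "0 \<le> \<bar>g\<bar> * \<eta>" using \<open>\<eta> > 0\<close> by simp
  ultimately have "\<bar>g\<bar> * \<eta> \<le> g\<^sup>2 + \<eta>\<^sup>2" by linarith
  then show ?thesis using \<open>\<eta> > 0\<close> by (simp add: field_simps power2_eq_square)
qed

text \<open>The weighted mean of \<open>a\<close> vanishes, so that \<open>a x\<close> times the total weight is the integral of
  \<open>(a x - a y) * \<omega> y\<close> over \<open>y\<close>, which the oscillation of \<open>a\<close> on a large ball controls.\<close>

lemma weighted_poincare:
  fixes M c0 C0 \<epsilon> :: real
  assumes M: "M > 0" and c: "c0 > 0" "C0 > 0" and \<epsilon>: "\<epsilon> > 0"
  obtains \<rho> \<delta> where "\<rho> > 0" "\<delta> > 0"
    "\<And>a G \<omega>. (\<And>b. b \<in> Basis \<Longrightarrow> has_dd a b (G b)) \<Longrightarrow> continuous_on UNIV a \<Longrightarrow>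
       (\<And>b. b \<in> Basis \<Longrightarrow> continuous_on UNIV (G b)) \<Longrightarrow> (\<And>x. \<bar>a x\<bar> \<le> M) \<Longrightarrow>
       continuous_on UNIV \<omega> \<Longrightarrow> (\<And>x. c0 * decay4 x \<le> \<omega> x) \<Longrightarrow> (\<And>x. \<omega> x \<le> C0 * decay4 x) \<Longrightarrow>
       (LINT x|lborel. a x * \<omega> x) = 0 \<Longrightarrow>
       (LINT x|lborel. indicator (cball 0 \<rho>) x * (\<Sum>b\<in>Basis. (G b x)\<^sup>2)) < \<delta> \<Longrightarrow>
       (LINT x::real^3|lborel. \<bar>a x\<bar> * \<omega> x) \<le> \<epsilon>"
proof -
  define J where "J = (LINT x|lborel. decay4 x)"
  have J: "J > 0" unfolding J_def by (rule decay4_integral_pos)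
  \<comment> \<open>\<open>K\<close> collects the factors of the tail mass \<open>\<tau>\<close>:
    \<open>2 * C0\<^sup>2 * M / c0\<close> enters through the estimate on the ball,
    \<open>C0 * M\<close> through its complement.\<close>
  define K where "K = 2 * C0\<^sup>2 * M / c0 + C0 * M"
  have K: "K > 0" unfolding K_def using M c by (intro add_pos_pos divide_pos_pos mult_pos_pos) auto
  obtain r where r: "r \<ge> 1" "(LINT x|lborel. indicator (- cball 0 r) x * decay4 x) < \<epsilon> / (2 * K)"
    using decay4_tail[of "\<epsilon> / (2 * K)"] K \<epsilon> by auto
  have itail: "integrable lborel (\<lambda>y. indicator (- cball 0 r) y * decay4 y)"
    by (rule Bochner_Integration.integrable_bound[OF integrable_decay4])
       (use decay4_pos in \<open>auto intro!: AE_I2 simp: indicator_def\<close>)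
  define \<tau> where "\<tau> = (LINT x|lborel. indicator (- cball 0 r) x * decay4 x)"
  have \<tau>: "0 \<le> \<tau>" unfolding \<tau>_def using decay4_pos by (intro integral_nonneg_AE AE_I2) (auto simp: less_imp_le)
  have K\<tau>: "K * \<tau> \<le> \<epsilon> / 2" using r(2) K unfolding \<tau>_def[symmetric] by (simp add: field_simps)
  \<comment> \<open>The oscillation bound in dimension 3 needs the radius
    \<open>r + 3 * (2 * r)\<close>.\<close>
  define \<rho> where "\<rho> = 7 * r"
  define V1 where "V1 = measure lborel (cball (0::real^3) (2 * r))"
  define V2 where "V2 = measure lborel (cball (0::real^3) \<rho>)"
  have V: "V1 > 0" "V2 > 0" unfolding V1_def V2_def \<rho>_def using r by auto
  \<comment> \<open>\<open>P\<close> is the oscillation that can be tolerated: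
    \<open>C0 * (C0 * P) / (c0 * J) = \<epsilon> / 2\<close>. Then \<open>\<eta>\<close> and
    \<open>\<delta>\<close> make each of the two terms of the oscillation bound equal to
    \<open>P / 2\<close>.\<close>
  define P where "P = \<epsilon> * c0 * J / (2 * C0\<^sup>2)"
  have P: "P > 0" unfolding P_def using \<epsilon> c J by simp
  define \<eta> where "\<eta> = P / (2 * (V1 * (2 * r) * (3 * V2)))"
  have \<eta>: "\<eta> > 0" unfolding \<eta>_def using P V r by simp
  define \<delta> where "\<delta> = \<eta> * P / (2 * (V1 * (2 * r)))"
  have \<delta>: "\<delta> > 0" unfolding \<delta>_def using P V r \<eta> by simp
  show ?thesis
  proof (rule that[of \<rho> \<delta>])
    show "\<rho> > 0" unfolding \<rho>_def using r by simp
    show "\<delta> > 0" by (rule \<delta>)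
    fix a :: "real^3 \<Rightarrow> real" and G \<omega>
    assume dd: "\<And>b. b \<in> Basis \<Longrightarrow> has_dd a b (G b)" and ca: "continuous_on UNIV a"
      and cG: "\<And>b. b \<in> Basis \<Longrightarrow> continuous_on UNIV (G b)" and aM: "\<And>x. \<bar>a x\<bar> \<le> M"
      and cw: "continuous_on UNIV \<omega>" and w1: "\<And>x. c0 * decay4 x \<le> \<omega> x" and w2: "\<And>x. \<omega> x \<le> C0 * decay4 x"
      and zero: "(LINT x|lborel. a x * \<omega> x) = 0"
      and small: "(LINT x|lborel. indicator (cball 0 \<rho>) x * (\<Sum>b\<in>Basis. (G b x)\<^sup>2)) < \<delta>"
    note [measurable] = borel_of_continuous[OF ca] borel_of_continuous[OF cw]
    have w0: "\<omega> x > 0" for x using w1[of x] mult_pos_pos[OF c(1) decay4_pos[of x]] by linarith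
    have iw: "integrable lborel \<omega>"
      by (rule Bochner_Integration.integrable_bound[OF integrable_mult_right[OF integrable_decay4, of C0]])
         (use w0 w2 in \<open>auto intro!: AE_I2 order_trans[OF w2 abs_ge_self] simp: abs_of_pos\<close>)
    define m where "m = (LINT x|lborel. \<omega> x)"
    have m: "m \<ge> c0 * J" unfolding m_def J_def integral_mult_right_zero[symmetric]
      by (intro integral_mono integrable_mult_right integrable_decay4 iw w1)
    have m0: "m > 0" using m mult_pos_pos[OF c(1) J] by linarith
    have iaw: "integrable lborel (\<lambda>x. a x * \<omega> x)"
    proof (rule Bochner_Integration.integrable_bound[OF integrable_mult_right[OF iw, of M]])
      show "AE x in lborel. norm (a x * \<omega> x) \<le> norm (M * \<omega> x)"
        using aM w0 M by (intro AE_I2) (auto simp: abs_mult intro!: mult_right_mono)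
    qed measurable
    define Osc where "Osc = (\<integral>\<^sup>+x. indicator (cball 0 r) x * (\<integral>\<^sup>+y. indicator (cball 0 r) y * ennreal \<bar>a x - a y\<bar> \<partial>lborel) \<partial>lborel)"
    have Osc: "Osc \<le> ennreal P"
    proof -
      have N: "(\<integral>\<^sup>+x. indicator (cball 0 \<rho>) x * ennreal \<bar>G b x\<bar> \<partial>lborel)
         = ennreal (LINT x|lborel. indicator (cball 0 \<rho>) x * \<bar>G b x\<bar>)"
        and Ni: "integrable lborel (\<lambda>x. indicator (cball 0 \<rho>) x * \<bar>G b x\<bar>)"
        and Gi: "integrable lborel (\<lambda>x. indicator (cball 0 \<rho>) x * (G b x)\<^sup>2)" if b: "b \<in> Basis" for b
      proof -
        have "integrable lborel (\<lambda>x. indicator (cball 0 \<rho>) x *\<^sub>R \<bar>G b x\<bar>)" "integrable lborel (\<lambda>x. indicator (cball 0 \<rho>) x *\<^sub>R (G b x)\<^sup>2)"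
          by (intro borel_integrable_compact compact_cball continuous_intros continuous_on_subset[OF cG[OF b]] subset_UNIV)+
        then show i: "integrable lborel (\<lambda>x. indicator (cball 0 \<rho>) x * \<bar>G b x\<bar>)" "integrable lborel (\<lambda>x. indicator (cball 0 \<rho>) x * (G b x)\<^sup>2)"
          by simp_all
        have "(\<integral>\<^sup>+x. indicator (cball 0 \<rho>) x * ennreal \<bar>G b x\<bar> \<partial>lborel) = (\<integral>\<^sup>+x. ennreal (indicator (cball 0 \<rho>) x * \<bar>G b x\<bar>) \<partial>lborel)"
          by (intro nn_integral_cong) (auto simp: indicator_def)
        also have "\<dots> = ennreal (LINT x|lborel. indicator (cball 0 \<rho>) x * \<bar>G b x\<bar>)"
          by (rule nn_integral_eq_integral[OF i(1)]) auto
        finally show "(\<integral>\<^sup>+x. indicator (cball 0 \<rho>) x * ennreal \<bar>G b x\<bar> \<partial>lborel)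
         = ennreal (LINT x|lborel. indicator (cball 0 \<rho>) x * \<bar>G b x\<bar>)" .
      qed
      have sumN: "(\<Sum>b\<in>Basis. LINT x|lborel. indicator (cball 0 \<rho>) x * \<bar>G b x\<bar>) \<le> 3 * (\<eta> * V2) + \<delta> / \<eta>"
      proof -
        have "(\<Sum>b\<in>Basis. LINT x|lborel. indicator (cball 0 \<rho>) x * \<bar>G b x\<bar>)
          \<le> (\<Sum>b\<in>Basis. LINT x|lborel. \<eta> * indicator (cball 0 \<rho>) x + (1 / \<eta>) * (indicator (cball 0 \<rho>) x * (G b x)\<^sup>2))"
        proof (intro sum_mono integral_mono Ni Bochner_Integration.integrable_add integrable_indicator_cball integrable_mult_right Gi)
          fix b x
          show "indicator (cball 0 \<rho>) x * \<bar>G b x\<bar> \<le> \<eta> * indicator (cball 0 \<rho>) x + (1 / \<eta>) * (indicator (cball 0 \<rho>) x * (G b x)\<^sup>2)"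
            using abs_le_weighted_square[OF \<eta>, of "G b x"] by (auto simp: indicator_def)
        qed
        also have "\<dots> = (\<Sum>b\<in>(Basis::(real^3) set). \<eta> * V2 + (1 / \<eta>) * (LINT x|lborel. indicator (cball 0 \<rho>) x * (G b x)\<^sup>2))"
        proof (rule sum.cong[OF refl])
          fix b :: "real^3" assume b: "b \<in> Basis"
          show "(LINT x|lborel. \<eta> * indicator (cball 0 \<rho>) x + (1 / \<eta>) * (indicator (cball 0 \<rho>) x * (G b x)\<^sup>2))
             = \<eta> * V2 + (1 / \<eta>) * (LINT x|lborel. indicator (cball 0 \<rho>) x * (G b x)\<^sup>2)"
            unfolding V2_def
            by (subst Bochner_Integration.integral_add[OF integrable_indicator_cball integrable_mult_right[OF Gi[OF b]]])
               (simp only: integral_mult_right_zero, simp)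
        qed
        also have "\<dots> = 3 * (\<eta> * V2) + (1 / \<eta>) * (\<Sum>b\<in>Basis. LINT x|lborel. indicator (cball 0 \<rho>) x * (G b x)\<^sup>2)"
          unfolding sum.distrib sum_distrib_left[symmetric] by simp
        also have "(\<Sum>b\<in>Basis. LINT x|lborel. indicator (cball 0 \<rho>) x * (G b x)\<^sup>2) = (LINT x|lborel. indicator (cball 0 \<rho>) x * (\<Sum>b\<in>Basis. (G b x)\<^sup>2))"
          unfolding sum_distrib_left by (rule Bochner_Integration.integral_sum[symmetric]) (rule Gi)
        also have "(1 / \<eta>) * (LINT x|lborel. indicator (cball 0 \<rho>) x * (\<Sum>b\<in>Basis. (G b x)\<^sup>2)) \<le> \<delta> / \<eta>"
          using small \<eta> by (simp add: divide_right_mono)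
        finally show ?thesis by simp
      qed
      have "Osc \<le> emeasure lborel (cball (0::real^3) (2 * r)) * (ennreal (2 * r) * (\<Sum>b\<in>Basis. \<integral>\<^sup>+x. indicator (cball 0 \<rho>) x * ennreal \<bar>G b x\<bar> \<partial>lborel))"
        unfolding Osc_def using r by (intro oscillation_bound dd ca cG) (auto simp: \<rho>_def)
      also have "\<dots> = ennreal V1 * (ennreal (2 * r) * ennreal (\<Sum>b\<in>Basis. LINT x|lborel. indicator (cball 0 \<rho>) x * \<bar>G b x\<bar>))"
      proof -
        have "emeasure lborel (cball (0::real^3) (2 * r)) = ennreal V1"
          unfolding V1_def using emeasure_bounded_finite[OF bounded_cball, of "0::real^3" "2 * r"]
          by (intro emeasure_eq_ennreal_measure) auto
        then show ?thesis by (simp add: N sum_ennreal integral_nonneg_AE)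
      qed
      also have "\<dots> = ennreal (V1 * (2 * r * (\<Sum>b\<in>Basis. LINT x|lborel. indicator (cball 0 \<rho>) x * \<bar>G b x\<bar>)))"
        using V r by (simp add: ennreal_mult sum_nonneg integral_nonneg_AE)
      also have "\<dots> \<le> ennreal (V1 * (2 * r * (3 * (\<eta> * V2) + \<delta> / \<eta>)))"
        using V r sumN by (intro ennreal_leI mult_left_mono) auto
      also have "V1 * (2 * r * (3 * (\<eta> * V2) + \<delta> / \<eta>)) = P"
      proof -
        have "V1 * (2 * r * (3 * (\<eta> * V2))) = P / 2" unfolding \<eta>_def using V r by simp
        moreover have "V1 * (2 * r * (\<delta> / \<eta>)) = P / 2" unfolding \<delta>_def using V r \<eta> by simp
        ultimately show ?thesis by (simp add: distrib_left)
      qed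
      finally show ?thesis .
    qed
    \<comment> \<open>On the ball \<open>\<omega>\<close> is at most \<open>C0\<close>, as
      \<open>decay4\<close> is at most 1; outside it the difference of two values of
      \<open>a\<close> is at most \<open>2 * M\<close>, and the tail mass of the weight
      remains.\<close>
    have pt: "ennreal (m * \<bar>a x\<bar>) \<le> ennreal C0 * ((\<integral>\<^sup>+y. indicator (cball 0 r) y * ennreal \<bar>a x - a y\<bar> \<partial>lborel) + ennreal (2 * M * \<tau>))" for x
    proof -
      have ii: "integrable lborel (\<lambda>y. (a x - a y) * \<omega> y)"
        using Bochner_Integration.integrable_diff[OF integrable_mult_right[OF iw, of "a x"] iaw] by (simp add: left_diff_distrib)
      have "m * a x = (LINT y|lborel. (a x - a y) * \<omega> y)"
        unfolding left_diff_distrib using iw iaw zero by (simp add: m_def mult.commute)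
      then have "m * \<bar>a x\<bar> = \<bar>LINT y|lborel. (a x - a y) * \<omega> y\<bar>" using m0 by (metis abs_mult abs_of_pos)
      then have "ennreal (m * \<bar>a x\<bar>) \<le> (\<integral>\<^sup>+y. norm ((a x - a y) * \<omega> y) \<partial>lborel)"
        using integral_norm_bound_ennreal[OF ii] by simp
      also have "\<dots> \<le> (\<integral>\<^sup>+y. ennreal C0 * (indicator (cball 0 r) y * ennreal \<bar>a x - a y\<bar>) + ennreal C0 * ennreal (2 * M * (indicator (- cball 0 r) y * decay4 y)) \<partial>lborel)"
      proof (rule nn_integral_mono)
        fix y :: "real^3"
        have d: "\<bar>a x - a y\<bar> \<le> 2 * M" using aM[of x] aM[of y] by linarith
        have wy: "0 \<le> \<omega> y" using w0[of y] by simp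
        show "ennreal (norm ((a x - a y) * \<omega> y)) \<le> ennreal C0 * (indicator (cball 0 r) y * ennreal \<bar>a x - a y\<bar>) + ennreal C0 * ennreal (2 * M * (indicator (- cball 0 r) y * decay4 y))"
        proof (cases "norm y \<le> r")
          case True
          have "C0 * decay4 y \<le> C0 * 1" using decay4_le_1 c by (intro mult_left_mono) auto
          then have "\<omega> y \<le> C0" using w2[of y] by linarith
          then have "\<bar>a x - a y\<bar> * \<omega> y \<le> C0 * \<bar>a x - a y\<bar>" by (metis abs_ge_zero mult.commute mult_left_mono)
          then have "ennreal (norm ((a x - a y) * \<omega> y)) \<le> ennreal (C0 * \<bar>a x - a y\<bar>)"
            using wy by (intro ennreal_leI) (simp add: abs_mult)
          also have "\<dots> = ennreal C0 * ennreal \<bar>a x - a y\<bar>" using c by (intro ennreal_mult) auto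
          finally show ?thesis using True by simp
        next
          case False
          have "\<bar>a x - a y\<bar> * \<omega> y \<le> (2 * M) * (C0 * decay4 y)"
            using d w2[of y] wy by (intro mult_mono) auto
          then have "ennreal (norm ((a x - a y) * \<omega> y)) \<le> ennreal (C0 * (2 * M * decay4 y))"
            using wy by (intro ennreal_leI) (simp add: abs_mult mult_ac)
          also have "\<dots> = ennreal C0 * ennreal (2 * M * decay4 y)" using c M decay4_pos[of y] by (intro ennreal_mult) auto
          finally show ?thesis using False by simp
        qed
      qed
      also have "\<dots> = ennreal C0 * (\<integral>\<^sup>+y. indicator (cball 0 r) y * ennreal \<bar>a x - a y\<bar> \<partial>lborel)
          + ennreal C0 * (\<integral>\<^sup>+y. ennreal (2 * M * (indicator (- cball 0 r) y * decay4 y)) \<partial>lborel)"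
        by (subst nn_integral_add, measurable, subst (1 2) nn_integral_cmult, measurable)
      also have "(\<integral>\<^sup>+y. ennreal (2 * M * (indicator (- cball 0 r) y * decay4 y)) \<partial>lborel) = ennreal (2 * M * \<tau>)"
      proof -
        have "(\<integral>\<^sup>+y. ennreal (2 * M * (indicator (- cball 0 r) y * decay4 y)) \<partial>lborel) = ennreal (LINT y|lborel. 2 * M * (indicator (- cball 0 r) y * decay4 y))"
          using itail M decay4_pos by (intro nn_integral_eq_integral) (auto intro!: AE_I2 mult_nonneg_nonneg simp: less_imp_le)
        then show ?thesis unfolding \<tau>_def integral_mult_right_zero .
      qed
      finally show ?thesis by (simp add: distrib_left)
    qed
    define X where "X = (LINT x|lborel. indicator (cball 0 r) x * (\<bar>a x\<bar> * decay4 x))"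
    have iX: "integrable lborel (\<lambda>x. \<bar>a x\<bar> * decay4 x)"
      by (rule Bochner_Integration.integrable_bound[OF integrable_mult_right[OF integrable_decay4, of M]])
         (use aM decay4_pos M in \<open>auto intro!: AE_I2 mult_right_mono simp: abs_mult\<close>)
    have iX1: "integrable lborel (\<lambda>x. indicator (cball 0 r) x * (\<bar>a x\<bar> * decay4 x))"
      by (rule Bochner_Integration.integrable_bound[OF iX]) (auto intro!: AE_I2 simp: indicator_def)
    have X0: "X \<ge> 0" unfolding X_def using decay4_pos by (intro integral_nonneg_AE AE_I2 mult_nonneg_nonneg) (auto simp: less_imp_le)
    have "ennreal (m * X) = (\<integral>\<^sup>+x. ennreal (m * (indicator (cball 0 r) x * (\<bar>a x\<bar> * decay4 x))) \<partial>lborel)"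
      unfolding X_def integral_mult_right_zero[symmetric] using iX1 m0 decay4_pos
      by (intro nn_integral_eq_integral[symmetric] integrable_mult_right AE_I2 mult_nonneg_nonneg) (auto simp: less_imp_le)
    also have "\<dots> \<le> (\<integral>\<^sup>+x. ennreal C0 * (indicator (cball 0 r) x * (\<integral>\<^sup>+y. indicator (cball 0 r) y * ennreal \<bar>a x - a y\<bar> \<partial>lborel))
        + ennreal C0 * ennreal (2 * M * \<tau> * decay4 x) \<partial>lborel)"
    proof (rule nn_integral_mono)
      fix x :: "real^3"
      let ?q = "\<integral>\<^sup>+y. indicator (cball 0 r) y * ennreal \<bar>a x - a y\<bar> \<partial>lborel"
      show "ennreal (m * (indicator (cball 0 r) x * (\<bar>a x\<bar> * decay4 x))) \<le> ennreal C0 * (indicator (cball 0 r) x * ?q) + ennreal C0 * ennreal (2 * M * \<tau> * decay4 x)"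
      proof (cases "norm x \<le> r")
        case True
        have "ennreal (m * (\<bar>a x\<bar> * decay4 x)) = ennreal (m * \<bar>a x\<bar>) * ennreal (decay4 x)"
          using m0 decay4_pos[of x] by (simp add: mult.assoc flip: ennreal_mult)
        also have "\<dots> \<le> ennreal C0 * (?q + ennreal (2 * M * \<tau>)) * ennreal (decay4 x)"
          by (intro mult_right_mono pt) simp
        also have "\<dots> = ennreal C0 * (?q * ennreal (decay4 x)) + ennreal C0 * (ennreal (2 * M * \<tau>) * ennreal (decay4 x))"
          by (simp add: distrib_left distrib_right mult.assoc)
        also have "\<dots> \<le> ennreal C0 * (?q * 1) + ennreal C0 * ennreal (2 * M * \<tau> * decay4 x)"
          using decay4_le_1[of x] decay4_pos[of x] M \<tau>
          by (intro add_mono mult_left_mono) (auto simp: ennreal_mult)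
        finally show ?thesis using True by simp
      qed simp
    qed
    also have "\<dots> = ennreal C0 * Osc + ennreal C0 * (\<integral>\<^sup>+x. ennreal (2 * M * \<tau> * decay4 x) \<partial>lborel)"
      unfolding Osc_def by (subst nn_integral_add, measurable, subst (1 2) nn_integral_cmult, measurable)
    also have "(\<integral>\<^sup>+x. ennreal (2 * M * \<tau> * decay4 x) \<partial>lborel) = ennreal (2 * M * \<tau> * J)"
      unfolding J_def integral_mult_right_zero[symmetric] using M \<tau> decay4_pos
      by (intro nn_integral_eq_integral integrable_mult_right integrable_decay4 AE_I2 mult_nonneg_nonneg) (auto simp: less_imp_le)
    also have "ennreal C0 * Osc + ennreal C0 * ennreal (2 * M * \<tau> * J) \<le> ennreal C0 * ennreal P + ennreal C0 * ennreal (2 * M * \<tau> * J)"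
      by (intro add_mono mult_left_mono Osc) auto
    also have "\<dots> = ennreal (C0 * P + C0 * (2 * M * \<tau> * J))"
      using c P M \<tau> J by (simp add: ennreal_mult ennreal_plus)
    finally have mX: "m * X \<le> C0 * P + C0 * (2 * M * \<tau> * J)"
      using c P M \<tau> J by (subst (asm) ennreal_le_iff) auto
    have "c0 * J * X \<le> m * X" using m X0 by (rule mult_right_mono)
    with mX have "X \<le> (C0 * P + C0 * (2 * M * \<tau> * J)) / (c0 * J)" using c J by (simp add: pos_le_divide_eq mult.commute)
    then have "C0 * X \<le> C0 * ((C0 * P + C0 * (2 * M * \<tau> * J)) / (c0 * J))" using c by (intro mult_left_mono) auto
    also have "\<dots> = \<epsilon> / 2 + (2 * C0\<^sup>2 * M / c0) * \<tau>"
      unfolding P_def using c J by (simp add: add_divide_distrib power2_eq_square distrib_left)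
    finally have CX: "C0 * X \<le> \<epsilon> / 2 + (2 * C0\<^sup>2 * M / c0) * \<tau>" .
    have "(LINT x|lborel. \<bar>a x\<bar> * \<omega> x) \<le> (LINT x|lborel. C0 * (indicator (cball 0 r) x * (\<bar>a x\<bar> * decay4 x)) + C0 * M * (indicator (- cball 0 r) x * decay4 x))"
    proof (rule integral_mono)
      show "integrable lborel (\<lambda>x. \<bar>a x\<bar> * \<omega> x)"
        using integrable_abs[OF iaw] w0 by (simp add: abs_mult less_imp_le)
      show "integrable lborel (\<lambda>x. C0 * (indicator (cball 0 r) x * (\<bar>a x\<bar> * decay4 x)) + C0 * M * (indicator (- cball 0 r) x * decay4 x))"
        by (intro Bochner_Integration.integrable_add integrable_mult_right iX1 itail)
      fix x
      have "\<bar>a x\<bar> * \<omega> x \<le> \<bar>a x\<bar> * (C0 * decay4 x)" using w2[of x] by (intro mult_left_mono) auto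
      moreover have "\<bar>a x\<bar> * (C0 * decay4 x) \<le> M * (C0 * decay4 x)"
        using aM[of x] c decay4_pos[of x] by (intro mult_right_mono) auto
      ultimately show "\<bar>a x\<bar> * \<omega> x \<le> C0 * (indicator (cball 0 r) x * (\<bar>a x\<bar> * decay4 x)) + C0 * M * (indicator (- cball 0 r) x * decay4 x)"
        by (auto simp: indicator_def mult_ac)
    qed
    also have "\<dots> = C0 * X + C0 * M * \<tau>"
      unfolding X_def \<tau>_def
      by (subst Bochner_Integration.integral_add) (auto intro!: integrable_mult_right iX1 itail)
    also have "\<dots> \<le> \<epsilon> / 2 + K * \<tau>" using CX unfolding K_def by (simp add: distrib_right)
    also have "\<dots> \<le> \<epsilon>" using K\<tau> by simp
    finally show "(LINT x|lborel. \<bar>a x\<bar> * \<omega> x) \<le> \<epsilon>" .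
  qed
qed

section \<open>Comparison and monotonicity in time\<close>

text \<open>\<open>bb k p\<close> is the Barenblatt solution in dimension 3 at remaining time \<open>p = T - t\<close>;
  \<open>bb k 1\<close> is the rescaled one.\<close>

definition bb :: "real \<Rightarrow> real \<Rightarrow> 'a::real_normed_vector \<Rightarrow> real" where
  "bb k p x = 2 * p ^ 3 / (k + p\<^sup>2 * (norm x)\<^sup>2)"

lemma barenblatt_eq_bb:
  assumes "t < T"
  shows "barenblatt T k (x :: real^3) t = bb k (T - t) x"
  using assms unfolding barenblatt_def bb_def by (simp add: Let_def)

lemma bb_pos: "k > 0 \<Longrightarrow> p > 0 \<Longrightarrow> bb k p x > 0"
  unfolding bb_def by (intro divide_pos_pos add_pos_nonneg) auto

text \<open>Dropping \<open>k\<close> gives one bound for all Barenblatt solutions; it controls both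
  \<open>u\<close> and \<open>B\<close> far from the origin.\<close>

lemma bb_le_inverse_square:
  assumes "k > 0" "p > 0" "x \<noteq> 0"
  shows "bb k p x \<le> 2 * p / (norm x)\<^sup>2"
proof -
  have "bb k p x \<le> 2 * p ^ 3 / (p\<^sup>2 * (norm x)\<^sup>2)"
    unfolding bb_def using assms by (intro divide_left_mono mult_pos_pos add_pos_nonneg) auto
  also have "\<dots> = 2 * p / (norm x)\<^sup>2" using assms by (simp add: power3_eq_cube power2_eq_square)
  finally show ?thesis .
qed

lemma bb_le_const:
  assumes "k > 0" "p > 0"
  shows "bb k p x \<le> 2 * p ^ 3 / k"
  unfolding bb_def using assms by (intro divide_left_mono mult_pos_pos add_pos_nonneg) auto

text \<open>One-sided, since the minimum in the comparison argument may lie at the final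
  time.\<close>

lemma deriv_nonpos_at_left_min:
  assumes "(f has_real_derivative d) (at t)" "a < t" "\<And>s. a \<le> s \<Longrightarrow> s \<le> t \<Longrightarrow> f t \<le> f s"
  shows "d \<le> 0"
proof (rule ccontr)
  assume "\<not> d \<le> 0"
  then obtain e where e: "e > 0" "\<And>h. h > 0 \<Longrightarrow> h < e \<Longrightarrow> f (t - h) < f t"
    using DERIV_pos_inc_left[OF assms(1)] by auto
  define h where "h = min (e / 2) (t - a)"
  have "h > 0" "h < e" "h \<le> t - a" using e assms(2) unfolding h_def by auto
  then show False using e(2)[of h] assms(3)[of "t - h"] by auto
qed

lemma second_deriv_nonneg_at_min:
  fixes f f' :: "real \<Rightarrow> real"
  assumes f: "\<And>h. (f has_real_derivative f' h) (at h)" and f': "(f' has_real_derivative d) (at 0)"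
    and e: "e > 0" "\<And>h. \<bar>h\<bar> < e \<Longrightarrow> f 0 \<le> f h"
  shows "d \<ge> 0"
proof (rule ccontr)
  assume "\<not> d \<ge> 0"
  then obtain c where c: "c > 0" "\<And>h. h > 0 \<Longrightarrow> h < c \<Longrightarrow> f' h < f' 0"
    using DERIV_neg_dec_right[OF f'] by auto
  have 0: "f' 0 = 0" by (rule DERIV_local_min[OF f e(1)]) (use e in auto)
  define h where "h = min c e / 2"
  have h: "h > 0" "h < c" "h < e" using c e unfolding h_def by auto
  obtain z where z: "0 < z" "z < h" "f h - f 0 = (h - 0) * f' z"
    using MVT2[of 0 h f f'] h f by auto
  have "f' z < 0" using c(2)[of z] z h 0 by auto
  then have "h * f' z < 0" using h by (simp add: mult_pos_neg)
  then have "f h < f 0" using z by simp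
  then show False using e(2)[of h] h by auto
qed

lemma has_dd_ln:
  assumes f: "has_dd f b f'" and f': "has_dd f' b f''" and pos: "\<And>x. f x > 0"
  shows "has_dd (\<lambda>x. ln (f x)) b (\<lambda>x. f' x / f x)"
    and "has_dd (\<lambda>x. f' x / f x) b (\<lambda>x. f'' x / f x - (f' x / f x)\<^sup>2)"
proof -
  have "has_dd (\<lambda>x. ln (f x)) b (\<lambda>x. inverse (f x) * f' x)"
    by (rule has_dd_chain[OF f]) (rule DERIV_ln[OF pos])
  then show "has_dd (\<lambda>x. ln (f x)) b (\<lambda>x. f' x / f x)" by (simp add: field_simps)
  show "has_dd (\<lambda>x. f' x / f x) b (\<lambda>x. f'' x / f x - (f' x / f x)\<^sup>2)"
    unfolding has_dd_def
  proof
    fix x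
    have "((\<lambda>h. f (x + h *\<^sub>R b)) has_real_derivative f' x) (at 0)"
      "((\<lambda>h. f' (x + h *\<^sub>R b)) has_real_derivative f'' x) (at 0)"
      using f f' unfolding has_dd_def by auto
    then show "((\<lambda>h. f' (x + h *\<^sub>R b) / f (x + h *\<^sub>R b)) has_real_derivative f'' x / f x - (f' x / f x)\<^sup>2) (at 0)"
      using pos[of x] by (auto intro!: derivative_eq_intros simp: field_simps power2_eq_square)
  qed
qed

text \<open>\<open>ut\<close>, \<open>g b\<close> and \<open>H b\<close> stand for \<open>u\<^sub>t\<close>, \<open>D\<^sub>b u\<close> and \<open>D\<^sub>b D\<^sub>b u\<close>; the last assumption is the
  equation with \<open>D\<^sub>b D\<^sub>b (ln u)\<close> expanded.\<close>

locale trapped_solution =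
  fixes T k1 k2 :: real and u ut :: "real^3 \<Rightarrow> real \<Rightarrow> real" and g H :: "real^3 \<Rightarrow> real^3 \<Rightarrow> real \<Rightarrow> real"
  assumes T: "T > 0" and k: "k2 > 0" "k1 > k2"
    and trap: "\<And>x t. t \<in> {0<..<T} \<Longrightarrow> bb k1 (T - t) x \<le> u x t" "\<And>x t. t \<in> {0<..<T} \<Longrightarrow> u x t \<le> bb k2 (T - t) x"
    and dt: "\<And>x t. t \<in> {0<..<T} \<Longrightarrow> (u x has_real_derivative ut x t) (at t)"
    and dx: "\<And>b t. t \<in> {0<..<T} \<Longrightarrow> b \<in> Basis \<Longrightarrow> has_dd (\<lambda>x. u x t) b (\<lambda>x. g b x t)"
    and dxx: "\<And>b t. t \<in> {0<..<T} \<Longrightarrow> b \<in> Basis \<Longrightarrow> has_dd (\<lambda>x. g b x t) b (\<lambda>x. H b x t)"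
    and contu: "continuous_on (UNIV \<times> {0<..<T}) (\<lambda>(x, t). u x t)"
    and contut: "continuous_on (UNIV \<times> {0<..<T}) (\<lambda>(x, t). ut x t)"
    and contg: "\<And>b. b \<in> Basis \<Longrightarrow> continuous_on (UNIV \<times> {0<..<T}) (\<lambda>(x, t). g b x t)"
    and contH: "\<And>b. b \<in> Basis \<Longrightarrow> continuous_on (UNIV \<times> {0<..<T}) (\<lambda>(x, t). H b x t)"
    and pde: "\<And>x t. t \<in> {0<..<T} \<Longrightarrow> ut x t = (\<Sum>b\<in>Basis. H b x t / u x t - (g b x t / u x t)\<^sup>2)"
begin

lemma k1: "k1 > 0" using k by simp

lemma upos: "t \<in> {0<..<T} \<Longrightarrow> u x t > 0"
  using trap(1)[of t x] bb_pos[OF k1, of "T - t" x] by auto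

lemma slice:
  assumes "continuous_on (UNIV \<times> {0<..<T}) (\<lambda>(x, t). F x t)" "t \<in> {0<..<T}"
  shows "continuous_on UNIV (\<lambda>x::real^3. F x t :: real)"
proof -
  have "continuous_on UNIV (\<lambda>x. (\<lambda>(x, t). F x t) (x, t))"
    by (rule continuous_on_compose2[OF assms(1)]) (use assms(2) in \<open>auto intro!: continuous_intros\<close>)
  then show ?thesis by simp
qed

lemmas sliceu = slice[OF contu] and sliceut = slice[OF contut] and sliceg = slice[OF contg] and sliceH = slice[OF contH]

lemma dd_ln:
  assumes "t \<in> {0<..<T}" "b \<in> Basis"
  shows "has_dd (\<lambda>x. ln (u x t)) b (\<lambda>x. g b x t / u x t)"
    and "has_dd (\<lambda>x. g b x t / u x t) b (\<lambda>x. H b x t / u x t - (g b x t / u x t)\<^sup>2)"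
  using has_dd_ln[OF dx[OF assms] dxx[OF assms] upos[OF assms(1)]] by blast+

text \<open>\<open>W(x, t) = lam * u(x, t0 + (t - t0) / lam)\<close> solves the equation again, with \<open>W > u\<close> at time \<open>t0\<close> and, since its
  extinction time is later, with \<open>W > u\<close> for large \<open>x\<close>. So a negative value of \<open>exp (- C * (t - t0)) * (ln W - ln u)\<close> would
  produce an interior minimum, which the equation forbids when \<open>C\<close> is large.\<close>

lemma comparison_time_scaling:
  assumes t0: "0 < t0" "t0 \<le> ts" "ts < T" and lam: "lam > 1"
  shows "u xs ts \<le> lam * u xs (t0 + (ts - t0) / lam)"
proof (rule ccontr)
  assume contra: "\<not> ?thesis"
  define \<tau> where "\<tau> t = t0 + (t - t0) / lam" for t
  have \<tau>: "t0 \<le> \<tau> t" "\<tau> t \<le> t" "\<tau> t \<le> ts" if "t0 \<le> t" "t \<le> ts" for t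
  proof -
    have "(t - t0) / lam \<le> t - t0" using lam that by (simp add: divide_le_eq mult_le_cancel_left1)
    then show "t0 \<le> \<tau> t" "\<tau> t \<le> t" "\<tau> t \<le> ts" using that lam unfolding \<tau>_def by auto
  qed
  have in1: "t \<in> {0<..<T}" if "t0 \<le> t" "t \<le> ts" for t using that t0 by auto
  have in2: "\<tau> t \<in> {0<..<T}" if "t0 \<le> t" "t \<le> ts" for t using \<tau>[OF that] t0 by auto
  define z where "z x t = ln lam + ln (u x (\<tau> t)) - ln (u x t)" for x t
  have zneg: "z x t < 0 \<longleftrightarrow> lam * u x (\<tau> t) < u x t" if "t0 \<le> t" "t \<le> ts" for x t
  proof -
    have "ln lam + ln (u x (\<tau> t)) = ln (lam * u x (\<tau> t))"
      using lam upos[OF in2[OF that], of x] by (simp add: ln_mult)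
    then show ?thesis unfolding z_def using lam upos[OF in1[OF that], of x] upos[OF in2[OF that], of x] by simp
  qed
  \<comment> \<open>The margin \<open>lam * p' - p\<close> between the scaled remaining times of
    \<open>W\<close> and \<open>u\<close>, which does not depend on \<open>t\<close>.\<close>
  define d where "d = (lam - 1) * (T - t0)"
  define ps where "ps = T - ts"
  have d: "d > 0" unfolding d_def using lam t0 by simp
  have ps: "ps > 0" unfolding ps_def using t0 by simp
  \<comment> \<open>From this radius on, the lower barrier of \<open>W\<close> is not below the
    upper barrier of \<open>u\<close>: this amounts to
    \<open>p * k1 \<le> (norm x)^2 * p'^2 * d\<close>, where \<open>R \<ge> 1\<close> gives
    \<open>R \<le> R^2\<close>. The first entry puts \<open>xs\<close> strictly inside the
    ball.\<close>
  define R where "R = max (norm xs + 1) (T * k1 / (ps\<^sup>2 * d) + 1)"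
  have R1: "R \<ge> 1" "norm xs < R" unfolding R_def using norm_ge_zero[of xs] by linarith+
  have zout: "z x t \<ge> 0" if x: "norm x \<ge> R" and t: "t0 \<le> t" "t \<le> ts" for x t
  proof -
    define p where "p = T - t"
    define p' where "p' = T - \<tau> t"
    have p: "0 < p" "p \<le> T" "ps \<le> p'" "0 < p'"
      using t t0 \<tau>[OF t] unfolding p_def p'_def ps_def by auto
    have x0: "x \<noteq> 0" "norm x > 0" using x R1 by auto
    have "T * k1 / (ps\<^sup>2 * d) \<le> R" unfolding R_def by simp
    also have "R \<le> R\<^sup>2" using R1 by (simp add: power2_eq_square)
    also have "R\<^sup>2 \<le> (norm x)\<^sup>2" using x R1 by (intro power_mono) auto
    finally have "T * k1 \<le> (norm x)\<^sup>2 * (ps\<^sup>2 * d)" using ps d by (simp add: divide_le_eq)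
    also have "\<dots> \<le> (norm x)\<^sup>2 * (p'\<^sup>2 * d)" using p ps d by (intro mult_left_mono mult_right_mono power_mono) auto
    finally have 1: "p * k1 \<le> (norm x)\<^sup>2 * (p'\<^sup>2 * d)"
      using mult_right_mono[OF p(2), of k1] k1 by linarith
    have "lam * p' - p = d" using lam unfolding p_def p'_def d_def \<tau>_def by (simp add: field_simps)
    with 1 have 2: "p * (k1 + p'\<^sup>2 * (norm x)\<^sup>2) \<le> lam * p' ^ 3 * (norm x)\<^sup>2"
      unfolding \<open>lam * p' - p = d\<close>[symmetric] by (simp add: algebra_simps power3_eq_cube power2_eq_square)
    have pq: "k1 + p'\<^sup>2 * (norm x)\<^sup>2 > 0" using k1 by (simp add: add_pos_nonneg)
    have "u x t \<le> 2 * p / (norm x)\<^sup>2"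
      using trap(2)[OF in1[OF t], of x] bb_le_inverse_square[OF k(1) p(1) x0(1)] unfolding p_def by linarith
    also have "\<dots> \<le> lam * bb k1 p' x"
      using 2 x0 pq unfolding bb_def by (simp add: field_simps)
    also have "\<dots> \<le> lam * u x (\<tau> t)"
      using trap(1)[OF in2[OF t], of x] lam unfolding p'_def by simp
    finally show ?thesis using zneg[OF t, of x] by linarith
  qed
  define K where "K = cball (0::real^3) R \<times> {t0..ts}"
  have K: "compact K" "K \<noteq> {}" using R1 t0 unfolding K_def by (auto intro!: compact_Times)
  have KU: "K \<subseteq> UNIV \<times> {0<..<T}" using t0 unfolding K_def by auto
  have "compact ((\<lambda>(x, t). ut x t) ` K)"
    by (intro compact_continuous_image continuous_on_subset[OF contut KU] K)
  then obtain L where L: "\<And>x t. (x, t) \<in> K \<Longrightarrow> \<bar>ut x t\<bar> \<le> L"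
    using compact_imp_bounded bounded_iff by (metis (no_types, lifting) case_prod_conv image_eqI real_norm_def)
  obtain q where q: "q \<in> K" "\<And>y. y \<in> K \<Longrightarrow> (\<lambda>(x, t). u x t) q \<le> (\<lambda>(x, t). u x t) y"
    using continuous_attains_inf[OF K continuous_on_subset[OF contu KU]] by blast
  define m where "m = (\<lambda>(x, t). u x t) q"
  have m: "m > 0" "\<And>x t. (x, t) \<in> K \<Longrightarrow> m \<le> u x t"
    using q KU upos unfolding m_def by (auto split: prod.splits)
  \<comment> \<open>\<open>ut * (1 / W - 1 / u)\<close> is at least \<open>L / m * z\<close> at a
    point where \<open>z < 0\<close>; the extra 1 turns the final inequality into a
    contradiction.\<close>
  define C where "C = L / m + 1"
  define F where "F = (\<lambda>(x, t). exp (- C * (t - t0)) * z x t)"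
  have contz: "continuous_on K (\<lambda>(x, t). z x t)"
  proof -
    have a: "continuous_on K (\<lambda>y. u (fst y) (snd y))"
      using continuous_on_subset[OF contu KU] by (simp add: split_beta)
    have "continuous_on K ((\<lambda>(x, t). u x t) \<circ> (\<lambda>y. (fst y, \<tau> (snd y))))"
      unfolding \<tau>_def using lam t0
      by (intro continuous_on_compose continuous_on_subset[OF contu] continuous_intros)
         (use in2 in \<open>auto simp: K_def \<tau>_def[symmetric]\<close>)
    then have b: "continuous_on K (\<lambda>y. u (fst y) (\<tau> (snd y)))" by (simp add: comp_def)
    have "continuous_on K (\<lambda>y. ln lam + ln (u (fst y) (\<tau> (snd y))) - ln (u (fst y) (snd y)))"
    proof (intro continuous_intros a b ballI)
      fix y assume "y \<in> K"
      then have "t0 \<le> snd y" "snd y \<le> ts" unfolding K_def by auto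
      then show "u (fst y) (snd y) \<noteq> 0" "u (fst y) (\<tau> (snd y)) \<noteq> 0"
        using upos[OF in1, of "snd y" "fst y"] upos[OF in2, of "snd y" "fst y"] by linarith+
    qed
    then show ?thesis by (simp add: z_def split_beta)
  qed
  have "continuous_on K F"
    using contz unfolding F_def split_beta by (intro continuous_intros) auto
  then obtain y where y: "y \<in> K" "\<And>w. w \<in> K \<Longrightarrow> F y \<le> F w"
    using continuous_attains_inf[OF K] by metis
  obtain x1 t1 where y1: "y = (x1, t1)" by (cases y)
  have t1: "t0 \<le> t1" "t1 \<le> ts" using y(1) unfolding y1 K_def by auto
  have min: "F (x1, t1) \<le> F (x, t)" if "norm x \<le> R" "t0 \<le> t" "t \<le> ts" for x t
    using y(2)[of "(x, t)"] that unfolding y1 K_def by auto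
  have "z xs ts < 0" using contra zneg[of ts xs] t0 unfolding \<tau>_def by auto
  then have "F (xs, ts) < 0" unfolding F_def by (simp add: mult_pos_neg)
  then have "F (x1, t1) < 0" using min[of xs ts] R1 t0 by auto
  then have z1: "z x1 t1 < 0" unfolding F_def by (simp add: mult_less_0_iff)
  have x1: "norm x1 < R" using zout[OF _ t1, of x1] z1 by force
  have t01: "t0 < t1"
  proof (rule ccontr)
    assume "\<not> t0 < t1"
    then have "t1 = t0" using t1 by simp
    then have "z x1 t1 = ln lam" unfolding z_def \<tau>_def by simp
    then show False using z1 lam by simp
  qed
  let ?a = "ut x1 (\<tau> t1)" and ?b = "ut x1 t1" and ?W = "lam * u x1 (\<tau> t1)"
  have Wpos: "?W > 0" "u x1 t1 > 0" using upos in1[OF t1] in2[OF t1] lam by auto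
  \<comment> \<open>At fixed time \<open>F\<close> is a positive multiple of \<open>z\<close>, so
    \<open>x1\<close> is an interior spatial minimum of \<open>z\<close>. Summing the second
    derivatives over the axes gives the difference of the two Laplacians, which the equation turns
    into \<open>ut\<close> at the two times.\<close>
  have lap: "?a - ?b \<ge> 0"
  proof -
    have "(H b x1 (\<tau> t1) / u x1 (\<tau> t1) - (g b x1 (\<tau> t1) / u x1 (\<tau> t1))\<^sup>2)
       - (H b x1 t1 / u x1 t1 - (g b x1 t1 / u x1 t1)\<^sup>2) \<ge> 0" if b: "b \<in> Basis" for b
    proof -
      define zb where "zb x = g b x (\<tau> t1) / u x (\<tau> t1) - g b x t1 / u x t1" for x
      have 1: "has_dd (\<lambda>x. ln (u x (\<tau> t1)) - ln (u x t1)) b zb"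
        unfolding zb_def by (intro has_dd_diff dd_ln in1 in2 t1 b)
      have 2: "has_dd zb b (\<lambda>x. (H b x (\<tau> t1) / u x (\<tau> t1) - (g b x (\<tau> t1) / u x (\<tau> t1))\<^sup>2)
       - (H b x t1 / u x t1 - (g b x t1 / u x t1)\<^sup>2))"
        unfolding zb_def by (intro has_dd_diff dd_ln in1 in2 t1 b)
      show ?thesis
      proof (rule second_deriv_nonneg_at_min[OF has_dd_at[OF 1, of x1], where e="R - norm x1"])
        show "((\<lambda>h. zb (x1 + h *\<^sub>R b)) has_real_derivative (H b x1 (\<tau> t1) / u x1 (\<tau> t1) - (g b x1 (\<tau> t1) / u x1 (\<tau> t1))\<^sup>2)
           - (H b x1 t1 / u x1 t1 - (g b x1 t1 / u x1 t1)\<^sup>2)) (at 0)"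
          using 2 unfolding has_dd_def by blast
        show "R - norm x1 > 0" using x1 by simp
        fix h assume h: "\<bar>h\<bar> < R - norm x1"
        have "norm (x1 + h *\<^sub>R b) \<le> norm x1 + \<bar>h\<bar>"
          using norm_triangle_ineq[of x1 "h *\<^sub>R b"] b by simp
        then have "F (x1, t1) \<le> F (x1 + h *\<^sub>R b, t1)" using h t1 by (intro min) auto
        then have "z x1 t1 \<le> z (x1 + h *\<^sub>R b) t1" unfolding F_def by simp
        then show "ln (u (x1 + 0 *\<^sub>R b) (\<tau> t1)) - ln (u (x1 + 0 *\<^sub>R b) t1)
          \<le> ln (u (x1 + h *\<^sub>R b) (\<tau> t1)) - ln (u (x1 + h *\<^sub>R b) t1)"
          unfolding z_def by simp
      qed
    qed
    then show ?thesis unfolding pde[OF in1[OF t1]] pde[OF in2[OF t1]] sum_subtractf[symmetric] by (intro sum_nonneg) auto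
  qed
  have du\<tau>: "((\<lambda>t. u x1 (\<tau> t)) has_real_derivative ?a * (1 / lam)) (at t1)"
  proof (rule DERIV_chain2[where f="u x1" and g=\<tau>, OF dt[OF in2[OF t1]]])
    show "(\<tau> has_real_derivative 1 / lam) (at t1)"
      unfolding \<tau>_def[abs_def] using lam by (auto intro!: derivative_eq_intros)
  qed
  have zt: "(z x1 has_real_derivative ?a / ?W - ?b / u x1 t1) (at t1)"
    unfolding z_def[abs_def] using lam upos[OF in1[OF t1], of x1] upos[OF in2[OF t1], of x1]
    by (auto intro!: derivative_eq_intros du\<tau> dt[OF in1[OF t1]] simp: field_simps)
  have "((\<lambda>t. F (x1, t)) has_real_derivative
      exp (- C * (t1 - t0)) * ((?a / ?W - ?b / u x1 t1) - C * z x1 t1)) (at t1)"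
    unfolding F_def by (auto intro!: derivative_eq_intros zt simp: algebra_simps)
  then have "exp (- C * (t1 - t0)) * ((?a / ?W - ?b / u x1 t1) - C * z x1 t1) \<le> 0"
    by (rule deriv_nonpos_at_left_min[OF _ t01]) (use min x1 t1 in auto)
  then have 1: "?a / ?W - ?b / u x1 t1 \<le> C * z x1 t1"
    by (simp add: mult_le_0_iff)
  have zexp: "?W / u x1 t1 = exp (z x1 t1)"
    unfolding z_def using Wpos lam upos[OF in2[OF t1], of x1] by (simp add: exp_add exp_diff)
  have "1 / ?W - 1 / u x1 t1 = (1 - exp (z x1 t1)) / ?W"
  proof -
    have "1 / W - 1 / v = (1 - W / v) / W" if "W > 0" "v > 0" for W v :: real
      using that by (simp add: field_simps)
    then show ?thesis unfolding zexp[symmetric] using Wpos by blast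
  qed
  have inK: "(x1, t1) \<in> K" "(x1, \<tau> t1) \<in> K" using x1 t1 \<tau>[OF t1] unfolding K_def by auto
  have L0: "L \<ge> 0" using L[OF inK(1)] by linarith
  have mW: "m \<le> ?W"
    using m(2)[OF inK(2)] m(1) lam mult_right_mono[of 1 lam "u x1 (\<tau> t1)"] by linarith
  have e1: "0 \<le> 1 - exp (z x1 t1)" "1 - exp (z x1 t1) \<le> - z x1 t1"
    using z1 exp_ge_add_one_self[of "z x1 t1"] by (simp, linarith)
  have "(1 - exp (z x1 t1)) / ?W \<le> (- z x1 t1) / m"
    using e1 mW m(1) by (intro frac_le) auto
  then have b2: "0 \<le> 1 / ?W - 1 / u x1 t1" "1 / ?W - 1 / u x1 t1 \<le> (- z x1 t1) / m"
    unfolding \<open>1 / ?W - 1 / u x1 t1 = (1 - exp (z x1 t1)) / ?W\<close> using e1 Wpos by auto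
  \<comment> \<open>The time derivative of \<open>z\<close> is split as
    \<open>(?a - ?b) / ?W + ?b * (1 / ?W - 1 / u x1 t1)\<close>: the first term is nonnegative at
    the minimum, the second is at least \<open>- L * (- z x1 t1 / m)\<close>.\<close>
  have "- L * ((- z x1 t1) / m) \<le> - L * (1 / ?W - 1 / u x1 t1)"
    using mult_left_mono[OF b2(2) L0] by simp
  also have "\<dots> \<le> ?b * (1 / ?W - 1 / u x1 t1)"
    using L[OF inK(1)] b2(1) by (intro mult_right_mono) auto
  also have "\<dots> \<le> (?a - ?b) / ?W + ?b * (1 / ?W - 1 / u x1 t1)"
    using lap Wpos by simp
  also have "\<dots> = ?a / ?W - ?b / u x1 t1" by (simp add: diff_divide_distrib right_diff_distrib)
  also have "\<dots> \<le> C * z x1 t1" by (rule 1)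
  finally have "L / m * z x1 t1 \<le> (L / m + 1) * z x1 t1" unfolding C_def by simp
  then show False using z1 by (simp add: algebra_simps)
qed

text \<open>\<open>lam = (t - t0) / (s - t0)\<close> is the factor for which the scaled time
  belonging to \<open>t\<close> is exactly \<open>s\<close>; then \<open>t0\<close> tends to 0. The
  comparison has to start at a positive \<open>t0\<close>, because \<open>u\<close> is controlled
  pointwise only at positive times.\<close>

lemma benilan_crandall:
  assumes "0 < s" "s \<le> t" "t < T"
  shows "s * u x t \<le> t * u x s"
proof (cases "s = t")
  case False
  then have st: "s < t" using assms by simp
  have ev: "u x t \<le> (t - t0) / (s - t0) * u x s" if t0: "0 < t0" "t0 < s" for t0
  proof -
    have "(t - t0) / (s - t0) > 1" using st t0 by (simp add: less_divide_eq)
    then have "u x t \<le> (t - t0) / (s - t0) * u x (t0 + (t - t0) / ((t - t0) / (s - t0)))"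
      using comparison_time_scaling[of t0 t "(t - t0) / (s - t0)" x] t0 st assms by auto
    also have "t0 + (t - t0) / ((t - t0) / (s - t0)) = s" using t0 st by simp
    finally show ?thesis .
  qed
  have "u x t \<le> (t - 0) / (s - 0) * u x s"
  proof (rule tendsto_lowerbound)
    show "((\<lambda>t0. (t - t0) / (s - t0) * u x s) \<longlongrightarrow> (t - 0) / (s - 0) * u x s) (at_right 0)"
      using assms by (intro tendsto_intros) auto
    show "\<forall>\<^sub>F t0 in at_right 0. u x t \<le> (t - t0) / (s - t0) * u x s"
      using eventually_at_right_real[OF assms(1)] by eventually_elim (use ev in auto)
  qed simp
  then show ?thesis using assms by (simp add: field_simps)
qed auto

text \<open>The infinitesimal form of the monotonicity of \<open>u / t\<close>: the function
  \<open>s \<mapsto> u x s - u x t / t * s\<close> vanishes at \<open>t\<close> and is nonnegative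
  before, so its derivative at \<open>t\<close> is not positive.\<close>

lemma ut_le:
  assumes "t \<in> {0<..<T}"
  shows "ut x t \<le> u x t / t"
proof -
  have "((\<lambda>s. u x s - u x t / t * s) has_real_derivative ut x t - u x t / t) (at t)"
    using dt[OF assms, of x] assms by (auto intro!: derivative_eq_intros)
  then have "ut x t - u x t / t \<le> 0"
  proof (rule deriv_nonpos_at_left_min[where a="t / 2"])
    show "t / 2 < t" using assms by simp
    fix s assume s: "t / 2 \<le> s" "s \<le> t"
    have "s * u x t \<le> t * u x s" using assms s by (intro benilan_crandall) auto
    then show "u x t - u x t / t * t \<le> u x s - u x t / t * s" using assms s by (simp add: field_simps)
  qed
  then show ?thesis by simp
qed

end

section \<open>Conservation of mass\<close>

text \<open>If \<open>f\<close> is not integrable, its integral is 0 by convention and the bound is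
  trivial; hence the form that asks for integrability of \<open>g\<close> only.\<close>

lemma abs_integral_le:
  fixes f :: "'a \<Rightarrow> real"
  assumes g: "integrable M g" and le: "\<And>x. \<bar>f x\<bar> \<le> g x"
  shows "\<bar>LINT x|M. f x\<bar> \<le> (LINT x|M. g x)"
proof (cases "integrable M f")
  case True
  have "\<bar>LINT x|M. f x\<bar> \<le> (LINT x|M. \<bar>f x\<bar>)" by (rule integral_abs_bound)
  also have "\<dots> \<le> (LINT x|M. g x)" using True g le by (intro integral_mono) auto
  finally show ?thesis .
next
  case False
  have "0 \<le> g x" for x using le[of x] by linarith
  then show ?thesis using False by (simp add: not_integrable_integral_eq)
qed

section \<open>Barenblatt solutions and functions trapped between them\<close>

lemma continuous_on_bb_joint:
  assumes "k > 0"
  shows "continuous_on S (\<lambda>(x::'a::real_normed_vector, t). bb k (T - t) x)"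
proof -
  have "k + (T - snd z)\<^sup>2 * (norm (fst z))\<^sup>2 \<noteq> 0" for z :: "'a \<times> real"
    using assms by (metis add_pos_nonneg less_irrefl mult_nonneg_nonneg zero_le_power2)
  then show ?thesis unfolding bb_def split_beta by (intro continuous_intros) auto
qed

lemma continuous_on_bb: "k > 0 \<Longrightarrow> continuous_on UNIV (bb k p)"
  unfolding bb_def[abs_def]
  by (intro continuous_intros) (metis add_pos_nonneg less_irrefl mult_nonneg_nonneg zero_le_power2)

text \<open>Equivalent to \<open>grad (1 / B) = x / p\<close>; the form with
  \<open>B\<^sup>2\<close> keeps the later formulas polynomial in \<open>B\<close>.\<close>

lemma has_dd_bb:
  assumes "k > 0" "p > 0"
  shows "has_dd (bb k p) b (\<lambda>x. - (x \<bullet> b) * (bb k p x)\<^sup>2 / p)"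
proof -
  have d: "((\<lambda>s. 2 * p ^ 3 / (k + p\<^sup>2 * s)) has_real_derivative - (2 * p ^ 3 * p\<^sup>2) / (k + p\<^sup>2 * s)\<^sup>2) (at s)"
    if "k + p\<^sup>2 * s > 0" for s
    using that by (auto intro!: derivative_eq_intros simp: power2_eq_square)
  have "has_dd (\<lambda>x. 2 * p ^ 3 / (k + p\<^sup>2 * (norm x)\<^sup>2)) b
     (\<lambda>x. - (2 * p ^ 3 * p\<^sup>2) / (k + p\<^sup>2 * (norm x)\<^sup>2)\<^sup>2 * (2 * (x \<bullet> b)))"
    by (rule has_dd_chain[OF has_dd_norm2 d[OF pos_quad[OF assms(1)]]]) simp
  moreover have "- (2 * p ^ 3 * p\<^sup>2) / (k + p\<^sup>2 * (norm x)\<^sup>2)\<^sup>2 * (2 * (x \<bullet> b)) = - (x \<bullet> b) * (bb k p x)\<^sup>2 / p" for x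
    using assms unfolding bb_def by (simp add: power_divide power2_eq_square power3_eq_cube)
  ultimately show ?thesis unfolding bb_def[abs_def] by simp
qed

text \<open>One expression in two roles: the time derivative of \<open>bb k (T - t) x\<close> and
  the Laplacian of \<open>ln (bb k p x)\<close>. That they coincide is the equation for the
  Barenblatt solution.\<close>

definition bb_dt :: "real \<Rightarrow> real \<Rightarrow> real^3 \<Rightarrow> real" where
  "bb_dt k p x = - 3 * bb k p x / p + (norm x)\<^sup>2 * (bb k p x)\<^sup>2 / p\<^sup>2"

lemma bb_time_derivative:
  assumes "k > 0" "t < T"
  shows "((\<lambda>t. bb k (T - t) x) has_real_derivative bb_dt k (T - t) x) (at t)"
proof -
  define p where "p = T - t"
  have p: "p > 0" using assms p_def by simp
  have q: "k + p\<^sup>2 * (norm x)\<^sup>2 > 0" using pos_quad[OF assms(1), of "p\<^sup>2" x] by simp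
  have "((\<lambda>p. bb k p x) has_real_derivative
     (6 * p\<^sup>2 * (k + p\<^sup>2 * (norm x)\<^sup>2) - 2 * p ^ 3 * (2 * p * (norm x)\<^sup>2)) / (k + p\<^sup>2 * (norm x)\<^sup>2)\<^sup>2) (at p)"
    unfolding bb_def using q by (auto intro!: derivative_eq_intros simp: power2_eq_square)
  also have "(6 * p\<^sup>2 * (k + p\<^sup>2 * (norm x)\<^sup>2) - 2 * p ^ 3 * (2 * p * (norm x)\<^sup>2)) / (k + p\<^sup>2 * (norm x)\<^sup>2)\<^sup>2 = - bb_dt k p x"
  proof -
    have "(6 * p\<^sup>2 * Q - 2 * p ^ 3 * (2 * p * r)) / Q\<^sup>2 = 3 * (2 * p ^ 3 / Q) / p - r * (2 * p ^ 3 / Q)\<^sup>2 / p\<^sup>2"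
      if "Q > 0" for Q r :: real
      using that p by (simp add: field_simps power2_eq_square power3_eq_cube)
    from this[OF q] show ?thesis unfolding bb_dt_def bb_def by simp
  qed
  finally have D: "((\<lambda>p. bb k p x) has_real_derivative - bb_dt k p x) (at (T - t))" unfolding p_def .
  have "((\<lambda>t. bb k (T - t) x) has_real_derivative - bb_dt k p x * (- 1)) (at t)"
    by (rule DERIV_chain2[where f="\<lambda>p. bb k p x" and g="\<lambda>t. T - t", OF D]) (auto intro!: derivative_eq_intros)
  then show ?thesis by (simp add: p_def)
qed

lemma dd_ln_bb:
  assumes "k > 0" "p > 0" "norm b = 1"
  shows "has_dd (\<lambda>x. ln (bb k p x)) b (\<lambda>x. - (x \<bullet> b) * bb k p x / p)"
    and "has_dd (\<lambda>x. - (x \<bullet> b) * bb k p x / p) b (\<lambda>x. - bb k p x / p + (x \<bullet> b)\<^sup>2 * (bb k p x)\<^sup>2 / p\<^sup>2)"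
proof -
  have pos: "bb k p x > 0" for x :: 'a using bb_pos assms by blast
  have "has_dd (\<lambda>x. ln (bb k p x)) b (\<lambda>x. inverse (bb k p x) * (- (x \<bullet> b) * (bb k p x)\<^sup>2 / p))"
    using has_dd_bb[OF assms(1,2), of b] pos DERIV_ln unfolding has_dd_def
    by (auto intro!: derivative_eq_intros simp: divide_inverse)
  then show "has_dd (\<lambda>x. ln (bb k p x)) b (\<lambda>x. - (x \<bullet> b) * bb k p x / p)"
    using pos by (simp add: power2_eq_square field_simps less_imp_neq[symmetric])
  have "has_dd (\<lambda>x. (x \<bullet> b) * bb k p x * (- 1 / p)) b
     (\<lambda>x. ((b \<bullet> b) * bb k p x + (- (x \<bullet> b) * (bb k p x)\<^sup>2 / p) * (x \<bullet> b)) * (- 1 / p) + 0 * ((x \<bullet> b) * bb k p x))"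
    by (intro has_dd_mult has_dd_const has_dd_inner has_dd_bb assms)
  moreover have "b \<bullet> b = 1" using assms(3) by (simp add: dot_square_norm)
  ultimately show "has_dd (\<lambda>x. - (x \<bullet> b) * bb k p x / p) b (\<lambda>x. - bb k p x / p + (x \<bullet> b)\<^sup>2 * (bb k p x)\<^sup>2 / p\<^sup>2)"
    by (simp add: algebra_simps power2_eq_square diff_divide_distrib)
qed

lemma laplacian_ln_bb:
  fixes x :: "real^3"
  shows "(\<Sum>b\<in>Basis. - bb k p x / p + (x \<bullet> b)\<^sup>2 * (bb k p x)\<^sup>2 / p\<^sup>2) = bb_dt k p x"
  unfolding bb_dt_def sum.distrib sum_divide_distrib[symmetric] sum_distrib_right[symmetric] sum_inner_Basis_square
  by simp

text \<open>Reciprocals make the trap affine: with \<open>q = p\<^sup>2 * (norm x)\<^sup>2\<close>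
  one has \<open>1 / bb k' p x = (k' + q) / (2 * p ^ 3)\<close>, so \<open>q\<close> cancels in
  \<open>1 / B - 1 / v\<close>. Multiplied by \<open>v\<close> or by \<open>v * B\<close>, this
  bounded quantity becomes the relative or the absolute difference, which therefore inherits the
  decay of the factor.\<close>

lemma sandwich:
  fixes x :: "'a::real_normed_vector"
  assumes k: "k0 > 0" "k2 > 0" "k2 \<le> k1" and p: "p > 0"
    and v: "bb k1 p x \<le> v" "v \<le> bb k2 p x"
  shows "v > 0"
    and "\<bar>1 / bb k0 p x - 1 / v\<bar> \<le> (k0 + k1) / (2 * p ^ 3)"
    and "\<bar>v / bb k0 p x - 1\<bar> \<le> (k0 + k1) / (k2 + p\<^sup>2 * (norm x)\<^sup>2)"
    and "\<bar>v - bb k0 p x\<bar> \<le> 2 * p ^ 3 * (k0 + k1) / (min k0 k2 + p\<^sup>2 * (norm x)\<^sup>2)\<^sup>2"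
    and "bb k0 p x / v \<le> 1 + k1 / k0"
    and "v / bb k0 p x \<le> 1 + k0 / k2"
    and "\<bar>ln v - ln (bb k0 p x)\<bar> \<le> (1 + k1 / k0) * \<bar>v / bb k0 p x - 1\<bar>"
proof -
  define q where "q = p\<^sup>2 * (norm x)\<^sup>2"
  have q: "q \<ge> 0" unfolding q_def by simp
  have k1: "k1 > 0" using k by simp
  have b: "bb k' p x = 2 * p ^ 3 / (k' + q)" for k' unfolding bb_def q_def by simp
  have p3: "p ^ 3 > 0" using p by simp
  show v0: "v > 0" using v bb_pos[OF k1 p, of x] by linarith
  have iv: "(k2 + q) / (2 * p ^ 3) \<le> 1 / v" "1 / v \<le> (k1 + q) / (2 * p ^ 3)"
  proof -
    have "v * (k2 + q) \<le> 2 * p ^ 3" using v(2) k q unfolding b by (simp add: pos_le_divide_eq)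
    then show "(k2 + q) / (2 * p ^ 3) \<le> 1 / v" using v0 p3 by (simp add: field_simps)
    have "2 * p ^ 3 \<le> v * (k1 + q)" using v(1) k1 q unfolding b by (simp add: pos_divide_le_eq)
    then show "1 / v \<le> (k1 + q) / (2 * p ^ 3)" using v0 p3 by (simp add: field_simps)
  qed
  have ib: "1 / bb k0 p x = (k0 + q) / (2 * p ^ 3)" unfolding b by simp
  have "1 / bb k0 p x - 1 / v \<le> (k0 - k2) / (2 * p ^ 3)" "(k0 - k1) / (2 * p ^ 3) \<le> 1 / bb k0 p x - 1 / v"
    using iv unfolding ib by (simp_all add: add_divide_distrib diff_divide_distrib)
  \<comment> \<open>\<open>k0 + k1\<close> covers both ends, whatever the position of
    \<open>k0\<close> relative to the other two constants.\<close>
  moreover have "(k0 - k2) / (2 * p ^ 3) \<le> (k0 + k1) / (2 * p ^ 3)" "- ((k0 + k1) / (2 * p ^ 3)) \<le> (k0 - k1) / (2 * p ^ 3)"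
    unfolding minus_divide_left using k k1 p3 by (auto intro!: divide_right_mono)
  ultimately show A: "\<bar>1 / bb k0 p x - 1 / v\<bar> \<le> (k0 + k1) / (2 * p ^ 3)" by linarith
  have e: "v / bb k0 p x - 1 = (1 / bb k0 p x - 1 / v) * v" using v0 by (simp add: left_diff_distrib)
  have "\<bar>v / bb k0 p x - 1\<bar> \<le> (k0 + k1) / (2 * p ^ 3) * (2 * p ^ 3 / (k2 + q))"
    unfolding e abs_mult using A v v0 b by (intro mult_mono) auto
  then show y: "\<bar>v / bb k0 p x - 1\<bar> \<le> (k0 + k1) / (k2 + p\<^sup>2 * (norm x)\<^sup>2)"
    using p3 unfolding q_def[symmetric] by simp
  have b0: "bb k0 p x > 0" using bb_pos k p by blast
  define m where "m = min k0 k2"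
  have m: "m > 0" "m \<le> k0" "m \<le> k2" unfolding m_def using k by auto
  have "\<bar>v - bb k0 p x\<bar> = \<bar>v / bb k0 p x - 1\<bar> * bb k0 p x"
  proof -
    have "v - bb k0 p x = (v / bb k0 p x - 1) * bb k0 p x" using b0 by (simp add: left_diff_distrib)
    then show ?thesis using b0 abs_mult by (metis abs_of_pos)
  qed
  also have "\<dots> \<le> (k0 + k1) / (m + q) * (2 * p ^ 3 / (m + q))"
  proof (rule mult_mono)
    have "(k0 + k1) / (k2 + q) \<le> (k0 + k1) / (m + q)" using m q k k1 by (intro divide_left_mono) auto
    then show "\<bar>v / bb k0 p x - 1\<bar> \<le> (k0 + k1) / (m + q)" using y unfolding q_def[symmetric] by linarith
    show "bb k0 p x \<le> 2 * p ^ 3 / (m + q)" unfolding b using m q p3 k by (intro divide_left_mono) auto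
  qed (use m q k k1 b0 in auto)
  finally show "\<bar>v - bb k0 p x\<bar> \<le> 2 * p ^ 3 * (k0 + k1) / (min k0 k2 + p\<^sup>2 * (norm x)\<^sup>2)\<^sup>2"
    unfolding m_def q_def[symmetric] by (simp add: power2_eq_square mult_ac)
  have r: "(k' + q) / (k'' + q) \<le> 1 + k' / k''" if "k' > 0" "k'' > 0" for k' k''
  proof -
    have "(k' + q) / (k'' + q) = k' / (k'' + q) + q / (k'' + q)" by (simp add: add_divide_distrib)
    also have "\<dots> \<le> k' / k'' + 1"
      using that q by (intro add_mono divide_left_mono) (auto simp: divide_le_eq)
    finally show ?thesis by simp
  qed
  have "bb k0 p x / v = bb k0 p x * (1 / v)" by simp
  also have "\<dots> \<le> bb k0 p x * ((k1 + q) / (2 * p ^ 3))" using b0 iv by (intro mult_left_mono) auto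
  also have "\<dots> = (k1 + q) / (k0 + q)" unfolding b using p3 by simp
  finally show bv: "bb k0 p x / v \<le> 1 + k1 / k0" using r[OF k1 k(1)] by linarith
  have "v / bb k0 p x \<le> bb k2 p x / bb k0 p x" using v b0 by (intro divide_right_mono) auto
  also have "\<dots> = (k0 + q) / (k2 + q)" unfolding b using p3 by simp
  finally show "v / bb k0 p x \<le> 1 + k0 / k2" using r[OF k(1,2)] by linarith
  define y where "y = v / bb k0 p x"
  have y0: "y > 0" unfolding y_def using v0 b0 by simp
  have yi: "1 / y \<le> 1 + k1 / k0" using bv unfolding y_def by simp
  have "ln y \<le> y - 1" using ln_le_minus_one[OF y0] .
  moreover have "- ln y \<le> (1 - y) * (1 / y)"
    using ln_le_minus_one[of "1 / y"] y0 by (simp add: ln_div field_simps)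
  moreover have "(1 - y) * (1 / y) \<le> \<bar>y - 1\<bar> * (1 + k1 / k0)"
  proof -
    have "(1 - y) * (1 / y) \<le> \<bar>y - 1\<bar> * (1 / y)" using y0 by (intro mult_right_mono) auto
    also have "\<dots> \<le> \<bar>y - 1\<bar> * (1 + k1 / k0)" using yi by (intro mult_left_mono) auto
    finally show ?thesis .
  qed
  moreover have "y - 1 \<le> \<bar>y - 1\<bar> * (1 + k1 / k0)"
    using mult_left_mono[of 1 "1 + k1 / k0" "\<bar>y - 1\<bar>"] k k1 by auto
  ultimately have "\<bar>ln y\<bar> \<le> (1 + k1 / k0) * \<bar>y - 1\<bar>" by (simp add: abs_le_iff mult.commute)
  then show "\<bar>ln v - ln (bb k0 p x)\<bar> \<le> (1 + k1 / k0) * \<bar>v / bb k0 p x - 1\<bar>"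
    unfolding y_def using v0 b0 by (simp add: ln_div)
qed

context trapped_solution
begin

lemma p_pos: "t \<in> {0<..<T} \<Longrightarrow> T - t > 0" by simp

lemmas u_sandwich = sandwich[OF _ k(1) less_imp_le[OF k(2)] p_pos trap]

lemma integrable_u_minus_bb:
  assumes "k0 > 0" "t \<in> {0<..<T}"
  shows "integrable lborel (\<lambda>x. u x t - bb k0 (T - t) x)"
proof (rule Bochner_Integration.integrable_bound)
  show "integrable lborel (\<lambda>x::real^3. 2 * (T - t) ^ 3 * (k0 + k1) * (1 / (min k0 k2 + (T - t)\<^sup>2 * (norm x)\<^sup>2)\<^sup>2))"
    using assms k by (intro integrable_mult_right integrable_inverse_quartic_scaled) auto
  have "continuous_on UNIV (\<lambda>x. u x t - bb k0 (T - t) x)"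
    using assms by (intro continuous_intros sliceu continuous_on_bb)
  then show "(\<lambda>x. u x t - bb k0 (T - t) x) \<in> borel_measurable lborel"
    using borel_of_continuous by simp
  show "AE x in lborel. norm (u x t - bb k0 (T - t) x)
      \<le> norm (2 * (T - t) ^ 3 * (k0 + k1) * (1 / (min k0 k2 + (T - t)\<^sup>2 * (norm x)\<^sup>2)\<^sup>2))"
  proof (rule AE_I2)
    fix x
    show "norm (u x t - bb k0 (T - t) x)
      \<le> norm (2 * (T - t) ^ 3 * (k0 + k1) * (1 / (min k0 k2 + (T - t)\<^sup>2 * (norm x)\<^sup>2)\<^sup>2))"
      using order_trans[OF u_sandwich(4)[OF assms(1,2,2,2), of x] abs_ge_self] by simp
  qed
qed

text \<open>\<open>u\<close> and \<open>B\<close> solve the same equation, so the time derivative of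
  \<open>u - B\<close> is the Laplacian of \<open>ln u - ln B\<close>; Green's identity moves it
  onto the cutoff.\<close>

lemma cutoff_mass_derivative:
  assumes k0: "k0 > 0" and t: "t \<in> {0<..<T}" and R: "R > 0"
  shows "((\<lambda>t. LINT x|lborel. cutoff R x * (u x t - bb k0 (T - t) x)) has_real_derivative
    (LINT x|lborel. (ln (u x t) - ln (bb k0 (T - t) x)) * (\<Sum>b\<in>Basis. cutoff2 R b x))) (at t)"
proof -
  have p: "T - t > 0" using t by simp
  have "((\<lambda>t. LINT x|lborel. cutoff R x * (u x t - bb k0 (T - t) x)) has_real_derivative
    (LINT x|lborel. cutoff R x * (ut x t - bb_dt k0 (T - t) x))) (at t)"
  proof (rule leibniz_lborel[where a=0 and b=T and R=R])
    fix x t assume t: "t \<in> {0<..<T}"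
    show "((\<lambda>t. cutoff R x * (u x t - bb k0 (T - t) x)) has_real_derivative cutoff R x * (ut x t - bb_dt k0 (T - t) x)) (at t)"
      using t by (intro DERIV_cmult DERIV_diff dt bb_time_derivative k0) auto
    show "continuous_on UNIV (\<lambda>x. cutoff R x * (u x t - bb k0 (T - t) x))"
      using t by (intro continuous_intros continuous_on_cutoff sliceu continuous_on_bb k0)
  next
    have "continuous_on (UNIV \<times> {0<..<T}) (\<lambda>z. bb k0 (T - snd z) (fst z))"
      using continuous_on_bb_joint[OF k0] by (simp add: split_beta)
    moreover have "continuous_on (UNIV \<times> {0<..<T}) (\<lambda>z. ut (fst z) (snd z))"
      using contut by (simp add: split_beta)
    moreover have "continuous_on (UNIV \<times> {0<..<T}) (\<lambda>z. cutoff R (fst z))"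
      by (intro continuous_on_compose2[OF continuous_on_cutoff(1)] continuous_intros) auto
    ultimately show "continuous_on (UNIV \<times> {0<..<T}) (\<lambda>(x, t). cutoff R x * (ut x t - bb_dt k0 (T - t) x))"
      unfolding bb_dt_def split_beta by (intro continuous_intros) auto
  qed (use t R cutoff_supp in auto)
  moreover have "(LINT x|lborel. cutoff R x * (ut x t - bb_dt k0 (T - t) x))
    = (LINT x|lborel. (ln (u x t) - ln (bb k0 (T - t) x)) * (\<Sum>b\<in>Basis. cutoff2 R b x))"
  proof -
    have "ut x t - bb_dt k0 (T - t) x = (\<Sum>b\<in>Basis. H b x t / u x t - (g b x t / u x t)\<^sup>2 -
        (- bb k0 (T - t) x / (T - t) + (x \<bullet> b)\<^sup>2 * (bb k0 (T - t) x)\<^sup>2 / (T - t)\<^sup>2))" for x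
      unfolding sum_subtractf laplacian_ln_bb pde[OF t] by simp
    then have "(LINT x|lborel. cutoff R x * (ut x t - bb_dt k0 (T - t) x)) =
       (LINT x|lborel. cutoff R x * (\<Sum>b\<in>Basis. H b x t / u x t - (g b x t / u x t)\<^sup>2 -
        (- bb k0 (T - t) x / (T - t) + (x \<bullet> b)\<^sup>2 * (bb k0 (T - t) x)\<^sup>2 / (T - t)\<^sup>2)))" by simp
    also have "\<dots> = (LINT x|lborel. (ln (u x t) - ln (bb k0 (T - t) x)) * (\<Sum>b\<in>Basis. cutoff2 R b x))"
    proof (rule green_identity[where R=R and ?f1.0="\<lambda>b x. g b x t / u x t - (- (x \<bullet> b) * bb k0 (T - t) x / (T - t))"
          and ?p1.0="cutoff1 R"])
      fix b :: "real^3" assume b: "b \<in> Basis"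
      have nb: "norm b = 1" using b by simp
      show "has_dd (\<lambda>x. ln (u x t) - ln (bb k0 (T - t) x)) b (\<lambda>x. g b x t / u x t - (- (x \<bullet> b) * bb k0 (T - t) x / (T - t)))"
        by (intro has_dd_diff dd_ln t b dd_ln_bb k0 p nb)
      show "has_dd (\<lambda>x. g b x t / u x t - (- (x \<bullet> b) * bb k0 (T - t) x / (T - t))) b
        (\<lambda>x. H b x t / u x t - (g b x t / u x t)\<^sup>2 - (- bb k0 (T - t) x / (T - t) + (x \<bullet> b)\<^sup>2 * (bb k0 (T - t) x)\<^sup>2 / (T - t)\<^sup>2))"
        by (intro has_dd_diff dd_ln t b dd_ln_bb k0 p nb)
      show "has_dd (cutoff R) b (cutoff1 R b)" "has_dd (cutoff1 R b) b (cutoff2 R b)"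
        using has_dd_cutoff nb by auto
      show "continuous_on UNIV (\<lambda>x. g b x t / u x t - (- (x \<bullet> b) * bb k0 (T - t) x / (T - t)))"
        using p upos[OF t] by (intro continuous_intros sliceu sliceg continuous_on_bb k0 t b) (auto simp: less_imp_neq[symmetric])
      show "continuous_on UNIV (\<lambda>x. H b x t / u x t - (g b x t / u x t)\<^sup>2 - (- bb k0 (T - t) x / (T - t) + (x \<bullet> b)\<^sup>2 * (bb k0 (T - t) x)\<^sup>2 / (T - t)\<^sup>2))"
        using p upos[OF t] by (intro continuous_intros sliceu sliceg sliceH continuous_on_bb k0 t b) (auto simp: less_imp_neq[symmetric])
    next
      show "continuous_on UNIV (\<lambda>x. ln (u x t) - ln (bb k0 (T - t) x))"
        by (intro continuous_intros sliceu continuous_on_bb k0 t ballI less_imp_neq[symmetric] upos[OF t] bb_pos[OF k0 p])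
    qed (use cutoff_supp[OF R] continuous_on_cutoff in auto)
    finally show ?thesis .
  qed
  ultimately show ?thesis by simp
qed

text \<open>The rate of change is at most a multiple of \<open>R^(-2)\<close> times the integral of
  \<open>1 / (k2 + p2^2 * (norm x)^2)\<close> over the ball, thus of order \<open>R^(-1/2)\<close>.
  The constant is uniform in \<open>s\<close> and \<open>t\<close> because the remaining time is at
  least \<open>p2\<close> up to \<open>t2\<close>.\<close>

lemma cutoff_mass_lipschitz:
  assumes k0: "k0 > 0" and t2: "t2 \<in> {0<..<T}"
  obtains C where "\<And>R s t. R > 0 \<Longrightarrow> 0 < s \<Longrightarrow> s < t \<Longrightarrow> t \<le> t2 \<Longrightarrow>
    \<bar>(LINT x|lborel. cutoff R x * (u x t - bb k0 (T - t) x)) - (LINT x|lborel. cutoff R x * (u x s - bb k0 (T - s) x))\<bar>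
    \<le> C / sqrt R"
proof -
  define p2 where "p2 = T - t2"
  have p2: "p2 > 0" using t2 unfolding p2_def by simp
  obtain C where C: "C \<ge> 0" "\<And>R. R > 0 \<Longrightarrow> (LINT x::real^3|lborel. indicator (cball 0 R) x * (1 / (k2 + p2\<^sup>2 * (norm x)\<^sup>2))) \<le> C * (R * sqrt R)"
    using integral_inverse_quadratic_growth[OF k(1), of "p2\<^sup>2"] p2 by auto
  define M where "M = (1 + k1 / k0) * (k0 + k1)"
  have M: "M \<ge> 0" unfolding M_def using k0 k1 by simp
  have bd: "\<bar>LINT x|lborel. (ln (u x t) - ln (bb k0 (T - t) x)) * (\<Sum>b\<in>Basis. cutoff2 R b x)\<bar> \<le> 42 * M * C / sqrt R"
    if R: "R > 0" and t: "t \<in> {0<..<T}" "t \<le> t2" for R t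
  proof -
    have p: "p2 \<le> T - t" using t unfolding p2_def by simp
    have pw: "\<bar>(ln (u x t) - ln (bb k0 (T - t) x)) * (\<Sum>b\<in>Basis. cutoff2 R b x)\<bar>
       \<le> (M * 42 / R\<^sup>2) * (indicator (cball 0 R) x * (1 / (k2 + p2\<^sup>2 * (norm x)\<^sup>2)))" for x
    proof -
      have "\<bar>ln (u x t) - ln (bb k0 (T - t) x)\<bar> \<le> (1 + k1 / k0) * \<bar>u x t / bb k0 (T - t) x - 1\<bar>"
        using u_sandwich(7)[OF k0 t(1,1,1)] .
      also have "\<dots> \<le> (1 + k1 / k0) * ((k0 + k1) / (k2 + (T - t)\<^sup>2 * (norm x)\<^sup>2))"
        using u_sandwich(3)[OF k0 t(1,1,1)] k0 k1 by (intro mult_left_mono) auto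
      also have "\<dots> \<le> (1 + k1 / k0) * ((k0 + k1) / (k2 + p2\<^sup>2 * (norm x)\<^sup>2))"
        using k0 k1 k p p2 by (intro mult_left_mono divide_left_mono add_left_mono mult_right_mono power_mono mult_pos_pos pos_quad) auto
      finally have "\<bar>ln (u x t) - ln (bb k0 (T - t) x)\<bar> \<le> M / (k2 + p2\<^sup>2 * (norm x)\<^sup>2)" unfolding M_def by simp
      then have "\<bar>(ln (u x t) - ln (bb k0 (T - t) x)) * (\<Sum>b\<in>Basis. cutoff2 R b x)\<bar>
         \<le> M / (k2 + p2\<^sup>2 * (norm x)\<^sup>2) * (42 / R\<^sup>2 * indicator (cball 0 R) x)"
        unfolding abs_mult using laplacian_cutoff_bound[OF R, of x] M k pos_quad[OF k(1), of "p2\<^sup>2" x]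
        by (intro mult_mono) auto
      then show ?thesis by (simp add: mult_ac)
    qed
    have ib: "integrable lborel (\<lambda>x::real^3. (M * 42 / R\<^sup>2) * (indicator (cball 0 R) x * (1 / (k2 + p2\<^sup>2 * (norm x)\<^sup>2))))"
    proof (intro integrable_mult_right)
      have "integrable lborel (\<lambda>x::real^3. indicator (cball 0 R) x *\<^sub>R (1 / (k2 + p2\<^sup>2 * (norm x)\<^sup>2)))"
        by (intro borel_integrable_compact compact_cball continuous_intros ballI less_imp_neq[symmetric] pos_quad[OF k(1)]) simp
      then show "integrable lborel (\<lambda>x::real^3. indicator (cball 0 R) x * (1 / (k2 + p2\<^sup>2 * (norm x)\<^sup>2)))" by simp
    qed
    have "\<bar>LINT x|lborel. (ln (u x t) - ln (bb k0 (T - t) x)) * (\<Sum>b\<in>Basis. cutoff2 R b x)\<bar>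
      \<le> (LINT x::real^3|lborel. (M * 42 / R\<^sup>2) * (indicator (cball 0 R) x * (1 / (k2 + p2\<^sup>2 * (norm x)\<^sup>2))))"
      by (rule abs_integral_le[OF ib pw])
    also have "\<dots> \<le> (M * 42 / R\<^sup>2) * (C * (R * sqrt R))"
      unfolding integral_mult_right_zero using M by (intro mult_left_mono C(2)[OF R]) simp
    also have "\<dots> = 42 * M * C / sqrt R"
      using R by (simp add: field_simps power2_eq_square)
    finally show ?thesis .
  qed
  show ?thesis
  proof (rule that[of "T * (42 * M * C)"])
    fix R s t :: real assume *: "R > 0" "0 < s" "s < t" "t \<le> t2"
    let ?m = "\<lambda>t. LINT x|lborel. cutoff R x * (u x t - bb k0 (T - t) x)"
    let ?d = "\<lambda>t. LINT x|lborel. (ln (u x t) - ln (bb k0 (T - t) x)) * (\<Sum>b\<in>Basis. cutoff2 R b x)"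
    obtain z where z: "s < z" "z < t" "?m t - ?m s = (t - s) * ?d z"
      using MVT2[OF *(3), of ?m ?d] cutoff_mass_derivative[OF k0 _ *(1)] * t2 by fastforce
    have "\<bar>?m t - ?m s\<bar> = (t - s) * \<bar>?d z\<bar>" unfolding z(3) using * by (simp add: abs_mult)
    also have "\<dots> \<le> T * (42 * M * C / sqrt R)"
      using bd[OF *(1), of z] z * t2 by (intro mult_mono) auto
    finally show "\<bar>?m t - ?m s\<bar> \<le> T * (42 * M * C) / sqrt R" by simp
  qed
qed

end

section \<open>From cutoff integrals to integrals over the whole space\<close>

lemma lborel_of_continuous: "continuous_on UNIV f \<Longrightarrow> f \<in> borel_measurable lborel"
  using borel_of_continuous by simp

lemma abs_cutoff_mult: "\<bar>cutoff R x * y\<bar> \<le> \<bar>y\<bar>"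
  using cutoff_range[of R x] by (simp add: abs_mult mult_left_le_one_le)

text \<open>Over \<open>lebesgue\<close> rather than \<open>lborel\<close>, because
  \<open>u0\<close> may fail to be Borel measurable.\<close>

lemma cutoff_mult_integrable:
  assumes "integrable lebesgue f"
  shows "integrable lebesgue (\<lambda>x. cutoff R x * f x)"
proof (rule Bochner_Integration.integrable_bound[OF assms])
  have "cutoff R \<in> borel_measurable lebesgue"
    by (intro measurable_completion lborel_of_continuous continuous_on_cutoff)
  then show "(\<lambda>x. cutoff R x * f x) \<in> borel_measurable lebesgue"
    using assms by (intro borel_measurable_times) auto
  show "AE x in lebesgue. norm (cutoff R x * f x) \<le> norm (f x)"
    using abs_cutoff_mult by (intro AE_I2) simp
qed

lemma cutoff_integral_tendsto:
  assumes "integrable lebesgue f"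
  shows "(\<lambda>n. LINT x|lebesgue. cutoff (real (Suc n)) x * f x) \<longlonglongrightarrow> (LINT x|lebesgue. f x)"
proof (rule integral_dominated_convergence[where w="\<lambda>x. \<bar>f x\<bar>"])
  show "(\<lambda>x. cutoff (real (Suc n)) x * f x) \<in> borel_measurable lebesgue" for n
    using cutoff_mult_integrable[OF assms] by auto
  show "AE x in lebesgue. norm (cutoff (real (Suc n)) x * f x) \<le> \<bar>f x\<bar>" for n
    using abs_cutoff_mult by (intro AE_I2) simp
  have "(\<lambda>n. cutoff (real (Suc n)) x * f x) \<longlonglongrightarrow> 1 * f x" for x
    by (intro tendsto_mult LIMSEQ_Suc[OF cutoff_tendsto_1] tendsto_const)
  then show "AE x in lebesgue. (\<lambda>n. cutoff (real (Suc n)) x * f x) \<longlonglongrightarrow> f x" by simp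
qed (use assms in auto)

lemma tendsto_const_over_sqrt: "(\<lambda>n. C / sqrt (real (Suc n))) \<longlonglongrightarrow> 0"
  by (rule real_tendsto_divide_at_top[OF tendsto_const
        filterlim_compose[OF sqrt_at_top filterlim_compose[OF filterlim_real_sequentially filterlim_Suc]]])

context trapped_solution
begin

text \<open>The convergence to \<open>u0\<close> is local, so for fixed \<open>R\<close> time goes
  to 0 first and only then \<open>R\<close> to infinity; the bound \<open>C / sqrt R\<close>,
  uniform in time, connects the two limits.\<close>

lemma mass_zero:
  assumes k0: "k0 > 0" and t2: "t2 \<in> {0<..<T}"
    and u0: "integrable lebesgue (\<lambda>x. u0 x - bb k0 T x)" "(LINT x|lebesgue. u0 x - bb k0 T x) = 0"
    and L1: "tendsto_L1_loc (\<lambda>t x. u x t) u0 (at_right 0)"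
  shows "(LINT x|lborel. u x t2 - bb k0 (T - t2) x) = 0"
proof -
  define m where "m R t = (LINT x|lborel. cutoff R x * (u x t - bb k0 (T - t) x))" for R t
  define \<mu> where "\<mu> R = (LINT x|lebesgue. cutoff R x * (u0 x - bb k0 T x))" for R
  obtain C where C: "\<And>R s t. R > 0 \<Longrightarrow> 0 < s \<Longrightarrow> s < t \<Longrightarrow> t \<le> t2 \<Longrightarrow> \<bar>m R t - m R s\<bar> \<le> C / sqrt R"
    unfolding m_def by (rule cutoff_mass_lipschitz[OF k0 t2]) blast
  have uB: "integrable lebesgue (\<lambda>x. u x t - bb k0 (T - t) x)" if "t \<in> {0<..<T}" for t
    using integrable_u_minus_bb[OF k0 that] by (simp add: integrable_completion)
  have m_leb: "m R t = (LINT x|lebesgue. cutoff R x * (u x t - bb k0 (T - t) x))" if t: "t \<in> {0<..<T}" for R t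
  proof -
    have "continuous_on UNIV (\<lambda>x. cutoff R x * (u x t - bb k0 (T - t) x))"
      using t by (intro continuous_intros continuous_on_cutoff sliceu continuous_on_bb k0)
    from integral_completion[OF lborel_of_continuous[OF this]] show ?thesis
      unfolding m_def by (rule sym)
  qed
  have lim: "((\<lambda>t. m R t) \<longlongrightarrow> \<mu> R) (at_right 0)" if R: "R > 0" for R
  proof -
    let ?K = "cball (0::real^3) R"
    define \<beta> where "\<beta> t = (LINT x::real^3|lborel. cutoff R x * bb k0 (T - t) x)" for t
    \<comment> \<open>The formula for \<open>bb k0 (T - t)\<close> makes sense for negative times
      too; using it for \<open>t > -1\<close> makes \<open>\<beta>\<close> differentiable, hence
      continuous, at the initial time.\<close>
    have "(\<beta> has_real_derivative (LINT x|lborel. cutoff R x * bb_dt k0 (T - 0) x)) (at 0)"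
      unfolding \<beta>_def
    proof (rule leibniz_lborel[where a="-1" and b=T and R=R])
      fix x :: "real^3" and t assume t: "t \<in> {-1<..<T}"
      show "((\<lambda>t. cutoff R x * bb k0 (T - t) x) has_real_derivative cutoff R x * bb_dt k0 (T - t) x) (at t)"
        using t by (intro DERIV_cmult bb_time_derivative k0) auto
      show "continuous_on UNIV (\<lambda>x::real^3. cutoff R x * bb k0 (T - t) x)"
        by (intro continuous_intros continuous_on_cutoff continuous_on_bb k0)
    next
      have "continuous_on (UNIV \<times> {-1<..<T}) (\<lambda>z::(real^3) \<times> real. bb k0 (T - snd z) (fst z))"
        using continuous_on_bb_joint[OF k0] by (simp add: split_beta)
      moreover have "continuous_on (UNIV \<times> {-1<..<T}) (\<lambda>z::(real^3) \<times> real. cutoff R (fst z))"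
        by (intro continuous_on_compose2[OF continuous_on_cutoff(1)] continuous_intros) auto
      ultimately show "continuous_on (UNIV \<times> {-1<..<T}) (\<lambda>(x, t). cutoff R x * bb_dt k0 (T - t) x)"
        unfolding bb_dt_def split_beta by (intro continuous_intros) auto
    qed (use T R cutoff_supp in auto)
    then have "(\<beta> \<longlongrightarrow> \<beta> 0) (at 0)" using DERIV_isCont isCont_def by blast
    then have \<beta>: "((\<lambda>t. \<beta> t - \<beta> 0) \<longlongrightarrow> 0) (at_right 0)"
      using filterlim_mono[OF _ order_refl at_le] LIM_zero by (metis subset_UNIV)
    have L: "\<forall>\<^sub>F t in at_right 0. integrable (lebesgue_on ?K) (\<lambda>x. u x t - u0 x)"
      "((\<lambda>t. LINT x|lebesgue_on ?K. \<bar>u x t - u0 x\<bar>) \<longlongrightarrow> 0) (at_right 0)"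
      using L1 compact_cball unfolding tendsto_L1_loc_def tendsto_L1_def by blast+
    have bint: "integrable lborel (\<lambda>x::real^3. cutoff R x * bb k0 p x)" for p
      using R cutoff_supp
      by (intro integrable_continuous_cball[where R=R]) (auto intro!: continuous_intros continuous_on_cutoff continuous_on_bb k0)
    have tT: "\<forall>\<^sub>F t in at_right 0. t \<in> {0<..<T}"
      using eventually_at_right_real[OF T] .
    have "\<forall>\<^sub>F t in at_right 0. \<bar>m R t - \<mu> R + (\<beta> t - \<beta> 0)\<bar> \<le> (LINT x|lebesgue_on ?K. \<bar>u x t - u0 x\<bar>)"
      using L(1) tT
    proof eventually_elim
      fix t assume i: "integrable (lebesgue_on ?K) (\<lambda>x. u x t - u0 x)" and t: "t \<in> {0<..<T}"
      have bl: "integrable lebesgue (\<lambda>x::real^3. cutoff R x * bb k0 p x)"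
        "(LINT x::real^3|lebesgue. cutoff R x * bb k0 p x) = (LINT x::real^3|lborel. cutoff R x * bb k0 p x)" for p
        using bint[of p] by (auto simp: integrable_completion integral_completion)
      \<comment> \<open>The Barenblatt parts at times \<open>t\<close> and 0 are added back, so that
        only \<open>cutoff R x * (u x t - u0 x)\<close> is left, which the local convergence
        controls.\<close>
      have "m R t - \<mu> R + (\<beta> t - \<beta> 0) = (LINT x|lebesgue. (cutoff R x * (u x t - bb k0 (T - t) x) - cutoff R x * (u0 x - bb k0 T x))
          + (cutoff R x * bb k0 (T - t) x - cutoff R x * bb k0 (T - 0) x))"
        unfolding m_leb[OF t] \<mu>_def \<beta>_def
        using cutoff_mult_integrable[OF uB[OF t], of R] cutoff_mult_integrable[OF u0(1), of R] bl
        by (simp add: Bochner_Integration.integral_diff Bochner_Integration.integral_add)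
      also have "\<dots> = (LINT x|lebesgue. cutoff R x * (u x t - u0 x))" by (simp add: algebra_simps)
      finally have e: "m R t - \<mu> R + (\<beta> t - \<beta> 0) = (LINT x|lebesgue. cutoff R x * (u x t - u0 x))" .
      have "integrable (lebesgue_on ?K) (\<lambda>x. \<bar>u x t - u0 x\<bar>)" using i by (rule integrable_abs)
      then have i2: "integrable lebesgue (\<lambda>x. indicator ?K x *\<^sub>R \<bar>u x t - u0 x\<bar>)"
        by (subst (asm) integrable_restrict_space) auto
      have "\<bar>LINT x|lebesgue. cutoff R x * (u x t - u0 x)\<bar> \<le> (LINT x|lebesgue. indicator ?K x *\<^sub>R \<bar>u x t - u0 x\<bar>)"
      proof (rule abs_integral_le[OF i2])
        fix x
        show "\<bar>cutoff R x * (u x t - u0 x)\<bar> \<le> indicator ?K x *\<^sub>R \<bar>u x t - u0 x\<bar>"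
          using abs_cutoff_mult[of R x] cutoff_supp(1)[OF R, of x] by (cases "norm x \<le> R") auto
      qed
      also have "\<dots> = (LINT x|lebesgue_on ?K. \<bar>u x t - u0 x\<bar>)"
        by (subst integral_restrict_space) auto
      finally show "\<bar>m R t - \<mu> R + (\<beta> t - \<beta> 0)\<bar> \<le> (LINT x|lebesgue_on ?K. \<bar>u x t - u0 x\<bar>)" unfolding e .
    qed
    then have "((\<lambda>t. m R t - \<mu> R + (\<beta> t - \<beta> 0)) \<longlongrightarrow> 0) (at_right 0)"
      by (intro Lim_null_comparison[OF _ L(2)]) auto
    from tendsto_diff[OF this \<beta>] show ?thesis by (simp add: LIM_zero_iff)
  qed
  have bd: "\<bar>m R t2 - \<mu> R\<bar> \<le> C / sqrt R" if R: "R > 0" for R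
  proof (rule tendsto_upperbound)
    show "((\<lambda>t. \<bar>m R t2 - m R t\<bar>) \<longlongrightarrow> \<bar>m R t2 - \<mu> R\<bar>) (at_right 0)" by (intro tendsto_intros lim R)
    have "\<forall>\<^sub>F t in at_right 0. t \<in> {0<..<t2}" using eventually_at_right_real[of 0 t2] t2 by auto
    then show "\<forall>\<^sub>F t in at_right 0. \<bar>m R t2 - m R t\<bar> \<le> C / sqrt R"
      by eventually_elim (use C[OF R] in auto)
  qed simp
  let ?I = "LINT x|lborel. u x t2 - bb k0 (T - t2) x"
  have "?I = (LINT x|lebesgue. u x t2 - bb k0 (T - t2) x)"
    using integrable_u_minus_bb[OF k0 t2] by (simp add: integral_completion)
  then have "(\<lambda>n. m (real (Suc n)) t2) \<longlonglongrightarrow> ?I"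
    using cutoff_integral_tendsto[OF uB[OF t2]] unfolding m_leb[OF t2] by simp
  moreover have "(\<lambda>n. \<mu> (real (Suc n))) \<longlonglongrightarrow> 0"
    using cutoff_integral_tendsto[OF u0(1)] unfolding \<mu>_def u0(2) .
  ultimately have "(\<lambda>n. \<bar>m (real (Suc n)) t2 - \<mu> (real (Suc n))\<bar>) \<longlonglongrightarrow> \<bar>?I - 0\<bar>" by (intro tendsto_intros)
  then have "\<bar>?I - 0\<bar> \<le> 0"
    by (rule LIMSEQ_le[OF _ tendsto_const_over_sqrt[of C]]) (use bd in auto)
  then show ?thesis by simp
qed

end

section \<open>Entropy\<close>

definition entropy_density :: "real \<Rightarrow> real" where
  "entropy_density y = y - 1 - ln y"

text \<open>All from \<open>ln z \<le> z - 1\<close>. At \<open>z = 1 / y\<close> it gives the upper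
  bound. At \<open>z = sqrt y\<close> it puts \<open>(sqrt y - 1)^2\<close> below the entropy
  density, and \<open>(sqrt y + 1) * (sqrt y - 1) = y - 1\<close>.\<close>

lemma entropy_density_bounds:
  assumes "y > 0"
  shows "0 \<le> entropy_density y"
    and "entropy_density y \<le> (y - 1)\<^sup>2 * (1 / y)"
    and "(y - 1)\<^sup>2 \<le> (sqrt y + 1)\<^sup>2 * entropy_density y"
proof -
  show "0 \<le> entropy_density y" using ln_le_minus_one[OF assms] unfolding entropy_density_def by simp
  have "- ln y \<le> 1 / y - 1" using ln_le_minus_one[of "1 / y"] assms by (simp add: ln_div)
  then have "entropy_density y \<le> y - 2 + 1 / y" unfolding entropy_density_def by simp
  also have "\<dots> = (y - 1)\<^sup>2 * (1 / y)" using assms by (simp add: power2_diff field_simps power2_eq_square)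
  finally show "entropy_density y \<le> (y - 1)\<^sup>2 * (1 / y)" .
  have s: "sqrt y > 0" "(sqrt y)\<^sup>2 = y" using assms by auto
  have "ln (sqrt y) \<le> sqrt y - 1" by (rule ln_le_minus_one[OF s(1)])
  then have "ln y \<le> 2 * sqrt y - 2" using assms by (simp add: ln_sqrt)
  then have "(sqrt y - 1)\<^sup>2 \<le> entropy_density y"
    using s(2) unfolding entropy_density_def by (simp add: power2_diff)
  then have "(sqrt y + 1)\<^sup>2 * (sqrt y - 1)\<^sup>2 \<le> (sqrt y + 1)\<^sup>2 * entropy_density y"
    by (intro mult_left_mono) auto
  moreover have "(sqrt y + 1)\<^sup>2 * (sqrt y - 1)\<^sup>2 = (y - 1)\<^sup>2"
  proof -
    have "(sqrt y + 1) * (sqrt y - 1) = y - 1" using s(2) by (simp add: algebra_simps power2_eq_square)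
    then show ?thesis by (metis power_mult_distrib)
  qed
  ultimately show "(y - 1)\<^sup>2 \<le> (sqrt y + 1)\<^sup>2 * entropy_density y" by simp
qed

text \<open>Of the four factors of the positive part three make up the cutoff, and the one that is
  left is bounded. So the squared gradient divided by the cutoff stays bounded, which lets Young's
  inequality absorb the cross term into the dissipation.\<close>

lemma cutoff1_square:
  "(cutoff1 R b x)\<^sup>2 = cutoff R x * (36 * max 0 (1 - (norm x)\<^sup>2 / R\<^sup>2) * (x \<bullet> b)\<^sup>2 / R ^ 4)"
  unfolding cutoff1_def cutoff_def
  by (simp add: power_mult_distrib power_divide power2_eq_square power3_eq_cube mult_ac power4_eq_xxxx)

text \<open>Young's inequality with weight \<open>w\<close>, proved by comparing squares with
  \<open>4 * X * Y \<le> (X + Y)^2\<close>, so that \<open>w\<close> may vanish.\<close>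

lemma two_mult_le_weighted:
  fixes a c w K d :: real
  assumes "c\<^sup>2 = w * K" "w \<ge> 0" "K \<ge> 0"
  shows "2 * \<bar>a * d * c\<bar> \<le> w * d\<^sup>2 + a\<^sup>2 * K"
proof -
  have "(2 * \<bar>a * d * c\<bar>)\<^sup>2 = 4 * (w * d\<^sup>2) * (a\<^sup>2 * K)"
    using assms(1) by (simp add: power_mult_distrib mult_ac)
  also have "\<dots> \<le> (w * d\<^sup>2 + a\<^sup>2 * K)\<^sup>2"
  proof -
    have "4 * X * Y \<le> (X + Y)\<^sup>2" for X Y :: real
      using zero_le_power2[of "X - Y"] unfolding power2_sum power2_diff by linarith
    then show ?thesis by blast
  qed
  finally show ?thesis by (rule power2_le_imp_le) (use assms in \<open>auto intro!: add_nonneg_nonneg\<close>)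
qed

context trapped_solution
begin

text \<open>With \<open>A = 1 / B - 1 / u\<close> (\<open>pressure_gap\<close>) the equation reads \<open>u\<^sub>t = div (u * grad A) - div (x * u) / (T - t)\<close>.\<close>

definition pressure_gap :: "real \<Rightarrow> real^3 \<Rightarrow> real \<Rightarrow> real" where
  "pressure_gap k0 x t = 1 / bb k0 (T - t) x - 1 / u x t"

text \<open>The gradient is free of \<open>k0\<close>, which enters \<open>1 / B\<close> only
  through a term constant in \<open>x\<close>.\<close>

definition pressure_gap1 :: "real^3 \<Rightarrow> real^3 \<Rightarrow> real \<Rightarrow> real" where
  "pressure_gap1 b x t = (x \<bullet> b) / (T - t) + g b x t / (u x t)\<^sup>2"

lemma has_dd_pressure_gap:
  assumes "k0 > 0" "t \<in> {0<..<T}" "b \<in> Basis"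
  shows "has_dd (\<lambda>x. pressure_gap k0 x t) b (\<lambda>x. pressure_gap1 b x t)"
  unfolding has_dd_def
proof
  fix x
  have p: "T - t > 0" using assms by simp
  have "((\<lambda>h. u (x + h *\<^sub>R b) t) has_real_derivative g b x t) (at 0)"
    using dx[OF assms(2,3)] unfolding has_dd_def by auto
  then have 1: "((\<lambda>h. 1 / u (x + h *\<^sub>R b) t) has_real_derivative - (g b x t / (u x t)\<^sup>2)) (at 0)"
    using upos[OF assms(2), of x] by (auto intro!: derivative_eq_intros simp: power2_eq_square)
  define p where "p = T - t"
  have p0: "p > 0" using p p_def by simp
  have B: "1 / bb k0 p y = k0 / (2 * p ^ 3) + (norm y)\<^sup>2 * (1 / (2 * p))" for y :: "real^3"
    using p0 unfolding bb_def by (simp add: add_divide_distrib power2_eq_square power3_eq_cube)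
  have "has_dd (\<lambda>y. k0 / (2 * p ^ 3) + (norm y)\<^sup>2 * (1 / (2 * p))) b
    (\<lambda>y. 0 + (2 * (y \<bullet> b) * (1 / (2 * p)) + 0 * (norm y)\<^sup>2))"
    by (intro has_dd_add has_dd_mult has_dd_const has_dd_norm2)
  then have 2: "((\<lambda>h. 1 / bb k0 (T - t) (x + h *\<^sub>R b)) has_real_derivative (x \<bullet> b) / (T - t)) (at 0)"
    unfolding p_def[symmetric] B has_dd_def by simp
  show "((\<lambda>h. pressure_gap k0 (x + h *\<^sub>R b) t) has_real_derivative pressure_gap1 b x t) (at 0)"
    unfolding pressure_gap_def pressure_gap1_def using DERIV_diff[OF 2 1] by simp
qed

lemma continuous_pressure_gap:
  assumes "k0 > 0" "t \<in> {0<..<T}"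
  shows "continuous_on UNIV (\<lambda>x. pressure_gap k0 x t)"
  unfolding pressure_gap_def using bb_pos[OF assms(1), of "T - t"] upos[OF assms(2)] assms(2)
  by (intro continuous_intros sliceu continuous_on_bb assms) (auto simp: less_le)

lemma continuous_pressure_gap1:
  assumes "t \<in> {0<..<T}" "b \<in> Basis"
  shows "continuous_on UNIV (\<lambda>x. pressure_gap1 b x t)"
  unfolding pressure_gap1_def using upos[OF assms(1)] assms(1)
  by (intro continuous_intros sliceu sliceg assms) (auto simp: less_le)

text \<open>The factor \<open>(T - t) ^ 3\<close> is the Jacobian of
  \<open>x \<mapsto> (T - t) *\<^sub>R x\<close>: without the cutoff this is the relative entropy of
  the rescaled solution.\<close>

definition cutoff_entropy :: "real \<Rightarrow> real \<Rightarrow> real \<Rightarrow> real" where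
  "cutoff_entropy k0 R t =
     (LINT x|lborel. cutoff R x * ((T - t) ^ 3 * entropy_density (u x t / bb k0 (T - t) x)))"

definition entropy :: "real \<Rightarrow> real \<Rightarrow> real" where
  "entropy k0 t = (LINT x|lborel. (T - t) ^ 3 * entropy_density (u x t / bb k0 (T - t) x))"

lemma ratio_pos: "k0 > 0 \<Longrightarrow> t \<in> {0<..<T} \<Longrightarrow> u x t / bb k0 (T - t) x > 0"
  using upos[of t x] bb_pos[of k0 "T - t" x] by auto

lemma ratio_minus_one:
  "k0 > 0 \<Longrightarrow> t \<in> {0<..<T} \<Longrightarrow> u x t / bb k0 (T - t) x - 1 = pressure_gap k0 x t * u x t"
  unfolding pressure_gap_def using upos[of t x] by (simp add: left_diff_distrib)

lemma entropy_density_le: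
  assumes "k0 > 0" "t \<in> {0<..<T}"
  shows "entropy_density (u x t / bb k0 (T - t) x) \<le> (1 + k1 / k0) * (u x t / bb k0 (T - t) x - 1)\<^sup>2"
proof -
  have "1 / (u x t / bb k0 (T - t) x) \<le> 1 + k1 / k0"
    using u_sandwich(5)[OF assms(1,2,2,2), of x] by simp
  then have "(u x t / bb k0 (T - t) x - 1)\<^sup>2 * (1 / (u x t / bb k0 (T - t) x)) \<le> (u x t / bb k0 (T - t) x - 1)\<^sup>2 * (1 + k1 / k0)"
    by (intro mult_left_mono) auto
  from order_trans[OF entropy_density_bounds(2)[OF ratio_pos[OF assms]] this]
  show ?thesis by (simp only: mult.commute)
qed

lemma continuous_entropy_density:
  assumes "k0 > 0" "t \<in> {0<..<T}"
  shows "continuous_on UNIV (\<lambda>x. entropy_density (u x t / bb k0 (T - t) x))"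
  unfolding entropy_density_def using ratio_pos[OF assms] bb_pos[OF assms(1), of "T - t"] assms(2)
  by (intro continuous_intros sliceu continuous_on_bb assms) (auto simp: less_le)

lemma entropy_density_decay:
  assumes "k0 > 0" "t \<in> {0<..<T}"
  shows "entropy_density (u x t / bb k0 (T - t) x) \<le> (1 + k1 / k0) * (k0 + k1)\<^sup>2 * (1 / (k2 + (T - t)\<^sup>2 * (norm x)\<^sup>2)\<^sup>2)"
proof -
  have "(u x t / bb k0 (T - t) x - 1)\<^sup>2 \<le> ((k0 + k1) / (k2 + (T - t)\<^sup>2 * (norm x)\<^sup>2))\<^sup>2"
    using u_sandwich(3)[OF assms(1,2,2,2), of x] by (metis abs_ge_zero power2_abs power_mono)
  then have "(1 + k1 / k0) * (u x t / bb k0 (T - t) x - 1)\<^sup>2 \<le> (1 + k1 / k0) * ((k0 + k1) / (k2 + (T - t)\<^sup>2 * (norm x)\<^sup>2))\<^sup>2"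
    using assms k1 by (intro mult_left_mono) auto
  with entropy_density_le[OF assms, of x] show ?thesis by (simp add: power_divide)
qed

lemma integrable_entropy:
  assumes "k0 > 0" "t \<in> {0<..<T}"
  shows "integrable lborel (\<lambda>x. (T - t) ^ 3 * entropy_density (u x t / bb k0 (T - t) x))"
proof (intro integrable_mult_right, rule Bochner_Integration.integrable_bound)
  show "integrable lborel (\<lambda>x::real^3. (1 + k1 / k0) * (k0 + k1)\<^sup>2 * (1 / (k2 + (T - t)\<^sup>2 * (norm x)\<^sup>2)\<^sup>2))"
    using assms k by (intro integrable_mult_right integrable_inverse_quartic_scaled) auto
  show "(\<lambda>x. entropy_density (u x t / bb k0 (T - t) x)) \<in> borel_measurable lborel"
    by (intro lborel_of_continuous continuous_entropy_density assms)
  show "AE x in lborel. norm (entropy_density (u x t / bb k0 (T - t) x))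
      \<le> norm ((1 + k1 / k0) * (k0 + k1)\<^sup>2 * (1 / (k2 + (T - t)\<^sup>2 * (norm x)\<^sup>2)\<^sup>2))"
  proof (rule AE_I2)
    fix x
    show "norm (entropy_density (u x t / bb k0 (T - t) x))
      \<le> norm ((1 + k1 / k0) * (k0 + k1)\<^sup>2 * (1 / (k2 + (T - t)\<^sup>2 * (norm x)\<^sup>2)\<^sup>2))"
      using order_trans[OF entropy_density_decay[OF assms, of x] abs_ge_self]
        entropy_density_bounds(1)[OF ratio_pos[OF assms, of x]] by simp
  qed
qed

text \<open>Once the decay bound of the density is rescaled, the factor \<open>(T - t) ^ 3\<close>
  absorbs all dependence on time.\<close>

lemma entropy_bounded:
  assumes "k0 > 0"
  obtains C where "\<And>t. t \<in> {0<..<T} \<Longrightarrow> entropy k0 t \<le> C"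
proof
  fix t assume t: "t \<in> {0<..<T}"
  let ?f = "\<lambda>x::real^3. 1 / (k2 + 1 * (norm x)\<^sup>2)\<^sup>2"
  let ?c = "(1 + k1 / k0) * (k0 + k1)\<^sup>2"
  have p: "T - t > 0" using t by simp
  have "entropy k0 t \<le> (LINT x::real^3|lborel. (T - t) ^ 3 * (?c * (1 / (k2 + (T - t)\<^sup>2 * (norm x)\<^sup>2)\<^sup>2)))"
    unfolding entropy_def
  proof (rule integral_mono[OF integrable_entropy[OF assms t]])
    show "integrable lborel (\<lambda>x::real^3. (T - t) ^ 3 * (?c * (1 / (k2 + (T - t)\<^sup>2 * (norm x)\<^sup>2)\<^sup>2)))"
      using p k by (intro integrable_mult_right integrable_inverse_quartic_scaled) auto
    show "(T - t) ^ 3 * entropy_density (u x t / bb k0 (T - t) x) \<le> (T - t) ^ 3 * (?c * (1 / (k2 + (T - t)\<^sup>2 * (norm x)\<^sup>2)\<^sup>2))" for x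
      using p by (intro mult_left_mono entropy_density_decay assms t) simp
  qed
  also have "\<dots> = ?c * (\<bar>T - t\<bar> ^ 3 * (LINT x::real^3|lborel. ?f (0 + (T - t) *\<^sub>R x)))"
    unfolding integral_mult_right_zero using p by (simp add: power_mult_distrib)
  also have "\<dots> = ?c * (LINT x::real^3|lborel. ?f x)"
    using lborel_integral_affine[of ?f "T - t" 0] p by simp
  finally show "entropy k0 t \<le> ?c * (LINT x::real^3|lborel. ?f x)" .
qed

text \<open>Without the cutoff, the integrand \<open>(T - t)\<^sup>3 * h (u / B)\<close> has time derivative
  \<open>(T - t)\<^sup>3 * (div (A * u * grad A) - u * (norm (grad A))\<^sup>2) - (T - t)\<^sup>2 * div (x * h (u / B))\<close>.\<close>

lemma cutoff_entropy_derivative: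
  assumes k0: "k0 > 0" and t: "t \<in> {0<..<T}" and R: "R > 0"
  shows "((\<lambda>t. cutoff_entropy k0 R t) has_real_derivative
    (LINT x|lborel. (\<Sum>b\<in>Basis. - (((T - t) ^ 3 * pressure_gap k0 x t * (u x t * pressure_gap1 b x t)
           - (T - t)\<^sup>2 * (x \<bullet> b) * entropy_density (u x t / bb k0 (T - t) x)) * cutoff1 R b x))
      - (T - t) ^ 3 * cutoff R x * u x t * (\<Sum>b\<in>Basis. (pressure_gap1 b x t)\<^sup>2))) (at t)"
proof -
  define p where "p = T - t"
  have p: "p > 0" using t unfolding p_def by simp
  define A where "A x = pressure_gap k0 x t" for x
  define Ab where "Ab b x = pressure_gap1 b x t" for b x
  define B where "B x = bb k0 p x" for x :: "real^3"
  define y where "y x = u x t / B x" for x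
  have Bpos: "B x > 0" for x unfolding B_def using bb_pos[OF k0 p] .
  have up: "u x t > 0" for x using upos[OF t] .
  have ypos: "y x > 0" for x unfolding y_def using Bpos up by simp
  have Au: "A x * u x t = y x - 1" for x
    unfolding A_def y_def B_def p_def using ratio_minus_one[OF k0 t] by simp
  have ent: "continuous_on UNIV (\<lambda>x. entropy_density (y x))"
    unfolding y_def B_def p_def by (rule continuous_entropy_density[OF k0 t])
  have cA: "continuous_on UNIV A"
    unfolding A_def[abs_def] by (rule continuous_pressure_gap[OF k0 t])
  have cAb: "continuous_on UNIV (Ab b)" if "b \<in> Basis" for b
    unfolding Ab_def by (rule continuous_pressure_gap1[OF t that])
  have cB: "continuous_on UNIV B" unfolding B_def[abs_def] by (rule continuous_on_bb[OF k0])
  define F' where "F' x = cutoff R x * (- 3 * p\<^sup>2 * entropy_density (y x)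
      + p ^ 3 * (A x * ut x t - (y x - 1) * bb_dt k0 p x / B x))" for x
  have D: "((\<lambda>t. cutoff_entropy k0 R t) has_real_derivative (LINT x|lborel. F' x)) (at t)"
  proof -
    define G where "G x t = cutoff R x * (- 3 * (T - t)\<^sup>2 * entropy_density (u x t / bb k0 (T - t) x)
      + (T - t) ^ 3 * (pressure_gap k0 x t * ut x t - (u x t / bb k0 (T - t) x - 1) * bb_dt k0 (T - t) x / bb k0 (T - t) x))" for x t
    have "((\<lambda>t. cutoff_entropy k0 R t) has_real_derivative (LINT x|lborel. G x t)) (at t)"
      unfolding cutoff_entropy_def
    proof (rule leibniz_lborel[where a=0 and b=T and R=R])
      fix x :: "real^3" and t assume t: "t \<in> {0<..<T}"
      have p: "T - t > 0" using t by simp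
      have b: "bb k0 (T - t) x > 0" using bb_pos[OF k0 p] .
      have 1: "((\<lambda>t. u x t / bb k0 (T - t) x) has_real_derivative
           (ut x t * bb k0 (T - t) x - u x t * bb_dt k0 (T - t) x) / (bb k0 (T - t) x * bb k0 (T - t) x)) (at t)"
        using b p by (intro DERIV_divide dt t bb_time_derivative k0) auto
      have h: "(entropy_density has_real_derivative 1 - 1 / y) (at y)" if "y > 0" for y
        unfolding entropy_density_def[abs_def] using that by (auto intro!: derivative_eq_intros)
      have 2: "((\<lambda>t. entropy_density (u x t / bb k0 (T - t) x)) has_real_derivative
          (1 - 1 / (u x t / bb k0 (T - t) x)) * ((ut x t * bb k0 (T - t) x - u x t * bb_dt k0 (T - t) x) / (bb k0 (T - t) x * bb k0 (T - t) x))) (at t)"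
        by (rule DERIV_chain2[where f=entropy_density and g="\<lambda>t. u x t / bb k0 (T - t) x", OF h[OF ratio_pos[OF k0 t]] 1])
      have 3: "((\<lambda>t. (T - t) ^ 3) has_real_derivative - 3 * (T - t)\<^sup>2) (at t)"
        by (auto intro!: derivative_eq_intros)
      have alg: "(1 - 1 / (v / b)) * ((vt * b - v * bt) / (b * b)) = (1 / b - 1 / v) * vt - (v / b - 1) * bt / b"
        if "v > 0" "b > 0" for v b vt bt :: real
        using that by (simp add: field_simps)
      have "((\<lambda>t. cutoff R x * ((T - t) ^ 3 * entropy_density (u x t / bb k0 (T - t) x))) has_real_derivative
        cutoff R x * (- 3 * (T - t)\<^sup>2 * entropy_density (u x t / bb k0 (T - t) x) +
          ((1 - 1 / (u x t / bb k0 (T - t) x)) * ((ut x t * bb k0 (T - t) x - u x t * bb_dt k0 (T - t) x) / (bb k0 (T - t) x * bb k0 (T - t) x))) * (T - t) ^ 3)) (at t)"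
        by (rule DERIV_cmult[OF DERIV_mult[OF 3 2]])
      then show "((\<lambda>t. cutoff R x * ((T - t) ^ 3 * entropy_density (u x t / bb k0 (T - t) x))) has_real_derivative G x t) (at t)"
        unfolding alg[OF upos[OF t] b] G_def pressure_gap_def by (simp add: mult.commute)
      show "continuous_on UNIV (\<lambda>x. cutoff R x * ((T - t) ^ 3 * entropy_density (u x t / bb k0 (T - t) x)))"
        by (intro continuous_intros continuous_on_cutoff continuous_entropy_density k0 t)
    next
      let ?S = "(UNIV :: (real^3) set) \<times> {0<..<T}"
      have a: "continuous_on ?S (\<lambda>z. bb k0 (T - snd z) (fst z))"
        using continuous_on_bb_joint[OF k0] by (simp add: split_beta)
      have b: "continuous_on ?S (\<lambda>z. ut (fst z) (snd z))" "continuous_on ?S (\<lambda>z. u (fst z) (snd z))"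
        using contut contu by (simp_all add: split_beta)
      have c: "continuous_on ?S (\<lambda>z. cutoff R (fst z))"
        by (intro continuous_on_compose2[OF continuous_on_cutoff(1)] continuous_intros) auto
      have ne: "T - snd z \<noteq> 0" "bb k0 (T - snd z) (fst z) \<noteq> 0" "u (fst z) (snd z) \<noteq> 0" "u (fst z) (snd z) / bb k0 (T - snd z) (fst z) \<noteq> 0" if "z \<in> ?S" for z
        using that upos[of "snd z" "fst z"] bb_pos[OF k0, of "T - snd z" "fst z"] by (auto simp: mem_Times_iff)
      show "continuous_on ?S (\<lambda>(x, t). G x t)"
        unfolding G_def split_beta bb_dt_def pressure_gap_def entropy_density_def
        by (intro continuous_intros a b c ballI ne power_not_zero) auto
    qed (use t R cutoff_supp in \<open>auto simp: G_def\<close>)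
    then show ?thesis unfolding G_def F'_def A_def y_def B_def p_def .
  qed
  \<comment> \<open>\<open>V\<close> is the flux: its divergence, multiplied by the cutoff, accounts
    for everything except the dissipation.\<close>
  define V where "V b x = p ^ 3 * A x * (u x t * Ab b x) - p\<^sup>2 * (x \<bullet> b) * entropy_density (y x)" for b x
  define V' where "V' b x = p ^ 3 * (Ab b x * (u x t * Ab b x)
        + A x * (H b x t / u x t - (g b x t / u x t)\<^sup>2 + g b x t * (x \<bullet> b) / p + u x t / p))
      - p\<^sup>2 * (entropy_density (y x) + (x \<bullet> b) * ((y x - 1) * (g b x t / u x t + B x * (x \<bullet> b) / p)))" for b x
  have ddV: "has_dd (V b) b (V' b)" if b: "b \<in> Basis" for b
  proof -
    have bb1: "b \<bullet> b = 1" using b by (simp add: inner_Basis)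
    have nb: "norm b = 1" using b by simp
    have dA: "has_dd A b (Ab b)" unfolding A_def Ab_def by (rule has_dd_pressure_gap[OF k0 t b])
    have du: "has_dd (\<lambda>x. u x t) b (\<lambda>x. g b x t)" by (rule dx[OF t b])
    have uAb: "u x t * Ab b x = g b x t / u x t + u x t * (x \<bullet> b) * (1 / p)" for x
      unfolding Ab_def pressure_gap1_def p_def[symmetric] using up[of x]
      by (simp add: distrib_left power2_eq_square)
    have "has_dd (\<lambda>x. g b x t / u x t + u x t * (x \<bullet> b) * (1 / p)) b
       (\<lambda>x. (H b x t / u x t - (g b x t / u x t)\<^sup>2) + ((g b x t * (x \<bullet> b) + (b \<bullet> b) * u x t) * (1 / p) + 0 * (u x t * (x \<bullet> b))))"
      by (intro has_dd_add has_dd_mult has_dd_const has_dd_inner du dd_ln t b)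
    then have duA: "has_dd (\<lambda>x. u x t * Ab b x) b
        (\<lambda>x. H b x t / u x t - (g b x t / u x t)\<^sup>2 + g b x t * (x \<bullet> b) / p + u x t / p)"
      unfolding uAb by (simp add: bb1 add_divide_distrib add.assoc)
    have dln: "has_dd (\<lambda>x. ln (u x t) - ln (B x)) b (\<lambda>x. g b x t / u x t - (- (x \<bullet> b) * B x / p))"
      unfolding B_def by (intro has_dd_diff dd_ln dd_ln_bb t b k0 p nb)
    \<comment> \<open>The density is written through \<open>ln u - ln B\<close>, whose directional
      derivative is already known.\<close>
    have hy: "entropy_density (y x) = exp (ln (u x t) - ln (B x)) - 1 - (ln (u x t) - ln (B x))" for x
      unfolding entropy_density_def y_def using up[of x] Bpos[of x] by (simp add: ln_div exp_diff)
    have yex: "exp (ln (u x t) - ln (B x)) = y x" for x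
      unfolding y_def using up[of x] Bpos[of x] by (simp add: exp_diff)
    have "has_dd (\<lambda>x. exp (ln (u x t) - ln (B x)) - 1 - (ln (u x t) - ln (B x))) b
        (\<lambda>x. exp (ln (u x t) - ln (B x)) * (g b x t / u x t - (- (x \<bullet> b) * B x / p)) - 0 - (g b x t / u x t - (- (x \<bullet> b) * B x / p)))"
      by (intro has_dd_diff dln has_dd_const has_dd_chain[OF dln DERIV_exp])
    then have dh: "has_dd (\<lambda>x. entropy_density (y x)) b (\<lambda>x. (y x - 1) * (g b x t / u x t + B x * (x \<bullet> b) / p))"
    proof -
      assume "has_dd (\<lambda>x. exp (ln (u x t) - ln (B x)) - 1 - (ln (u x t) - ln (B x))) b
        (\<lambda>x. exp (ln (u x t) - ln (B x)) * (g b x t / u x t - (- (x \<bullet> b) * B x / p)) - 0 - (g b x t / u x t - (- (x \<bullet> b) * B x / p)))"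
      moreover have "exp (ln (u x t) - ln (B x)) * (g b x t / u x t - (- (x \<bullet> b) * B x / p)) - 0 - (g b x t / u x t - (- (x \<bullet> b) * B x / p))
        = (y x - 1) * (g b x t / u x t + B x * (x \<bullet> b) / p)" for x
        unfolding yex by (simp add: left_diff_distrib mult.commute)
      ultimately show ?thesis unfolding hy by (simp only:)
    qed
    have "has_dd (\<lambda>x. p ^ 3 * (A x * (u x t * Ab b x)) - p\<^sup>2 * ((x \<bullet> b) * entropy_density (y x))) b
       (\<lambda>x. (0 * (A x * (u x t * Ab b x)) + (Ab b x * (u x t * Ab b x)
           + (H b x t / u x t - (g b x t / u x t)\<^sup>2 + g b x t * (x \<bullet> b) / p + u x t / p) * A x) * p ^ 3)
        - (0 * ((x \<bullet> b) * entropy_density (y x)) + ((b \<bullet> b) * entropy_density (y x)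
           + (y x - 1) * (g b x t / u x t + B x * (x \<bullet> b) / p) * (x \<bullet> b)) * p\<^sup>2))"
      by (intro has_dd_diff has_dd_mult has_dd_const has_dd_inner dA duA dh)
    then show ?thesis unfolding V_def[abs_def] V'_def[abs_def] bb1 by (simp add: mult_ac)
  qed
  have cV: "continuous_on UNIV (V b)" "continuous_on UNIV (V' b)" if "b \<in> Basis" for b
  proof -
    have cy: "continuous_on UNIV y" unfolding y_def[abs_def] using Bpos
      by (intro continuous_intros sliceu t cB) (auto simp: less_le)
    show "continuous_on UNIV (V b)" unfolding V_def[abs_def]
      by (intro continuous_intros sliceu t cA cAb ent that)
    show "continuous_on UNIV (V' b)" unfolding V'_def[abs_def] using up p
      by (intro continuous_intros sliceu sliceg sliceH t cA cAb ent cy cB that) (auto simp: less_le)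
  qed
  \<comment> \<open>The pointwise divergence identity. By \<open>A * u = y - 1\<close> the terms
    with the inner product of \<open>x\<close> and \<open>grad u\<close> cancel; the factors 3 come
    from the divergence of \<open>x\<close> in dimension 3.\<close>
  have alg: "F' x = (\<Sum>b\<in>Basis. cutoff R x * V' b x) - p ^ 3 * cutoff R x * u x t * (\<Sum>b\<in>Basis. (Ab b x)\<^sup>2)" for x
  proof -
    define G where "G = (\<Sum>b\<in>Basis. g b x t * (x \<bullet> b))"
    define S where "S = (\<Sum>b\<in>Basis. (Ab b x)\<^sup>2)"
    have "(\<Sum>b\<in>Basis. V' b x) = p ^ 3 * (u x t * S + A x * (ut x t + G / p + 3 * (u x t / p)))
       - p\<^sup>2 * (3 * entropy_density (y x) + (y x - 1) * (G / u x t + B x * (norm x)\<^sup>2 / p))"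
    proof -
      have V'eq: "V' b x = p ^ 3 * (u x t * (Ab b x)\<^sup>2)
        + p ^ 3 * A x * (H b x t / u x t - (g b x t / u x t)\<^sup>2) + p ^ 3 * A x * (1 / p) * (g b x t * (x \<bullet> b)) + p ^ 3 * A x * (u x t / p)
        - (p\<^sup>2 * entropy_density (y x) + p\<^sup>2 * (y x - 1) * (1 / u x t) * (g b x t * (x \<bullet> b)) + p\<^sup>2 * (y x - 1) * (B x / p) * (x \<bullet> b)\<^sup>2)" for b
        unfolding V'_def using p by (simp add: algebra_simps power2_eq_square diff_divide_distrib add_divide_distrib)
      show ?thesis
        unfolding V'eq sum_subtractf sum.distrib sum_distrib_left[symmetric] G_def[symmetric] S_def[symmetric]
          pde[OF t, symmetric] sum_inner_Basis_square
        unfolding pde[OF t] sum_subtractf[symmetric] by (simp add: algebra_simps add_divide_distrib diff_divide_distrib)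
    qed
    moreover have "- 3 * p\<^sup>2 * h + p ^ 3 * (a * ut' - (Y - 1) * (- 3 * b / p + r * b\<^sup>2 / p\<^sup>2) / b)
       = p ^ 3 * (v * S' + a * (ut' + G' / p + 3 * (v / p))) - p\<^sup>2 * (3 * h + (Y - 1) * (G' / v + b * r / p)) - p ^ 3 * v * S'"
      if "a * v = Y - 1" "v > 0" "b > 0" for a v Y b h ut' r S' G' :: real
    proof -
      have aa: "a = (Y - 1) / v" using that by (simp add: field_simps)
      have 1: "(Y - 1) * (- 3 * b / p + r * b\<^sup>2 / p\<^sup>2) / b = (Y - 1) * (- 3 / p + r * b / p\<^sup>2)"
      proof -
        have "(- 3 * b / p + r * b\<^sup>2 / p\<^sup>2) / b = - 3 / p + r * b / p\<^sup>2"
          using that p by (simp add: add_divide_distrib diff_divide_distrib power2_eq_square)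
        then show ?thesis by (simp only: times_divide_eq_right[symmetric])
      qed
      show ?thesis unfolding 1 aa using that p by (simp add: field_simps power2_eq_square power3_eq_cube)
    qed
    from this[of "A x" "u x t" "y x" "B x" "entropy_density (y x)" "ut x t" "(norm x)\<^sup>2" S G, OF Au up Bpos] calculation
    show ?thesis
      unfolding F'_def sum_distrib_left[symmetric] bb_dt_def B_def[symmetric] S_def[symmetric]
      by (simp add: right_diff_distrib mult_ac)
  qed
  have i1: "integrable lborel (\<lambda>x. cutoff R x * V' b x)" "integrable lborel (\<lambda>x. V b x * cutoff1 R b x)" if "b \<in> Basis" for b
    by (rule integrable_continuous_cball[where R=R];
        (intro continuous_intros continuous_on_cutoff cV that)?; simp add: cutoff_supp[OF R])+
  have i2: "integrable lborel (\<lambda>x. p ^ 3 * cutoff R x * u x t * (\<Sum>b\<in>Basis. (Ab b x)\<^sup>2))"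
    by (rule integrable_continuous_cball[where R=R];
        (intro continuous_intros continuous_on_cutoff sliceu t cAb)?; simp add: cutoff_supp[OF R])
  have "(LINT x|lborel. F' x) = (\<Sum>b\<in>Basis. LINT x|lborel. cutoff R x * V' b x) - (LINT x|lborel. p ^ 3 * cutoff R x * u x t * (\<Sum>b\<in>Basis. (Ab b x)\<^sup>2))"
    unfolding alg using i1(1) i2 by (subst Bochner_Integration.integral_diff) auto
  also have "(\<Sum>b\<in>Basis. LINT x|lborel. cutoff R x * V' b x) = (\<Sum>b\<in>Basis. LINT x|lborel. - (V b x * cutoff1 R b x))"
  proof (rule sum.cong[OF refl])
    fix b :: "real^3" assume b: "b \<in> Basis"
    have "(LINT x|lborel. cutoff R x * V' b x) = - (LINT x|lborel. V b x * cutoff1 R b x)"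
      by (rule integral_by_parts_dd[where R=R, OF ddV[OF b] has_dd_cutoff(1)[of R b] cV[OF b] continuous_on_cutoff(1,2)
            cutoff_supp(1,2)[OF R]])
    then show "(LINT x|lborel. cutoff R x * V' b x) = (LINT x|lborel. - (V b x * cutoff1 R b x))" by simp
  qed
  also have "(\<Sum>b\<in>Basis. LINT x|lborel. - (V b x * cutoff1 R b x)) - (LINT x|lborel. p ^ 3 * cutoff R x * u x t * (\<Sum>b\<in>Basis. (Ab b x)\<^sup>2))
     = (LINT x|lborel. (\<Sum>b\<in>Basis. - (V b x * cutoff1 R b x)) - p ^ 3 * cutoff R x * u x t * (\<Sum>b\<in>Basis. (Ab b x)\<^sup>2))"
    using i1(2) i2 by (subst Bochner_Integration.integral_diff) (auto simp: Bochner_Integration.integral_sum)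
  finally show ?thesis using D unfolding V_def Ab_def A_def y_def B_def p_def by simp
qed

end

lemma cutoff_integral_tendsto_lborel:
  assumes "integrable lborel f"
  shows "(\<lambda>n. LINT x|lborel. cutoff (real (Suc n)) x * f x) \<longlonglongrightarrow> (LINT x|lborel. f x)"
proof -
  have f: "f \<in> borel_measurable lborel" using assms by auto
  then have "(\<lambda>x. cutoff R x * f x) \<in> borel_measurable lborel" for R
    by (intro borel_measurable_times lborel_of_continuous[OF continuous_on_cutoff(1)])
  then have "(LINT x|lebesgue. cutoff R x * f x) = (LINT x|lborel. cutoff R x * f x)" for R
    by (rule integral_completion)
  then show ?thesis
    using cutoff_integral_tendsto[of f] f assms by (simp add: integral_completion integrable_completion)
qed

lemma cancel_sqrt:
  assumes "R > 0"
  shows "c / R\<^sup>2 * (C * (R * sqrt R)) = c * C / sqrt R"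
proof -
  define r where "r = sqrt R"
  have r: "r > 0" "R = r * r" using assms unfolding r_def by auto
  show ?thesis unfolding r_def[symmetric] unfolding r(2) using r(1) by (simp add: field_simps power2_eq_square)
qed

context trapped_solution
begin

text \<open>Half of the dissipation absorbs the cross term. What remains is a multiple of
  \<open>p ^ 3 * u * A^2\<close> times the squared gradient over the cutoff; as \<open>A\<close> is
  bounded in space and \<open>u\<close> decays like a Barenblatt solution, its integral is of order
  \<open>R^(-1/2)\<close>. The drift term has a favourable sign, because \<open>h\<close> is
  nonnegative and the cutoff decreases radially.\<close>

lemma cutoff_entropy_dissipation:
  assumes k0: "k0 > 0" and t2: "t2 \<in> {0<..<T}"
  obtains C where "C \<ge> 0" "\<And>R t. R > 0 \<Longrightarrow> 0 < t \<Longrightarrow> t \<le> t2 \<Longrightarrow>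
    \<exists>D. (cutoff_entropy k0 R has_real_derivative D) (at t) \<and>
      D \<le> C / sqrt R - 1 / 2 * (T - t) ^ 3 * (LINT x|lborel. cutoff R x * u x t * (\<Sum>b\<in>Basis. (pressure_gap1 b x t)\<^sup>2))"
proof -
  define p2 where "p2 = T - t2"
  have p2: "p2 > 0" using t2 unfolding p2_def by simp
  obtain C where C: "C \<ge> 0" "\<And>R. R > 0 \<Longrightarrow> (LINT x::real^3|lborel. indicator (cball 0 R) x * (1 / (k2 + p2\<^sup>2 * (norm x)\<^sup>2))) \<le> C * (R * sqrt R)"
    using integral_inverse_quadratic_growth[OF k(1), of "p2\<^sup>2"] p2 by auto
  define c where "c = (k0 + k1)\<^sup>2 * (9 + 6 * (1 + k1 / k0))"
  have c: "c \<ge> 0" unfolding c_def using k0 k1 by simp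
  show ?thesis
  proof (rule that[of "c * C"])
    show "c * C \<ge> 0" using c C by simp
    fix R t :: real assume R: "R > 0" and tt: "0 < t" "t \<le> t2"
    have t: "t \<in> {0<..<T}" using tt t2 by simp
    define p where "p = T - t"
    have p: "p > 0" "p2 \<le> p" using t tt unfolding p_def p2_def by auto
    define h where "h x = entropy_density (u x t / bb k0 (T - t) x)" for x
    define A where "A x = pressure_gap k0 x t" for x
    define Ab where "Ab b x = pressure_gap1 b x t" for b x
    define Q where "Q x = (\<Sum>b\<in>Basis. - ((p ^ 3 * A x * (u x t * Ab b x) - p\<^sup>2 * (x \<bullet> b) * h x) * cutoff1 R b x))
        - p ^ 3 * cutoff R x * u x t * (\<Sum>b\<in>Basis. (Ab b x)\<^sup>2)" for x
    define W where "W x = cutoff R x * u x t * (\<Sum>b\<in>Basis. (Ab b x)\<^sup>2)" for x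
    define E where "E x = c / R\<^sup>2 * (indicator (cball 0 R) x * (1 / (k2 + p2\<^sup>2 * (norm x)\<^sup>2)))" for x :: "real^3"
    have D: "(cutoff_entropy k0 R has_real_derivative (LINT x|lborel. Q x)) (at t)"
      using cutoff_entropy_derivative[OF k0 t R] unfolding Q_def p_def A_def Ab_def h_def .
    have h0: "h x \<ge> 0" for x unfolding h_def by (rule entropy_density_bounds(1)[OF ratio_pos[OF k0 t]])
    have up: "u x t > 0" for x using upos[OF t] .
    have le: "Q x \<le> E x - 1 / 2 * p ^ 3 * W x" for x
    proof (cases "norm x \<le> R")
      case False
      then show ?thesis using cutoff_supp[OF R, of x] unfolding Q_def E_def W_def by simp
    next
      case True
      define w where "w = max 0 (1 - (norm x)\<^sup>2 / R\<^sup>2)"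
      have r2: "(norm x)\<^sup>2 \<le> R\<^sup>2" using True by (intro power_mono) auto
      have w: "0 \<le> w" "w \<le> 1" unfolding w_def by auto
      define K where "K b = 36 * w * (x \<bullet> b)\<^sup>2 / R ^ 4" for b
      define q where "q = k2 + p\<^sup>2 * (norm x)\<^sup>2"
      have q: "q > 0" unfolding q_def using pos_quad[OF k(1), of "p\<^sup>2"] by simp
      have sumK: "(\<Sum>b\<in>Basis. K b) \<le> 36 / R\<^sup>2"
      proof -
        have "(\<Sum>b\<in>Basis. K b) = 36 * w * (norm x)\<^sup>2 / R ^ 4"
          unfolding K_def sum_divide_distrib[symmetric] sum_distrib_left[symmetric] sum_inner_Basis_square by simp
        also have "\<dots> \<le> 36 * 1 * R\<^sup>2 / R ^ 4"
          using w r2 R by (intro divide_right_mono mult_mono) auto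
        also have "\<dots> = 36 / R\<^sup>2" using R by (simp add: power2_eq_square power4_eq_xxxx)
        finally show ?thesis .
      qed
      have K0: "K b \<ge> 0" for b unfolding K_def using w by simp
      have one: "- (p ^ 3 * A x * (u x t * Ab b x) * cutoff1 R b x)
          \<le> 1 / 2 * p ^ 3 * u x t * (cutoff R x * (Ab b x)\<^sup>2) + 1 / 2 * p ^ 3 * u x t * ((A x)\<^sup>2 * K b)" for b
      proof -
        have "2 * \<bar>A x * Ab b x * cutoff1 R b x\<bar> \<le> cutoff R x * (Ab b x)\<^sup>2 + (A x)\<^sup>2 * K b"
          by (rule two_mult_le_weighted) (use cutoff1_square[of R b x] cutoff_range K0 in \<open>auto simp: K_def w_def\<close>)
        then have "\<bar>A x * Ab b x * cutoff1 R b x\<bar> \<le> 1 / 2 * (cutoff R x * (Ab b x)\<^sup>2 + (A x)\<^sup>2 * K b)" by simp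
        from order_trans[OF abs_ge_minus_self this]
        have "- (A x * Ab b x * cutoff1 R b x) \<le> 1 / 2 * (cutoff R x * (Ab b x)\<^sup>2 + (A x)\<^sup>2 * K b)" .
        then have "(p ^ 3 * u x t) * - (A x * Ab b x * cutoff1 R b x) \<le> (p ^ 3 * u x t) * (1 / 2 * (cutoff R x * (Ab b x)\<^sup>2 + (A x)\<^sup>2 * K b))"
          using p up[of x] by (intro mult_left_mono) auto
        then show ?thesis by (simp add: algebra_simps)
      qed
      have two: "(\<Sum>b\<in>Basis. p\<^sup>2 * (x \<bullet> b) * h x * cutoff1 R b x) \<le> 0"
      proof -
        have "(\<Sum>b\<in>Basis. p\<^sup>2 * (x \<bullet> b) * h x * cutoff1 R b x) = (\<Sum>b\<in>Basis. - (6 * p\<^sup>2 * h x * w\<^sup>2 / R\<^sup>2) * (x \<bullet> b)\<^sup>2)"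
          unfolding cutoff1_def w_def[symmetric] by (simp add: power2_eq_square mult_ac)
        also have "\<dots> = - (6 * p\<^sup>2 * h x * w\<^sup>2 / R\<^sup>2) * (norm x)\<^sup>2"
          unfolding sum_distrib_left[symmetric] sum_inner_Basis_square ..
        also have "\<dots> \<le> 0" using h0[of x] by simp
        finally show ?thesis .
      qed
      have "Q x = (\<Sum>b\<in>Basis. - (p ^ 3 * A x * (u x t * Ab b x) * cutoff1 R b x)) + (\<Sum>b\<in>Basis. p\<^sup>2 * (x \<bullet> b) * h x * cutoff1 R b x) - p ^ 3 * W x"
        unfolding Q_def W_def sum.distrib[symmetric] by (simp add: algebra_simps)
      also have "\<dots> \<le> (\<Sum>b\<in>Basis. 1 / 2 * p ^ 3 * u x t * (cutoff R x * (Ab b x)\<^sup>2) + 1 / 2 * p ^ 3 * u x t * ((A x)\<^sup>2 * K b)) + 0 - p ^ 3 * W x"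
        by (intro diff_right_mono add_mono sum_mono one two)
      also have "\<dots> = 1 / 2 * p ^ 3 * u x t * (A x)\<^sup>2 * (\<Sum>b\<in>Basis. K b) - 1 / 2 * p ^ 3 * W x"
        unfolding W_def sum.distrib sum_distrib_left[symmetric] by (simp add: algebra_simps)
      \<comment> \<open>The powers of \<open>p\<close> cancel: \<open>p ^ 3\<close> and
        \<open>u \<le> 2 * p ^ 3 / q\<close> stand against the square of \<open>2 * p ^ 3\<close> in
        the bound of \<open>A^2\<close>. The factor 9 is 36 / 4.\<close>
      also have "1 / 2 * p ^ 3 * u x t * (A x)\<^sup>2 * (\<Sum>b\<in>Basis. K b) \<le> E x"
      proof -
        have "\<bar>A x\<bar> \<le> (k0 + k1) / (2 * p ^ 3)"
          using u_sandwich(2)[OF k0 t t t, of x] unfolding A_def pressure_gap_def p_def .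
        then have "(A x)\<^sup>2 \<le> ((k0 + k1) / (2 * p ^ 3))\<^sup>2" by (metis abs_ge_zero power2_abs power_mono)
        moreover have "u x t \<le> 2 * p ^ 3 / q" using trap(2)[OF t, of x] unfolding bb_def q_def p_def .
        ultimately have "1 / 2 * p ^ 3 * u x t * (A x)\<^sup>2 * (\<Sum>b\<in>Basis. K b)
          \<le> 1 / 2 * p ^ 3 * (2 * p ^ 3 / q) * ((k0 + k1) / (2 * p ^ 3))\<^sup>2 * (36 / R\<^sup>2)"
          using p up[of x] sumK q K0 by (intro mult_mono mult_nonneg_nonneg) (auto intro!: sum_nonneg)
        also have "\<dots> = 9 * (k0 + k1)\<^sup>2 / R\<^sup>2 * (1 / q)"
          using p q R by (simp add: power_divide power_mult_distrib power2_eq_square)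
        also have "\<dots> \<le> c / R\<^sup>2 * (1 / (k2 + p2\<^sup>2 * (norm x)\<^sup>2))"
        proof (rule mult_mono)
          have "(k0 + k1)\<^sup>2 * 9 \<le> c" unfolding c_def using k0 k1 by (intro mult_left_mono) auto
          then show "9 * (k0 + k1)\<^sup>2 / R\<^sup>2 \<le> c / R\<^sup>2" by (simp add: divide_right_mono)
          show "1 / q \<le> 1 / (k2 + p2\<^sup>2 * (norm x)\<^sup>2)"
            unfolding q_def using p p2 k by (intro divide_left_mono add_left_mono mult_right_mono power_mono mult_pos_pos pos_quad) auto
        qed (use c q in auto)
        finally show ?thesis unfolding E_def using True by simp
      qed
      finally show ?thesis by simp
    qed
    have cont: "continuous_on UNIV h" "continuous_on UNIV A" "\<And>b. b \<in> Basis \<Longrightarrow> continuous_on UNIV (Ab b)"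
    proof -
      show "continuous_on UNIV h" unfolding h_def[abs_def] by (rule continuous_entropy_density[OF k0 t])
      show "continuous_on UNIV A" unfolding A_def[abs_def] by (rule continuous_pressure_gap[OF k0 t])
      show "continuous_on UNIV (Ab b)" if "b \<in> Basis" for b
        unfolding Ab_def by (rule continuous_pressure_gap1[OF t that])
    qed
    have iQ: "integrable lborel Q" unfolding Q_def[abs_def]
      by (rule integrable_continuous_cball[where R=R];
          (intro continuous_intros continuous_on_cutoff sliceu t cont)?; simp add: cutoff_supp[OF R])
    have iW: "integrable lborel W" unfolding W_def[abs_def]
      by (rule integrable_continuous_cball[where R=R];
          (intro continuous_intros continuous_on_cutoff sliceu t cont)?; simp add: cutoff_supp[OF R])
    have iE: "integrable lborel E"
    proof -
      have "integrable lborel (\<lambda>x::real^3. indicator (cball 0 R) x *\<^sub>R (1 / (k2 + p2\<^sup>2 * (norm x)\<^sup>2)))"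
        by (intro borel_integrable_compact compact_cball continuous_intros ballI less_imp_neq[symmetric] pos_quad[OF k(1)]) simp
      then show ?thesis unfolding E_def[abs_def] by (intro integrable_mult_right) simp
    qed
    have "(LINT x|lborel. Q x) \<le> (LINT x|lborel. E x - 1 / 2 * p ^ 3 * W x)"
      by (intro integral_mono iQ Bochner_Integration.integrable_diff iE integrable_mult_right iW le)
    also have "\<dots> = (LINT x|lborel. E x) - 1 / 2 * p ^ 3 * (LINT x|lborel. W x)"
      using iE iW by simp
    also have "(LINT x|lborel. E x) \<le> c / R\<^sup>2 * (C * (R * sqrt R))"
      unfolding E_def integral_mult_right_zero using c by (intro mult_left_mono C(2)[OF R]) simp
    also have "\<dots> = c * C / sqrt R" by (rule cancel_sqrt[OF R])
    finally show "\<exists>D. (cutoff_entropy k0 R has_real_derivative D) (at t) \<and>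
      D \<le> c * C / sqrt R - 1 / 2 * (T - t) ^ 3 * (LINT x|lborel. cutoff R x * u x t * (\<Sum>b\<in>Basis. (pressure_gap1 b x t)\<^sup>2))"
      using D unfolding W_def p_def Ab_def by auto
  qed
qed

lemma cutoff_entropy_tendsto:
  assumes "k0 > 0" "t \<in> {0<..<T}"
  shows "(\<lambda>n. cutoff_entropy k0 (real (Suc n)) t) \<longlonglongrightarrow> entropy k0 t"
  unfolding cutoff_entropy_def entropy_def
  by (rule cutoff_integral_tendsto_lborel[OF integrable_entropy[OF assms]])

lemma entropy_nonneg:
  assumes "k0 > 0" "t \<in> {0<..<T}"
  shows "entropy k0 t \<ge> 0"
  unfolding entropy_def using entropy_density_bounds(1)[OF ratio_pos[OF assms]] assms(2)
  by (intro integral_nonneg_AE AE_I2) auto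

lemma dissipation_integral_nonneg:
  assumes "t \<in> {0<..<T}"
  shows "0 \<le> (LINT x|lborel. cutoff R x * u x t * (\<Sum>b\<in>Basis. (pressure_gap1 b x t)\<^sup>2))"
  using cutoff_range(1) upos[OF assms] by (intro integral_nonneg_AE AE_I2 mult_nonneg_nonneg sum_nonneg) (auto simp: less_imp_le)

text \<open>The cutoff entropies grow at a rate of at most \<open>C / sqrt R\<close>, which
  disappears as \<open>R\<close> tends to infinity.\<close>

lemma entropy_antimono:
  assumes k0: "k0 > 0" and st: "0 < s" "s \<le> t" "t < T"
  shows "entropy k0 t \<le> entropy k0 s"
proof (cases "s = t")
  case False
  have t: "t \<in> {0<..<T}" using st by simp
  obtain C where C: "C \<ge> 0" "\<And>R r. R > 0 \<Longrightarrow> 0 < r \<Longrightarrow> r \<le> t \<Longrightarrow>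
    \<exists>D. (cutoff_entropy k0 R has_real_derivative D) (at r) \<and>
      D \<le> C / sqrt R - 1 / 2 * (T - r) ^ 3 * (LINT x|lborel. cutoff R x * u x r * (\<Sum>b\<in>Basis. (pressure_gap1 b x r)\<^sup>2))"
    by (rule cutoff_entropy_dissipation[OF k0 t]) blast
  have bd: "cutoff_entropy k0 R t - cutoff_entropy k0 R s \<le> (T * C) / sqrt R" if R: "R > 0" for R
  proof -
    define G where "G r = C / sqrt R * r - cutoff_entropy k0 R r" for r
    have "G s \<le> G t"
    proof (rule DERIV_nonneg_imp_nondecreasing[where f=G, OF st(2)])
      fix r assume r: "s \<le> r" "r \<le> t"
      obtain D where D: "(cutoff_entropy k0 R has_real_derivative D) (at r)"
        "D \<le> C / sqrt R - 1 / 2 * (T - r) ^ 3 * (LINT x|lborel. cutoff R x * u x r * (\<Sum>b\<in>Basis. (pressure_gap1 b x r)\<^sup>2))"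
        using C(2)[OF R, of r] r st by auto
      have "0 \<le> 1 / 2 * (T - r) ^ 3 * (LINT x|lborel. cutoff R x * u x r * (\<Sum>b\<in>Basis. (pressure_gap1 b x r)\<^sup>2))"
        using r st by (intro mult_nonneg_nonneg dissipation_integral_nonneg) auto
      then have "0 \<le> C / sqrt R - D" using D(2) by linarith
      moreover have "(G has_real_derivative C / sqrt R - D) (at r)"
        unfolding G_def by (intro DERIV_diff DERIV_cmult_Id D(1))
      ultimately show "\<exists>y. (G has_real_derivative y) (at r) \<and> 0 \<le> y" by blast
    qed
    then have "cutoff_entropy k0 R t - cutoff_entropy k0 R s \<le> C / sqrt R * (t - s)" unfolding G_def by (simp add: algebra_simps diff_divide_distrib)
    also have "\<dots> \<le> C / sqrt R * T" using C(1) R st by (intro mult_left_mono) auto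
    finally show ?thesis by (simp add: mult.commute)
  qed
  have "entropy k0 t - entropy k0 s \<le> 0"
    by (rule LIMSEQ_le[OF tendsto_diff[OF cutoff_entropy_tendsto cutoff_entropy_tendsto] tendsto_const_over_sqrt[of "T * C"]])
       (use bd k0 st in auto)
  then show ?thesis by simp
qed auto

text \<open>The power 7 makes this the integral over \<open>cball 0 \<rho>\<close> of the squared gradient of the rescaled gap
  \<open>p\<^sup>3 * A (x / p)\<close>, where \<open>p = T - t\<close>.\<close>

definition local_dissipation :: "real \<Rightarrow> real \<Rightarrow> real" where
  "local_dissipation \<rho> t = (T - t) ^ 7 *
     (LINT x|lborel. indicator (cball 0 (\<rho> / (T - t))) x * (\<Sum>b\<in>Basis. (pressure_gap1 b x t)\<^sup>2))"

text \<open>Otherwise the entropy would fall at a rate of at least \<open>\<eta> / (T - t)\<close>.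
  This is not integrable up to \<open>T\<close>, whereas the entropy is nonnegative and
  bounded.\<close>

lemma small_dissipation:
  fixes k0 \<delta> \<rho> t1 :: real
  assumes k0: "k0 > 0" and \<delta>: "\<delta> > 0" and \<rho>: "\<rho> > 0" and t1: "t1 \<in> {0<..<T}"
  obtains (small) t where "t1 \<le> t" "t < T" "local_dissipation \<rho> t < \<delta>"
proof (rule ccontr)
  assume "\<not> thesis"
  then have big: "local_dissipation \<rho> t \<ge> \<delta>" if "t1 \<le> t" "t < T" for t
    using small[OF that] by linarith
  \<comment> \<open>On the ball of radius \<open>\<rho> / p\<close> the cutoff is at least 1/2 and
    \<open>u\<close> at least \<open>2 * p ^ 3 / (k1 + \<rho>^2)\<close>. With the half of the
    dissipation that is left, and \<open>p ^ 7\<close> in \<open>local_dissipation\<close>, this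
    gives the rate \<open>\<eta> / p\<close>.\<close>
  define \<eta> where "\<eta> = \<delta> / (2 * (k1 + \<rho>\<^sup>2))"
  have kr: "k1 + \<rho>\<^sup>2 > 0" using k1 by (simp add: add_pos_nonneg)
  have \<eta>: "\<eta> > 0" unfolding \<eta>_def using \<delta> kr by simp
  have main: "entropy k0 t2 - entropy k0 t1 + \<eta> * ln ((T - t1) / (T - t2)) \<le> 0" if t2: "t1 < t2" "t2 < T" for t2
  proof -
    have t2': "t2 \<in> {0<..<T}" using t1 t2 by simp
    obtain C where C: "C \<ge> 0" "\<And>R r. R > 0 \<Longrightarrow> 0 < r \<Longrightarrow> r \<le> t2 \<Longrightarrow>
      \<exists>D. (cutoff_entropy k0 R has_real_derivative D) (at r) \<and>
        D \<le> C / sqrt R - 1 / 2 * (T - r) ^ 3 * (LINT x|lborel. cutoff R x * u x r * (\<Sum>b\<in>Basis. (pressure_gap1 b x r)\<^sup>2))"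
      by (rule cutoff_entropy_dissipation[OF k0 t2']) blast
    have bd: "cutoff_entropy k0 R t2 - cutoff_entropy k0 R t1 + \<eta> * ln ((T - t1) / (T - t2)) \<le> (T * C) / sqrt R"
      if R: "R > 0" "3 * \<rho> / (T - t2) \<le> R" for R
    proof -
      \<comment> \<open>As \<open>- ln (T - r)\<close> has derivative \<open>1 / (T - r)\<close>,
        monotonicity of \<open>G\<close> says that the cutoff entropy falls at least at the rate
        \<open>\<eta> / (T - r)\<close>, up to \<open>C / sqrt R\<close>.\<close>
      define G where "G r = C / sqrt R * r - (cutoff_entropy k0 R r - \<eta> * ln (T - r))" for r
      have "G t1 \<le> G t2"
      proof (rule DERIV_nonneg_imp_nondecreasing[where f=G, OF less_imp_le[OF t2(1)]])
        fix r assume r: "t1 \<le> r" "r \<le> t2"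
        define p where "p = T - r"
        have p: "p > 0" "T - t2 \<le> p" using r t2 unfolding p_def by auto
        have rT: "r \<in> {0<..<T}" using r t1 t2 by simp
        obtain D where D: "(cutoff_entropy k0 R has_real_derivative D) (at r)"
          "D \<le> C / sqrt R - 1 / 2 * (T - r) ^ 3 * (LINT x|lborel. cutoff R x * u x r * (\<Sum>b\<in>Basis. (pressure_gap1 b x r)\<^sup>2))"
          using C(2)[OF R(1), of r] r t1 by auto
        define S where "S x = (\<Sum>b\<in>Basis. (pressure_gap1 b x r)\<^sup>2)" for x
        have cS: "continuous_on UNIV S"
          unfolding S_def[abs_def] by (intro continuous_intros continuous_pressure_gap1 rT)
        have S0: "S x \<ge> 0" for x unfolding S_def by (intro sum_nonneg) auto
        define I where "I = (LINT x|lborel. indicator (cball 0 (\<rho> / p)) x * S x)"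
        have "\<delta> \<le> p ^ 7 * I" using big[of r] r t2 unfolding local_dissipation_def I_def S_def p_def by simp
        moreover have "p ^ 3 / (k1 + \<rho>\<^sup>2) * I \<le> (LINT x|lborel. cutoff R x * u x r * S x)"
          unfolding I_def integral_mult_right_zero[symmetric]
        proof (rule integral_mono)
          have "integrable lborel (\<lambda>x. indicator (cball 0 (\<rho> / p)) x *\<^sub>R S x)"
            using continuous_on_subset[OF cS] by (intro borel_integrable_compact compact_cball) auto
          then show "integrable lborel (\<lambda>x. p ^ 3 / (k1 + \<rho>\<^sup>2) * (indicator (cball 0 (\<rho> / p)) x * S x))"
            by (intro integrable_mult_right) simp
          show "integrable lborel (\<lambda>x. cutoff R x * u x r * S x)"
            by (rule integrable_continuous_cball[where R=R];
                (intro continuous_intros continuous_on_cutoff sliceu rT cS)?; simp add: cutoff_supp[OF R(1)])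
          fix x
          show "p ^ 3 / (k1 + \<rho>\<^sup>2) * (indicator (cball 0 (\<rho> / p)) x * S x) \<le> cutoff R x * u x r * S x"
          proof (cases "norm x \<le> \<rho> / p")
            case True
            have px: "p * norm x \<le> \<rho>" using True p by (simp add: field_simps)
            have "3 * \<rho> / p \<le> 3 * \<rho> / (T - t2)" using p t2 \<rho> by (intro divide_left_mono) auto
            then have "3 * norm x \<le> R" using True R(2) by simp
            from cutoff_ge_half[OF R(1) this] have c: "1 / 2 \<le> cutoff R x" .
            have "(p * norm x)\<^sup>2 \<le> \<rho>\<^sup>2" using px p by (intro power_mono) auto
            then have "p\<^sup>2 * (norm x)\<^sup>2 \<le> \<rho>\<^sup>2" by (simp add: power_mult_distrib)
            then have "2 * p ^ 3 / (k1 + \<rho>\<^sup>2) \<le> bb k1 p x"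
              unfolding bb_def using p k1 by (intro divide_left_mono mult_pos_pos kr pos_quad) auto
            then have u: "2 * p ^ 3 / (k1 + \<rho>\<^sup>2) \<le> u x r" using trap(1)[OF rT, of x] unfolding p_def by linarith
            have "1 / 2 * (2 * p ^ 3 / (k1 + \<rho>\<^sup>2)) \<le> cutoff R x * u x r"
              using c u p kr cutoff_range(1)[of R x] by (intro mult_mono) auto
            then have "p ^ 3 / (k1 + \<rho>\<^sup>2) * S x \<le> cutoff R x * u x r * S x"
              by (intro mult_right_mono S0) simp
            then show ?thesis using True by simp
          next
            case False
            then show ?thesis using S0[of x] upos[OF rT, of x] cutoff_range(1)[of R x] by simp
          qed
        qed
        moreover have "p ^ 3 / (k1 + \<rho>\<^sup>2) * (\<delta> / p ^ 7) \<le> p ^ 3 / (k1 + \<rho>\<^sup>2) * I" if "\<delta> \<le> p ^ 7 * I"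
          using p kr that by (intro mult_left_mono) (auto simp: pos_divide_le_eq mult.commute)
        ultimately have "p ^ 3 / (k1 + \<rho>\<^sup>2) * (\<delta> / p ^ 7) \<le> (LINT x|lborel. cutoff R x * u x r * S x)"
          by (meson order_trans)
        then have "1 / 2 * p ^ 3 * (p ^ 3 / (k1 + \<rho>\<^sup>2) * (\<delta> / p ^ 7)) \<le> 1 / 2 * p ^ 3 * (LINT x|lborel. cutoff R x * u x r * S x)"
          using p by (intro mult_left_mono) auto
        moreover have "1 / 2 * p ^ 3 * (p ^ 3 / (k1 + \<rho>\<^sup>2) * (\<delta> / p ^ 7)) = \<eta> / p"
        proof -
          have "p ^ 7 = p ^ 3 * p ^ 3 * p" by (simp flip: power_add power_Suc2)
          then show ?thesis unfolding \<eta>_def using p by simp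
        qed
        ultimately have "D \<le> C / sqrt R - \<eta> / p" using D(2) unfolding S_def p_def by linarith
        moreover have "(G has_real_derivative C / sqrt R - (D - \<eta> * (- 1 / (T - r)))) (at r)"
        proof -
          have "((\<lambda>r. ln (T - r)) has_real_derivative - 1 / (T - r)) (at r)"
            using p by (auto intro!: derivative_eq_intros simp: p_def)
          then show ?thesis unfolding G_def by (intro DERIV_diff DERIV_cmult_Id D(1) DERIV_cmult)
        qed
        ultimately show "\<exists>y. (G has_real_derivative y) (at r) \<and> 0 \<le> y" unfolding p_def by force
      qed
      then have "cutoff_entropy k0 R t2 - cutoff_entropy k0 R t1 + \<eta> * (ln (T - t1) - ln (T - t2)) \<le> C / sqrt R * (t2 - t1)"
        unfolding G_def by (simp add: algebra_simps diff_divide_distrib)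
      also have "\<dots> \<le> C / sqrt R * T" using C(1) R t2 t1 by (intro mult_left_mono) auto
      finally show ?thesis using t2 t1 by (simp add: mult.commute ln_div)
    qed
    show ?thesis
    proof (rule LIMSEQ_le[OF _ tendsto_const_over_sqrt[of "T * C"]])
      show "(\<lambda>n. cutoff_entropy k0 (real (Suc n)) t2 - cutoff_entropy k0 (real (Suc n)) t1 + \<eta> * ln ((T - t1) / (T - t2)))
        \<longlonglongrightarrow> entropy k0 t2 - entropy k0 t1 + \<eta> * ln ((T - t1) / (T - t2))"
        by (intro tendsto_intros cutoff_entropy_tendsto k0 t1 t2')
      obtain N where N: "3 * \<rho> / (T - t2) \<le> real N" using real_arch_simple by blast
      show "\<exists>N. \<forall>n\<ge>N. cutoff_entropy k0 (real (Suc n)) t2 - cutoff_entropy k0 (real (Suc n)) t1 + \<eta> * ln ((T - t1) / (T - t2)) \<le> T * C / sqrt (real (Suc n))"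
      proof (intro exI[of _ N] allI impI bd)
        fix n assume "N \<le> n"
        then have "real N \<le> real (Suc n)" by simp
        then show "3 * \<rho> / (T - t2) \<le> real (Suc n)" using N by linarith
      qed simp
    qed
  qed
  obtain E0 where E0: "\<And>t. t \<in> {0<..<T} \<Longrightarrow> entropy k0 t \<le> E0" by (rule entropy_bounded[OF k0]) blast
  have E00: "E0 \<ge> 0" using E0[OF t1] entropy_nonneg[OF k0 t1] by linarith
  \<comment> \<open>The time at which the logarithm equals \<open>E0 / \<eta> + 1\<close>, so that
    the drop \<open>E0 + \<eta>\<close> exceeds the whole entropy available.\<close>
  define t2 where "t2 = T - (T - t1) * exp (- (E0 / \<eta> + 1))"
  have "0 \<le> E0 / \<eta>" using E00 \<eta> by simp
  then have "exp (- (E0 / \<eta> + 1)) < 1" by simp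
  then have "(T - t1) * exp (- (E0 / \<eta> + 1)) < (T - t1) * 1" using t1 by (intro mult_strict_left_mono) auto
  moreover have "0 < (T - t1) * exp (- (E0 / \<eta> + 1))" using t1 by simp
  moreover have "t1 < T - w \<and> T - w < T" if "w < (T - t1) * 1" "0 < w" for w using that by simp
  ultimately have "t1 < t2 \<and> t2 < T" unfolding t2_def by blast
  then have t2: "t1 < t2" "t2 < T" by auto
  have "(T - t1) / (T - t2) = exp (E0 / \<eta> + 1)"
  proof -
    have "(T - t1) / (T - t2) = 1 / exp (- (E0 / \<eta> + 1))" using t1 unfolding t2_def by simp
    also have "\<dots> = exp (E0 / \<eta> + 1)" unfolding exp_minus[of "E0 / \<eta> + 1"] by (simp add: divide_inverse)
    finally show ?thesis .
  qed
  then have "\<eta> * ln ((T - t1) / (T - t2)) = E0 + \<eta>" using \<eta> by (simp add: distrib_left)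
  then have "entropy k0 t2 - entropy k0 t1 + (E0 + \<eta>) \<le> 0" using main[OF t2] by simp
  moreover have "entropy k0 t1 \<le> E0" "entropy k0 t2 \<ge> 0"
    using E0[OF t1] entropy_nonneg[OF k0, of t2] t1 t2 by auto
  ultimately show False using \<eta> by linarith
qed

end

section \<open>Convergence in the mean\<close>

lemma bb_scale: "p > 0 \<Longrightarrow> bb k p ((1 / p) *\<^sub>R x) = p ^ 3 * bb k 1 x"
  unfolding bb_def by (simp add: power_mult_distrib power_divide)

lemma bb_product_decay:
  assumes "k > 0" "k' > 0"
  obtains c0 C0 where "c0 > 0" "C0 > 0" "\<And>x::real^3. c0 * decay4 x \<le> bb k 1 x * bb k' 1 x"
    "\<And>x::real^3. bb k 1 x * bb k' 1 x \<le> C0 * decay4 x"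
proof -
  have b: "bb k 1 x = 2 * (1 / (k + 1 * (norm x)\<^sup>2))" for k and x :: "real^3" unfolding bb_def by simp
  have d: "decay4 x = (1 / (1 + (norm x)\<^sup>2)) * (1 / (1 + (norm x)\<^sup>2))" for x unfolding decay4_def by (simp add: power2_eq_square)
  have q: "(0::real) < 1 + (norm x)\<^sup>2" for x :: "real^3" by (simp add: add_pos_nonneg)
  show ?thesis
  proof (rule that)
    show "4 / (max 1 k * max 1 k') > 0" "4 * (1 / min k 1 * (1 / min k' 1)) > 0" using assms by (auto intro!: mult_pos_pos divide_pos_pos)
    fix x :: "real^3"
    have lo: "1 / max 1 k * (1 / (1 + (norm x)\<^sup>2)) \<le> 1 / (k + 1 * (norm x)\<^sup>2)" if "k > 0" for k
    proof -
      have "k + 1 * (norm x)\<^sup>2 \<le> max 1 k * 1 + max 1 k * (norm x)\<^sup>2"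
        by (intro add_mono mult_right_mono) auto
      then have "k + 1 * (norm x)\<^sup>2 \<le> max 1 k * (1 + (norm x)\<^sup>2)" by (simp add: distrib_left)
      then have "1 / (max 1 k * (1 + (norm x)\<^sup>2)) \<le> 1 / (k + 1 * (norm x)\<^sup>2)"
        using that q[of x] pos_quad[OF that, of 1 x] by (intro divide_left_mono mult_pos_pos) auto
      then show ?thesis by simp
    qed
    have "(1 / max 1 k * (1 / (1 + (norm x)\<^sup>2))) * (1 / max 1 k' * (1 / (1 + (norm x)\<^sup>2))) \<le> (1 / (k + 1 * (norm x)\<^sup>2)) * (1 / (k' + 1 * (norm x)\<^sup>2))"
      using q[of x] assms pos_quad[OF assms(1), of 1 x] by (intro mult_mono lo) auto
    then show "4 / (max 1 k * max 1 k') * decay4 x \<le> bb k 1 x * bb k' 1 x" unfolding b d by (simp add: mult_ac)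
    have "(1 / (k + 1 * (norm x)\<^sup>2)) * (1 / (k' + 1 * (norm x)\<^sup>2)) \<le> (1 / min k 1 * (1 / (1 + (norm x)\<^sup>2))) * (1 / min k' 1 * (1 / (1 + (norm x)\<^sup>2)))"
      using assms q[of x] pos_quad[OF assms(2), of 1 x] by (intro mult_mono inverse_quadratic_le) auto
    then show "bb k 1 x * bb k' 1 x \<le> 4 * (1 / min k 1 * (1 / min k' 1)) * decay4 x" unfolding b d by (simp add: mult_ac)
  qed
qed

context trapped_solution
begin

text \<open>The rescaling preserves mass: this is also the \<open>L1\<close> distance of the
  rescaled functions, without any power of \<open>T - t\<close>.\<close>

definition L1_gap :: "real \<Rightarrow> real \<Rightarrow> real" where
  "L1_gap k0 t = (LINT x|lborel. \<bar>u x t - bb k0 (T - t) x\<bar>)"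

lemma rescale_integral:
  fixes F :: "real^3 \<Rightarrow> real"
  assumes "p > 0" "F \<in> borel_measurable borel"
  shows "(LINT x|lborel. F ((1 / p) *\<^sub>R x) / p ^ 3) = (LINT x|lborel. F x)"
  using lborel_integral_affine[OF assms(2), of "1 / p" 0] assms(1) by (simp add: power_divide)

text \<open>The Poincare inequality is applied to the rescaled gap \<open>a\<close> and the weight
  \<open>\<omega> = v * B\<close>. Their product is \<open>v - B\<close>, so conservation of mass is
  the condition of zero mean, and \<open>\<rho>\<close> and \<open>\<delta>\<close> do not depend on
  \<open>t\<close>.\<close>

lemma small_dissipation_small_gap:
  assumes k0: "k0 > 0" and \<epsilon>: "\<epsilon> > 0"
    and mass: "\<And>t. t \<in> {0<..<T} \<Longrightarrow> (LINT x|lborel. u x t - bb k0 (T - t) x) = 0"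
  obtains \<rho> \<delta> where "\<rho> > 0" "\<delta> > 0" "\<And>t. t \<in> {0<..<T} \<Longrightarrow> local_dissipation \<rho> t < \<delta> \<Longrightarrow> L1_gap k0 t \<le> \<epsilon>"
proof -
  \<comment> \<open>The weight lies between \<open>bb k1 1 x * bb k0 1 x\<close> and
    \<open>bb k2 1 x * bb k0 1 x\<close>: the lower constant comes from \<open>k1\<close>, the upper
    one from \<open>k2\<close>.\<close>
  obtain c1 C1 where c1: "c1 > 0" "C1 > 0" "\<And>x::real^3. c1 * decay4 x \<le> bb k1 1 x * bb k0 1 x"
    "\<And>x::real^3. bb k1 1 x * bb k0 1 x \<le> C1 * decay4 x"
    using bb_product_decay[OF k1 k0] by blast
  obtain c2 C2 where c2: "c2 > 0" "C2 > 0" "\<And>x::real^3. c2 * decay4 x \<le> bb k2 1 x * bb k0 1 x"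
    "\<And>x::real^3. bb k2 1 x * bb k0 1 x \<le> C2 * decay4 x"
    using bb_product_decay[OF k(1) k0] by blast
  have M: "(k0 + k1) / 2 > 0" using k0 k1 by simp
  obtain \<rho> \<delta> where \<rho>: "\<rho> > 0" "\<delta> > 0"
    and poin: "\<And>a G \<omega>. (\<And>b. b \<in> Basis \<Longrightarrow> has_dd a b (G b)) \<Longrightarrow> continuous_on UNIV a \<Longrightarrow>
       (\<And>b. b \<in> Basis \<Longrightarrow> continuous_on UNIV (G b)) \<Longrightarrow> (\<And>x. \<bar>a x\<bar> \<le> (k0 + k1) / 2) \<Longrightarrow>
       continuous_on UNIV \<omega> \<Longrightarrow> (\<And>x. c1 * decay4 x \<le> \<omega> x) \<Longrightarrow> (\<And>x. \<omega> x \<le> C2 * decay4 x) \<Longrightarrow>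
       (LINT x|lborel. a x * \<omega> x) = 0 \<Longrightarrow>
       (LINT x|lborel. indicator (cball 0 \<rho>) x * (\<Sum>b\<in>Basis. (G b x)\<^sup>2)) < \<delta> \<Longrightarrow>
       (LINT x::real^3|lborel. \<bar>a x\<bar> * \<omega> x) \<le> \<epsilon>"
    by (rule weighted_poincare[OF M c1(1) c2(2) \<epsilon>]) blast
  show ?thesis
  proof (rule that[OF \<rho>])
    fix t assume t: "t \<in> {0<..<T}" and small: "local_dissipation \<rho> t < \<delta>"
    define p where "p = T - t"
    have p: "p > 0" using t unfolding p_def by simp
    let ?y = "\<lambda>x::real^3. (1 / p) *\<^sub>R x"
    have up: "u x t > 0" for x using upos[OF t] .
    define a where "a x = p ^ 3 * pressure_gap k0 (?y x) t" for x
    define G where "G b x = p ^ 2 * pressure_gap1 b (?y x) t" for b x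
    define \<omega> where "\<omega> x = u (?y x) t / p ^ 3 * bb k0 1 x" for x
    have cy: "continuous_on UNIV (\<lambda>x. F (?y x))" if "continuous_on UNIV F" for F :: "real^3 \<Rightarrow> real"
      by (rule continuous_on_compose2[OF that]) (auto intro!: continuous_intros)
    have cuB: "continuous_on UNIV (\<lambda>x. u x t - bb k0 p x)"
      by (intro continuous_intros sliceu t continuous_on_bb k0)
    have diff: "u x t - bb k0 p x = pressure_gap k0 x t * u x t * bb k0 p x" for x
      using up[of x] bb_pos[OF k0 p, of x] unfolding pressure_gap_def p_def[symmetric] by (simp add: field_simps)
    have a\<omega>: "a x * \<omega> x = (u (?y x) t - bb k0 p (?y x)) / p ^ 3" for x
      unfolding diff a_def \<omega>_def using p by (simp add: bb_scale)
    have vb: "bb k1 1 x \<le> u (?y x) t / p ^ 3" "u (?y x) t / p ^ 3 \<le> bb k2 1 x" for x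
      using trap[OF t, of "?y x"] p unfolding p_def[symmetric] bb_scale[OF p] by (simp_all add: field_simps)
    have "(LINT x|lborel. \<bar>a x\<bar> * \<omega> x) \<le> \<epsilon>"
    proof (rule poin)
      show "has_dd a b (G b)" if "b \<in> Basis" for b
      proof -
        have "has_dd (\<lambda>x. p ^ 3 * pressure_gap k0 (?y x) t) b (\<lambda>x. 0 * pressure_gap k0 (?y x) t + 1 / p * pressure_gap1 b (?y x) t * p ^ 3)"
          by (intro has_dd_mult has_dd_const has_dd_scale[OF has_dd_pressure_gap[OF k0 t that]])
        moreover have "0 * c + 1 / p * d * p ^ 3 = p\<^sup>2 * d" for c d :: real
          using p by (simp add: power2_eq_square power3_eq_cube)
        ultimately show ?thesis unfolding a_def[abs_def] G_def[abs_def] by (simp only:)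
      qed
      show "continuous_on UNIV a" unfolding a_def[abs_def] by (intro continuous_intros cy continuous_pressure_gap k0 t)
      show "continuous_on UNIV (G b)" if "b \<in> Basis" for b
        unfolding G_def by (intro continuous_intros cy continuous_pressure_gap1 t that)
      show "\<bar>a x\<bar> \<le> (k0 + k1) / 2" for x
      proof -
        have "p ^ 3 * \<bar>pressure_gap k0 (?y x) t\<bar> \<le> p ^ 3 * ((k0 + k1) / (2 * p ^ 3))"
          using u_sandwich(2)[OF k0 t t t, of "?y x"] p unfolding pressure_gap_def p_def[symmetric] by (intro mult_left_mono) auto
        then show ?thesis unfolding a_def using p by (simp add: abs_mult)
      qed
      show "continuous_on UNIV \<omega>" unfolding \<omega>_def[abs_def] using p
        by (intro continuous_intros cy sliceu t continuous_on_bb k0) auto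
      show "c1 * decay4 x \<le> \<omega> x" for x
        using c1(3)[of x] mult_right_mono[OF vb(1)[of x] less_imp_le[OF bb_pos[OF k0, of 1 x]]] unfolding \<omega>_def by simp
      show "\<omega> x \<le> C2 * decay4 x" for x
        using c2(4)[of x] mult_right_mono[OF vb(2)[of x] less_imp_le[OF bb_pos[OF k0, of 1 x]]] unfolding \<omega>_def by simp
      show "(LINT x|lborel. a x * \<omega> x) = 0"
        unfolding a\<omega> using rescale_integral[OF p borel_of_continuous[OF cuB]] mass[OF t] unfolding p_def[symmetric] by simp
      show "(LINT x|lborel. indicator (cball 0 \<rho>) x * (\<Sum>b\<in>Basis. (G b x)\<^sup>2)) < \<delta>"
      proof -
        define F where "F x = indicator (cball 0 (\<rho> / p)) x * (\<Sum>b\<in>Basis. (pressure_gap1 b x t)\<^sup>2)" for x :: "real^3"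
        have "continuous_on UNIV (\<lambda>x. \<Sum>b\<in>Basis. (pressure_gap1 b x t)\<^sup>2)" by (intro continuous_intros continuous_pressure_gap1 t)
        then have F: "F \<in> borel_measurable borel"
          unfolding F_def[abs_def] by (intro borel_measurable_times borel_measurable_indicator borel_of_continuous) auto
        have ind: "indicator (cball 0 \<rho>) x = (indicator (cball 0 (\<rho> / p)) (?y x) :: real)" for x :: "real^3"
          using p by (auto simp: indicator_def field_simps)
        have "indicator (cball 0 \<rho>) x * (\<Sum>b\<in>Basis. (G b x)\<^sup>2) = p ^ 7 * (F (?y x) / p ^ 3)" for x
        proof -
          have "p ^ 7 / p ^ 3 = (p\<^sup>2)\<^sup>2" using p by (simp add: field_simps flip: power_mult power_add)
          then have key: "p ^ 7 * (c / p ^ 3) = (p\<^sup>2)\<^sup>2 * c" for c by (metis times_divide_eq_left times_divide_eq_right)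
          show ?thesis unfolding ind F_def G_def power_mult_distrib sum_distrib_left[symmetric]
            by (subst key) (rule mult.left_commute)
        qed
        then have "(LINT x|lborel. indicator (cball 0 \<rho>) x * (\<Sum>b\<in>Basis. (G b x)\<^sup>2)) = p ^ 7 * (LINT x|lborel. F (?y x) / p ^ 3)"
          by (simp only: integral_mult_right_zero)
        also have "\<dots> = p ^ 7 * (LINT x|lborel. F x)" by (simp only: rescale_integral[OF p F])
        also have "\<dots> = local_dissipation \<rho> t" unfolding local_dissipation_def F_def p_def ..
        finally show ?thesis using small by simp
      qed
    qed
    also have "(LINT x|lborel. \<bar>a x\<bar> * \<omega> x) = L1_gap k0 t"
    proof -
      have "\<omega> x > 0" for x unfolding \<omega>_def using up p bb_pos[OF k0, of 1 x] by simp
      then have "\<bar>a x\<bar> * \<omega> x = \<bar>a x * \<omega> x\<bar>" for x by (simp add: abs_mult less_imp_le)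
      then have "\<bar>a x\<bar> * \<omega> x = \<bar>u (?y x) t - bb k0 p (?y x)\<bar> / p ^ 3" for x
        unfolding a\<omega> using p by (simp add: abs_divide)
      moreover have "(\<lambda>x. \<bar>u x t - bb k0 p x\<bar>) \<in> borel_measurable borel"
        by (intro borel_of_continuous continuous_intros sliceu t continuous_on_bb k0)
      ultimately show ?thesis unfolding L1_gap_def p_def[symmetric] by (simp only: rescale_integral[OF p, of "\<lambda>x. \<bar>u x t - bb k0 p x\<bar>"])
    qed
    finally show "L1_gap k0 t \<le> \<epsilon>" .
  qed
qed

text \<open>With \<open>y = u / B\<close>, \<open>(y - 1)^2\<close> is
  \<open>\<bar>A\<bar> * (u / B) * \<bar>u - B\<bar>\<close>; the trap bounds \<open>u / B\<close>
  and gives \<open>A\<close> the size of \<open>1 / p ^ 3\<close>, which the Jacobian compensates.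
  So the entropy, quadratic near \<open>y = 1\<close>, is at most linear in the gap.\<close>

lemma entropy_le_gap:
  assumes k0: "k0 > 0"
  obtains C where "C > 0" "\<And>t. t \<in> {0<..<T} \<Longrightarrow> entropy k0 t \<le> C * L1_gap k0 t"
proof
  show "(1 + k1 / k0) * ((k0 + k1) / 2 * (1 + k0 / k2)) > 0"
    using k0 k1 k by (intro mult_pos_pos add_pos_pos divide_pos_pos) auto
  fix t assume t: "t \<in> {0<..<T}"
  have p: "T - t > 0" using t by simp
  show "entropy k0 t \<le> (1 + k1 / k0) * ((k0 + k1) / 2 * (1 + k0 / k2)) * L1_gap k0 t"
    unfolding entropy_def L1_gap_def integral_mult_right_zero[symmetric]
  proof (rule integral_mono[OF integrable_entropy[OF k0 t]])
    show "integrable lborel (\<lambda>x. (1 + k1 / k0) * ((k0 + k1) / 2 * (1 + k0 / k2)) * \<bar>u x t - bb k0 (T - t) x\<bar>)"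
      by (intro integrable_mult_right integrable_abs integrable_u_minus_bb k0 t)
    fix x :: "real^3"
    define p where "p = T - t"
    define B where "B = bb k0 p x"
    define A where "A = pressure_gap k0 x t"
    have p: "p > 0" using t unfolding p_def by simp
    have B: "B > 0" unfolding B_def by (rule bb_pos[OF k0 p])
    have A: "\<bar>A\<bar> \<le> (k0 + k1) / (2 * p ^ 3)"
      using u_sandwich(2)[OF k0 t t t, of x] unfolding A_def pressure_gap_def p_def .
    have yA: "u x t / B - 1 = A * u x t"
      using ratio_minus_one[OF k0 t, of x] unfolding B_def A_def p_def .
    have "(u x t / B - 1)\<^sup>2 = \<bar>u x t / B - 1\<bar> * \<bar>u x t / B - 1\<bar>" by (simp add: power2_eq_square)
    also have "\<dots> = \<bar>A\<bar> * u x t * \<bar>u x t / B - 1\<bar>" using upos[OF t, of x] by (simp add: yA abs_mult)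
    also have "\<bar>u x t / B - 1\<bar> = \<bar>u x t - B\<bar> / B"
    proof -
      have "u x t / B - 1 = (u x t - B) / B" using B by (simp add: diff_divide_distrib)
      then show ?thesis using B by (simp add: abs_divide)
    qed
    also have "\<bar>A\<bar> * u x t * (\<bar>u x t - B\<bar> / B) = \<bar>A\<bar> * (u x t / B) * \<bar>u x t - B\<bar>" by simp
    also have "\<dots> \<le> (k0 + k1) / (2 * p ^ 3) * (1 + k0 / k2) * \<bar>u x t - B\<bar>"
      using A u_sandwich(6)[OF k0 t t t, of x] B upos[OF t, of x] unfolding B_def p_def[symmetric]
      by (intro mult_right_mono mult_mono) auto
    finally have sq: "p ^ 3 * (u x t / B - 1)\<^sup>2 \<le> p ^ 3 * ((k0 + k1) / (2 * p ^ 3) * (1 + k0 / k2) * \<bar>u x t - B\<bar>)"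
      using p by (intro mult_left_mono) auto
    have "p ^ 3 * entropy_density (u x t / B) \<le> p ^ 3 * ((1 + k1 / k0) * (u x t / B - 1)\<^sup>2)"
      using entropy_density_le[OF k0 t, of x] p unfolding B_def p_def[symmetric] by (intro mult_left_mono) auto
    also have "\<dots> = (1 + k1 / k0) * (p ^ 3 * (u x t / B - 1)\<^sup>2)" by simp
    also have "\<dots> \<le> (1 + k1 / k0) * (p ^ 3 * ((k0 + k1) / (2 * p ^ 3) * (1 + k0 / k2) * \<bar>u x t - B\<bar>))"
      by (rule mult_left_mono[OF sq]) (use k0 k1 in simp)
    also have "\<dots> = (1 + k1 / k0) * ((k0 + k1) / 2 * (1 + k0 / k2)) * \<bar>u x t - B\<bar>"
      using p by simp
    finally show "(T - t) ^ 3 * entropy_density (u x t / bb k0 (T - t) x)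
      \<le> (1 + k1 / k0) * ((k0 + k1) / 2 * (1 + k0 / k2)) * \<bar>u x t - bb k0 (T - t) x\<bar>"
      unfolding p_def B_def .
  qed
qed

text \<open>The Cauchy-Schwarz inequality in Young's form, with a free parameter. In
  \<open>\<bar>u - B\<bar> = \<bar>y - 1\<bar> * B\<close> the square of \<open>y - 1\<close> is
  controlled by the entropy, and the integral of \<open>B^2 / p ^ 3\<close> is, by scaling, the same
  at all times.\<close>

lemma gap_le_entropy:
  assumes k0: "k0 > 0"
  obtains C J where "C > 0" "J > 0" "\<And>t \<eta>. t \<in> {0<..<T} \<Longrightarrow> \<eta> > 0 \<Longrightarrow> L1_gap k0 t \<le> C / \<eta> * entropy k0 t + \<eta> * J"
proof -
  define C where "C = (sqrt (1 + k0 / k2) + 1)\<^sup>2"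
  have "1 + k0 / k2 > 0" using k0 k by (simp add: add_pos_pos)
  then have C: "C > 0" unfolding C_def by (intro zero_less_power add_nonneg_pos) auto
  define J where "J = (LINT x::real^3|lborel. (bb k0 1 x)\<^sup>2)"
  have ibb: "integrable lborel (\<lambda>x::real^3. (bb k0 p x)\<^sup>2 / p ^ 3)" if "p > 0" for p
  proof -
    have "(bb k0 p x)\<^sup>2 / p ^ 3 = (2 * p ^ 3)\<^sup>2 / p ^ 3 * (1 / (k0 + p\<^sup>2 * (norm x)\<^sup>2)\<^sup>2)" for x :: "real^3"
      unfolding bb_def by (simp add: power_divide)
    then show ?thesis using that k0 by (simp only:) (intro integrable_mult_right integrable_inverse_quartic_scaled, auto)
  qed
  have Jp: "(LINT x::real^3|lborel. (bb k0 p x)\<^sup>2 / p ^ 3) = J" if p: "p > 0" for p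
  proof -
    have m: "(\<lambda>x::real^3. (bb k0 p x)\<^sup>2 / p ^ 3) \<in> borel_measurable borel"
      using ibb[OF p] by auto
    have "(bb k0 p ((1 / p) *\<^sub>R x))\<^sup>2 / p ^ 3 / p ^ 3 = (bb k0 1 x)\<^sup>2" for x :: "real^3"
      unfolding bb_scale[OF p] using p by (simp add: power_mult_distrib power2_eq_square)
    then show ?thesis using rescale_integral[OF p m] unfolding J_def by simp
  qed
  have J0: "J \<ge> 0" unfolding J_def by (intro integral_nonneg_AE) auto
  show ?thesis
  \<comment> \<open>\<open>J + 1\<close> instead of \<open>J\<close>, since only
    \<open>J \<ge> 0\<close> has been established.\<close>
  proof (rule that[of C "J + 1"])
    fix t \<eta> assume t: "t \<in> {0<..<T}" and \<eta>: "(\<eta>::real) > 0"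
    define p where "p = T - t"
    have p: "p > 0" using t unfolding p_def by simp
    have "L1_gap k0 t \<le> (LINT x|lborel. C / \<eta> * (p ^ 3 * entropy_density (u x t / bb k0 p x)) + \<eta> * ((bb k0 p x)\<^sup>2 / p ^ 3))"
      unfolding L1_gap_def p_def
    proof (rule integral_mono)
      show "integrable lborel (\<lambda>x. \<bar>u x t - bb k0 (T - t) x\<bar>)" by (intro integrable_abs integrable_u_minus_bb k0 t)
      show "integrable lborel (\<lambda>x. C / \<eta> * ((T - t) ^ 3 * entropy_density (u x t / bb k0 (T - t) x)) + \<eta> * ((bb k0 (T - t) x)\<^sup>2 / (T - t) ^ 3))"
        using p unfolding p_def by (intro Bochner_Integration.integrable_add integrable_mult_right[OF integrable_entropy[OF k0 t]] integrable_mult_right[OF ibb])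
      fix x :: "real^3"
      define B where "B = bb k0 p x"
      define y where "y = u x t / B"
      have B: "B > 0" unfolding B_def by (rule bb_pos[OF k0 p])
      have y: "y > 0" "y \<le> 1 + k0 / k2"
        using ratio_pos[OF k0 t, of x] u_sandwich(6)[OF k0 t t t, of x] unfolding y_def B_def p_def by auto
      have "(sqrt y + 1)\<^sup>2 \<le> C" unfolding C_def using y by (intro power_mono) auto
      then have "(sqrt y + 1)\<^sup>2 * entropy_density y \<le> C * entropy_density y"
        using entropy_density_bounds(1)[OF y(1)] by (rule mult_right_mono)
      with entropy_density_bounds(3)[OF y(1)] have h: "(y - 1)\<^sup>2 \<le> C * entropy_density y" by linarith
      have "\<bar>u x t - B\<bar> = p ^ 3 * (\<bar>y - 1\<bar> * (B / p ^ 3))"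
      proof -
        have "u x t - B = (y - 1) * B" unfolding y_def using B by (simp add: left_diff_distrib)
        then show ?thesis using B p by (simp add: abs_mult)
      qed
      also have "\<dots> \<le> p ^ 3 * ((y - 1)\<^sup>2 / \<eta> + \<eta> * (B / p ^ 3)\<^sup>2)"
      proof (rule mult_left_mono)
        define w where "w = \<eta> * (B / p ^ 3)"
        have w: "w > 0" unfolding w_def using \<eta> B p by simp
        have "\<bar>y - 1\<bar> \<le> w + (y - 1)\<^sup>2 / w" by (rule abs_le_weighted_square[OF w])
        then have "\<bar>y - 1\<bar> * (B / p ^ 3) \<le> (w + (y - 1)\<^sup>2 / w) * (B / p ^ 3)" using B p by (intro mult_right_mono) auto
        also have "\<dots> = (y - 1)\<^sup>2 / \<eta> + \<eta> * (B / p ^ 3)\<^sup>2"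
        proof -
          have key: "(\<eta> * c + s / (\<eta> * c)) * c = s / \<eta> + \<eta> * c\<^sup>2" if "c > 0" for c s :: real
            using that \<eta> by (simp add: distrib_right power2_eq_square)
          show ?thesis unfolding w_def by (rule key) (use B p in simp)
        qed
        finally show "\<bar>y - 1\<bar> * (B / p ^ 3) \<le> (y - 1)\<^sup>2 / \<eta> + \<eta> * (B / p ^ 3)\<^sup>2" .
      qed (use p in auto)
      also have "\<dots> \<le> p ^ 3 * (C * entropy_density y / \<eta> + \<eta> * (B / p ^ 3)\<^sup>2)"
        using h \<eta> p by (intro mult_left_mono add_mono divide_right_mono) auto
      also have "\<dots> = C / \<eta> * (p ^ 3 * entropy_density y) + \<eta> * (B\<^sup>2 / p ^ 3)"
      proof -
        have "c * (h / \<eta> + \<eta> * (B / c)\<^sup>2) = c * h / \<eta> + \<eta> * (B\<^sup>2 / c)" if "c > 0" for c h :: real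
          using that by (simp add: distrib_left power2_eq_square)
        from this[of "p ^ 3" "C * entropy_density y"] p show ?thesis by (simp add: mult_ac)
      qed
      finally show "\<bar>u x t - bb k0 (T - t) x\<bar> \<le> C / \<eta> * ((T - t) ^ 3 * entropy_density (u x t / bb k0 (T - t) x)) + \<eta> * ((bb k0 (T - t) x)\<^sup>2 / (T - t) ^ 3)"
        unfolding y_def B_def p_def .
    qed
    also have "\<dots> = C / \<eta> * entropy k0 t + \<eta> * J"
      unfolding entropy_def Jp[OF p, symmetric]
      by (subst Bochner_Integration.integral_add[OF integrable_mult_right[OF integrable_entropy[OF k0 t, folded p_def]] integrable_mult_right[OF ibb[OF p]]])
         (simp only: integral_mult_right_zero p_def)
    also have "\<dots> \<le> C / \<eta> * entropy k0 t + \<eta> * (J + 1)" using \<eta> by simp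
    finally show "L1_gap k0 t \<le> C / \<eta> * entropy k0 t + \<eta> * (J + 1)" .
  qed (use C J0 in auto)
qed

lemma L1_gap_tends_to_zero:
  assumes k0: "k0 > 0" and \<epsilon>: "\<epsilon> > 0"
    and mass: "\<And>t. t \<in> {0<..<T} \<Longrightarrow> (LINT x|lborel. u x t - bb k0 (T - t) x) = 0"
  obtains t1 where "t1 \<in> {0<..<T}" "\<And>t. t1 \<le> t \<Longrightarrow> t < T \<Longrightarrow> L1_gap k0 t \<le> \<epsilon>"
proof -
  obtain C1 J where C1: "C1 > 0" "J > 0" "\<And>t \<eta>. t \<in> {0<..<T} \<Longrightarrow> \<eta> > 0 \<Longrightarrow> L1_gap k0 t \<le> C1 / \<eta> * entropy k0 t + \<eta> * J"
    by (rule gap_le_entropy[OF k0]) blast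
  obtain C2 where C2: "C2 > 0" "\<And>t. t \<in> {0<..<T} \<Longrightarrow> entropy k0 t \<le> C2 * L1_gap k0 t"
    by (rule entropy_le_gap[OF k0]) blast
  \<comment> \<open>\<open>\<eta>\<close> makes the error \<open>\<eta> * J\<close> equal to
    \<open>\<epsilon> / 2\<close>; then \<open>e\<close> is the gap at time \<open>t1\<close> for
    which \<open>C1 / \<eta> * (C2 * e)\<close> is the other half.\<close>
  define \<eta> where "\<eta> = \<epsilon> / (2 * J)"
  have \<eta>: "\<eta> > 0" unfolding \<eta>_def using \<epsilon> C1 by simp
  define e where "e = \<epsilon> * \<eta> / (2 * C1 * C2)"
  have e: "e > 0" unfolding e_def using \<epsilon> \<eta> C1 C2 by simp
  obtain \<rho> \<delta> where \<rho>: "\<rho> > 0" "\<delta> > 0" "\<And>t. t \<in> {0<..<T} \<Longrightarrow> local_dissipation \<rho> t < \<delta> \<Longrightarrow> L1_gap k0 t \<le> e"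
    by (rule small_dissipation_small_gap[OF k0 e mass]) blast+
  have T2: "T / 2 \<in> {0<..<T}" using T by simp
  obtain t1 where t1: "T / 2 \<le> t1" "t1 < T" "local_dissipation \<rho> t1 < \<delta>"
    by (rule small_dissipation[OF k0 \<rho>(2,1) T2])
  have t1': "t1 \<in> {0<..<T}" using t1 T by auto
  show ?thesis
  proof (rule that[OF t1'])
    fix t assume t: "t1 \<le> t" "t < T"
    have t': "t \<in> {0<..<T}" using t t1' by auto
    have "entropy k0 t \<le> entropy k0 t1" using t t1' by (intro entropy_antimono k0) auto
    also have "\<dots> \<le> C2 * L1_gap k0 t1" by (rule C2(2)[OF t1'])
    also have "\<dots> \<le> C2 * e" using \<rho>(3)[OF t1' t1(3)] C2 by (intro mult_left_mono) auto
    finally have "C1 / \<eta> * entropy k0 t \<le> C1 / \<eta> * (C2 * e)" using C1 \<eta> by (intro mult_left_mono) auto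
    also have "\<dots> = \<epsilon> / 2" unfolding e_def using C1 C2 \<eta> by simp
    finally have "L1_gap k0 t \<le> \<epsilon> / 2 + \<eta> * J" using C1(3)[OF t' \<eta>] by linarith
    also have "\<eta> * J = \<epsilon> / 2" unfolding \<eta>_def using C1 by simp
    finally show "L1_gap k0 t \<le> \<epsilon>" by simp
  qed
qed

end

section \<open>Uniform convergence\<close>

lemma shifted_continuous:
  assumes "continuous_on UNIV F"
  shows "continuous_on UNIV (\<lambda>x::real^3. F (x0 + x) :: real)"
  by (rule continuous_on_compose2[OF assms]) (auto intro!: continuous_intros)

lemma continuous_ln_bb: "k > 0 \<Longrightarrow> p > 0 \<Longrightarrow> continuous_on UNIV (\<lambda>x::real^3. ln (bb k p x))"
  by (intro continuous_intros continuous_on_bb ballI less_imp_neq[symmetric] bb_pos)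

text \<open>\<open>bump \<sigma>\<close> concentrates at the origin as \<open>\<sigma>\<close> tends
  to 0, with fixed mass; the side condition \<open>\<sigma> \<le> r\<close> serves the later use of
  \<open>newton_diff \<sigma> r\<close>.\<close>

lemma bump_average_limit:
  fixes f :: "real^3 \<Rightarrow> real"
  assumes f: "continuous_on UNIV f" and \<epsilon>: "\<epsilon> > 0" and r: "r > 0"
  obtains \<sigma> where "0 < \<sigma>" "\<sigma> \<le> r" "\<bar>(LINT x|lborel. bump \<sigma> x * f (x0 + x)) - bump_mass * f x0\<bar> \<le> bump_mass * \<epsilon>"
proof -
  have "isCont f x0" using f by (simp add: continuous_on_eq_continuous_at)
  then obtain d where d: "d > 0" "\<And>y. dist y x0 < d \<Longrightarrow> dist (f y) (f x0) < \<epsilon>"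
    unfolding continuous_at_eps_delta using \<epsilon> by blast
  define \<sigma> where "\<sigma> = min r (d / 2)"
  have \<sigma>: "0 < \<sigma>" "\<sigma> \<le> r" "\<sigma> < d" unfolding \<sigma>_def using d r by auto
  show ?thesis
  proof (rule that[OF \<sigma>(1,2)])
    have cf: "continuous_on UNIV (\<lambda>x. f (x0 + x))" by (rule shifted_continuous[OF f])
    have i: "integrable lborel (\<lambda>x. bump \<sigma> x * f (x0 + x))"
      by (rule integrable_continuous_cball[where R=\<sigma>];
          (intro continuous_intros continuous_on_bump cf)?; simp add: bump_supp[OF \<sigma>(1)])
    have ib: "integrable lborel (bump \<sigma> :: real^3 \<Rightarrow> real)" by (rule integrable_bump[OF \<sigma>(1)])
    have "(LINT x|lborel. bump \<sigma> x * f (x0 + x)) - bump_mass * f x0 = (LINT x|lborel. bump \<sigma> x * f (x0 + x) - bump \<sigma> x * f x0)"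
      using i ib integral_bump[OF \<sigma>(1)] by simp
    moreover have "\<bar>LINT x|lborel. bump \<sigma> x * f (x0 + x) - bump \<sigma> x * f x0\<bar> \<le> (LINT x::real^3|lborel. bump \<sigma> x * \<epsilon>)"
    proof (rule abs_integral_le)
      show "integrable lborel (\<lambda>x::real^3. bump \<sigma> x * \<epsilon>)" using ib by simp
      fix x :: "real^3"
      show "\<bar>bump \<sigma> x * f (x0 + x) - bump \<sigma> x * f x0\<bar> \<le> bump \<sigma> x * \<epsilon>"
      proof (cases "norm x \<le> \<sigma>")
        case True
        then have "dist (x0 + x) x0 < d" using \<sigma> by (simp add: dist_norm)
        then have "\<bar>f (x0 + x) - f x0\<bar> \<le> \<epsilon>" using d(2) by (force simp: dist_real_def)
        then have "bump \<sigma> x * \<bar>f (x0 + x) - f x0\<bar> \<le> bump \<sigma> x * \<epsilon>"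
          using bump_nonneg[OF \<sigma>(1)] by (rule mult_left_mono)
        then show ?thesis using bump_nonneg[OF \<sigma>(1), of x] by (simp add: abs_mult flip: right_diff_distrib)
      qed (simp add: bump_supp[OF \<sigma>(1)])
    qed
    moreover have "(LINT x::real^3|lborel. bump \<sigma> x * \<epsilon>) = bump_mass * \<epsilon>" using integral_bump[OF \<sigma>(1)] by simp
    ultimately show "\<bar>(LINT x|lborel. bump \<sigma> x * f (x0 + x)) - bump_mass * f x0\<bar> \<le> bump_mass * \<epsilon>" by (simp only:)
  qed
qed

lemma integrable_bump_mult:
  fixes f :: "real^3 \<Rightarrow> real"
  assumes "r > 0" "continuous_on UNIV f"
  shows "integrable lborel (\<lambda>x. bump r x * f x)"
  by (rule integrable_continuous_cball[where R=r];
      (intro continuous_intros continuous_on_bump assms)?; simp add: bump_supp[OF assms(1)])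

lemma bump_integral_mono:
  fixes f g :: "real^3 \<Rightarrow> real"
  assumes r: "r > 0" and c: "continuous_on UNIV f" "continuous_on UNIV g" and le: "\<And>x. norm x \<le> r \<Longrightarrow> f x \<le> g x"
  shows "(LINT x|lborel. bump r x * f x) \<le> (LINT x|lborel. bump r x * g x)"
proof (intro integral_mono integrable_bump_mult r c)
  fix x :: "real^3"
  show "bump r x * f x \<le> bump r x * g x"
    using le[of x] bump_nonneg[OF r, of x] bump_supp[OF r, of x] by (cases "norm x \<le> r") (auto intro: mult_left_mono)
qed

lemma bump_integral_const:
  assumes "r > 0"
  shows "(LINT x::real^3|lborel. bump r x * c) = bump_mass * c"
  using integral_bump[OF assms] by simp

lemma abs_diff_le_ln:
  fixes a b M :: real
  assumes "0 < a" "0 < b" "a \<le> M" "b \<le> M"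
  shows "\<bar>a - b\<bar> \<le> M * \<bar>ln a - ln b\<bar>"
proof -
  have one: "a - b \<le> M * \<bar>ln a - ln b\<bar>" if ab: "0 < a" "0 < b" "a \<le> M" for a b :: real
  proof -
    have "ln (b / a) \<le> b / a - 1" using ab by (intro ln_le_minus_one) auto
    then have "1 - b / a \<le> ln a - ln b" using ab by (simp add: ln_div)
    then have "1 - b / a \<le> \<bar>ln a - ln b\<bar>" by linarith
    then have "a * (1 - b / a) \<le> a * \<bar>ln a - ln b\<bar>" using ab by (intro mult_left_mono) auto
    also have "\<dots> \<le> M * \<bar>ln a - ln b\<bar>" using ab by (intro mult_right_mono) auto
    finally show ?thesis using ab by (simp add: right_diff_distrib)
  qed
  from one[of a b] one[of b a] assms show ?thesis by (simp add: abs_minus_commute abs_le_iff)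
qed

text \<open>\<open>ln (bb k p y) = ln 2 + 3 * ln p - ln (k + (p * norm y)^2)\<close>, so only the
  ratio \<open>p / p1\<close> and the rescaled points count: \<open>\<tau>\<close> measures the
  change of time, \<open>\<rho>\<close> the rescaled displacement, and \<open>\<rho>0\<close> the
  rescaled distance from the origin, on which the Lipschitz constant depends.\<close>

lemma ln_bb_close:
  fixes x0 y :: "'a::real_normed_vector"
  assumes k: "k > 0" and p1: "p1 > 0" and p: "p1 \<le> p" "p \<le> (1 + \<tau>) * p1" and \<tau>: "0 \<le> \<tau>" "\<tau> \<le> 1"
    and x0: "p1 * norm x0 \<le> \<rho>0" and y: "p1 * norm (y - x0) \<le> \<rho>" and \<rho>: "0 \<le> \<rho>" "\<rho> \<le> 1"
  shows "\<bar>ln (bb k p y) - ln (bb k p1 x0)\<bar> \<le> (3 + (2 + \<rho>0) * (3 * \<rho>0 + 2) / k) * (\<tau> + \<rho>)"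
proof -
  have "(1 + \<tau>) * p1 \<le> 2 * p1" using \<tau> p1 by (intro mult_right_mono) auto
  then have p0: "p > 0" "p \<le> 2 * p1" using p p1 by linarith+
  have "0 \<le> p1 * norm x0" using p1 by simp
  then have \<rho>0: "\<rho>0 \<ge> 0" using x0 by linarith
  define X where "X = p * norm y"
  define X1 where "X1 = p1 * norm x0"
  have X1: "0 \<le> X1" "X1 \<le> \<rho>0" unfolding X1_def using x0 p1 by auto
  have eq: "ln (bb k p y) - ln (bb k p1 x0) = 3 * ln (p / p1) - (ln (k + X\<^sup>2) - ln (k + X1\<^sup>2))"
  proof -
    have "ln (bb k q z) = ln 2 + 3 * ln q - ln (k + q\<^sup>2 * (norm z)\<^sup>2)" if "q > 0" for q and z :: 'a
    proof -
      have "k + q\<^sup>2 * (norm z)\<^sup>2 > 0" by (rule pos_quad[OF k]) simp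
      then have "ln (bb k q z) = ln (2 * q ^ 3) - ln (k + q\<^sup>2 * (norm z)\<^sup>2)"
        unfolding bb_def using that by (subst ln_div) auto
      then show ?thesis using that by (simp add: ln_mult ln_realpow)
    qed
    then show ?thesis using p0 p1 unfolding X_def X1_def by (simp add: ln_div power_mult_distrib)
  qed
  have 1: "0 \<le> ln (p / p1)" "ln (p / p1) \<le> \<tau>"
  proof -
    show "0 \<le> ln (p / p1)" using p p1 by simp
    have "ln (p / p1) \<le> p / p1 - 1" using p0 p1 by (intro ln_le_minus_one) auto
    also have "p / p1 \<le> 1 + \<tau>" using p p1 by (simp add: pos_divide_le_eq)
    finally show "ln (p / p1) \<le> \<tau>" by simp
  qed
  have d: "\<bar>X - X1\<bar> \<le> 2 * \<rho> + \<tau> * \<rho>0"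
  proof -
    have "X - X1 = p * (norm y - norm x0) + (p - p1) * norm x0" unfolding X_def X1_def by (simp add: algebra_simps)
    then have "\<bar>X - X1\<bar> \<le> p * \<bar>norm y - norm x0\<bar> + (p - p1) * norm x0"
      using abs_triangle_ineq[of "p * (norm y - norm x0)" "(p - p1) * norm x0"] p0 p by (simp add: abs_mult)
    also have "p * \<bar>norm y - norm x0\<bar> \<le> (2 * p1) * norm (y - x0)"
      using p0 p1 norm_triangle_ineq3[of y x0] by (intro mult_mono) auto
    also have "\<dots> \<le> 2 * \<rho>" using y by simp
    also have "(p - p1) * norm x0 \<le> (\<tau> * p1) * norm x0" using p by (intro mult_right_mono) (auto simp: algebra_simps)
    also have "\<dots> \<le> \<tau> * \<rho>0" using x0 \<tau> unfolding mult.assoc by (intro mult_left_mono) auto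
    finally show ?thesis by simp
  qed
  have Xb: "0 \<le> X" "X + X1 \<le> 3 * \<rho>0 + 2"
  proof -
    show "0 \<le> X" unfolding X_def using p0 by simp
    have "\<tau> * \<rho>0 \<le> 1 * \<rho>0" using \<tau> \<rho>0 by (intro mult_right_mono) auto
    then show "X + X1 \<le> 3 * \<rho>0 + 2" using d X1 \<rho> by linarith
  qed
  have lnk: "\<bar>ln (k + a) - ln (k + b)\<bar> \<le> \<bar>a - b\<bar> / k" if ab: "a \<ge> 0" "b \<ge> 0" for a b :: real
  proof -
    have one: "ln (k + a) - ln (k + b) \<le> \<bar>a - b\<bar> / k" if ab: "a \<ge> 0" "b \<ge> 0" for a b :: real
    proof -
      have "ln ((k + a) / (k + b)) \<le> (k + a) / (k + b) - 1" using ab k by (intro ln_le_minus_one) auto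
      also have "\<dots> = (a - b) / (k + b)" using ab k by (simp add: field_simps)
      also have "\<dots> \<le> \<bar>a - b\<bar> / k" using ab k by (intro frac_le) auto
      finally show ?thesis using ab k by (simp add: ln_div)
    qed
    from one[OF ab] one[OF ab(2,1)] show ?thesis by (simp add: abs_minus_commute abs_le_iff)
  qed
  have "\<bar>X\<^sup>2 - X1\<^sup>2\<bar> = \<bar>X - X1\<bar> * (X + X1)"
  proof -
    have "X\<^sup>2 - X1\<^sup>2 = (X - X1) * (X + X1)" by (simp add: power2_eq_square algebra_simps)
    then show ?thesis using X1 Xb by (simp add: abs_mult)
  qed
  also have "\<dots> \<le> (2 * \<rho> + \<tau> * \<rho>0) * (3 * \<rho>0 + 2)" using d Xb X1 \<rho> \<tau> \<rho>0 by (intro mult_mono) auto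
  also have "\<dots> \<le> ((2 + \<rho>0) * (\<tau> + \<rho>)) * (3 * \<rho>0 + 2)"
    using \<rho> \<tau> \<rho>0 by (intro mult_right_mono) (auto simp: algebra_simps)
  finally have "\<bar>X\<^sup>2 - X1\<^sup>2\<bar> / k \<le> ((2 + \<rho>0) * (\<tau> + \<rho>)) * (3 * \<rho>0 + 2) / k" using k by (intro divide_right_mono) auto
  then have 2: "\<bar>ln (k + X\<^sup>2) - ln (k + X1\<^sup>2)\<bar> \<le> ((2 + \<rho>0) * (\<tau> + \<rho>)) * (3 * \<rho>0 + 2) / k"
    using lnk[of "X\<^sup>2" "X1\<^sup>2"] by simp
  have "\<bar>ln (bb k p y) - ln (bb k p1 x0)\<bar> \<le> 3 * \<tau> + ((2 + \<rho>0) * (\<tau> + \<rho>)) * (3 * \<rho>0 + 2) / k"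
    unfolding eq using 1 2 by linarith
  also have "\<dots> \<le> 3 * (\<tau> + \<rho>) + ((2 + \<rho>0) * (\<tau> + \<rho>)) * (3 * \<rho>0 + 2) / k" using \<rho> by simp
  also have "\<dots> = (3 + (2 + \<rho>0) * (3 * \<rho>0 + 2) / k) * (\<tau> + \<rho>)"
  proof -
    have "3 * S + (A * S) * E / k = (3 + A * E / k) * S" for S A E :: real
      by (simp add: distrib_right)
    then show ?thesis .
  qed
  finally show ?thesis .
qed

context trapped_solution
begin

lemma continuous_ln_u: "t \<in> {0<..<T} \<Longrightarrow> continuous_on UNIV (\<lambda>x. ln (u x t))"
  by (intro continuous_intros sliceu ballI less_imp_neq[symmetric] upos)

text \<open>On the ball the rescaled distance from the origin is at most \<open>R0\<close>, so
  \<open>B\<close> is at least a multiple of \<open>p ^ 3\<close>, and the trap bounds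
  \<open>\<bar>ln u - ln B\<bar>\<close> by a multiple of \<open>\<bar>u - B\<bar> / p ^ 3\<close>.
  As the bump is of order \<open>r^(-3)\<close>, convergence in the mean controls averages of
  logarithms over balls of fixed rescaled radius \<open>r * p\<close>.\<close>

lemma bump_ln_gap:
  assumes k0: "k0 > 0"
  obtains C where "C > 0" "\<And>t x0 r. t \<in> {0<..<T} \<Longrightarrow> r > 0 \<Longrightarrow> (T - t) * (norm x0 + r) \<le> R0 \<Longrightarrow>
    \<bar>(LINT x|lborel. bump r x * ln (u (x0 + x) t)) - (LINT x|lborel. bump r x * ln (bb k0 (T - t) (x0 + x)))\<bar>
     \<le> C / (r * (T - t)) ^ 3 * L1_gap k0 t"
proof
  define c1 where "c1 = 1 + k1 / k0"
  have c1: "c1 > 0" unfolding c1_def using k0 k1 by (simp add: add_pos_pos)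
  show "15 / 4 * c1 * (k0 + R0\<^sup>2) > 0" using c1 k0 by (intro mult_pos_pos) (auto simp: add_pos_nonneg)
  fix t r :: real and x0 :: "real^3" assume t: "t \<in> {0<..<T}" and r: "r > 0" and R0: "(T - t) * (norm x0 + r) \<le> R0"
  define p where "p = T - t"
  have p: "p > 0" using t unfolding p_def by simp
  let ?g = "\<lambda>x. \<bar>u x t - bb k0 p x\<bar>"
  have ig: "integrable lborel ?g" unfolding p_def by (intro integrable_abs integrable_u_minus_bb k0 t)
  have ig': "integrable lborel (\<lambda>x. ?g (x0 + x))" using lborel_integrable_affine[OF ig, of 1 x0] by simp
  have gb: "?g \<in> borel_measurable borel" using ig by auto
  define c where "c = 15 / (2 * r ^ 3) * (c1 * ((k0 + R0\<^sup>2) / (2 * p ^ 3)))"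
  have "(LINT x|lborel. bump r x * ln (u (x0 + x) t)) - (LINT x|lborel. bump r x * ln (bb k0 p (x0 + x)))
     = (LINT x|lborel. bump r x * ln (u (x0 + x) t) - bump r x * ln (bb k0 p (x0 + x)))"
    by (intro Bochner_Integration.integral_diff[symmetric] integrable_bump_mult r shifted_continuous[OF continuous_ln_u[OF t]]
      shifted_continuous[OF continuous_ln_bb[OF k0 p]])
  moreover have "\<bar>LINT x|lborel. bump r x * ln (u (x0 + x) t) - bump r x * ln (bb k0 p (x0 + x))\<bar> \<le> (LINT x|lborel. c * ?g (x0 + x))"
  proof (rule abs_integral_le[OF integrable_mult_right[OF ig']])
    fix x
    show "\<bar>bump r x * ln (u (x0 + x) t) - bump r x * ln (bb k0 p (x0 + x))\<bar> \<le> c * ?g (x0 + x)"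
    proof (cases "norm x \<le> r")
      case False
      have "c \<ge> 0" unfolding c_def using r c1 k0 p by simp
      then show ?thesis using False by (simp add: bump_supp[OF r])
    next
      case True
      let ?x = "x0 + x"
      have b: "bb k0 p ?x > 0" by (rule bb_pos[OF k0 p])
      have "p * norm ?x \<le> p * (norm x0 + r)" using True norm_triangle_ineq[of x0 x] p by (intro mult_left_mono) auto
      then have "p * norm ?x \<le> R0" using R0 unfolding p_def by linarith
      then have "(p * norm ?x)\<^sup>2 \<le> R0\<^sup>2" using p by (intro power_mono) auto
      then have "1 / bb k0 p ?x \<le> (k0 + R0\<^sup>2) / (2 * p ^ 3)"
        unfolding bb_def using p by (simp add: power_mult_distrib divide_right_mono)
      then have "?g ?x * (1 / bb k0 p ?x) \<le> ?g ?x * ((k0 + R0\<^sup>2) / (2 * p ^ 3))" by (intro mult_left_mono) auto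
      moreover have "\<bar>u ?x t / bb k0 p ?x - 1\<bar> = ?g ?x * (1 / bb k0 p ?x)"
      proof -
        have "u ?x t / bb k0 p ?x - 1 = (u ?x t - bb k0 p ?x) / bb k0 p ?x" using b by (simp add: diff_divide_distrib)
        then show ?thesis using b by (simp add: abs_divide)
      qed
      ultimately have "c1 * \<bar>u ?x t / bb k0 p ?x - 1\<bar> \<le> c1 * (?g ?x * ((k0 + R0\<^sup>2) / (2 * p ^ 3)))"
        using c1 by (intro mult_left_mono) auto
      then have l: "\<bar>ln (u ?x t) - ln (bb k0 p ?x)\<bar> \<le> c1 * (?g ?x * ((k0 + R0\<^sup>2) / (2 * p ^ 3)))"
        using u_sandwich(7)[OF k0 t t t, of ?x] unfolding c1_def p_def by linarith
      have "\<bar>bump r x * ln (u ?x t) - bump r x * ln (bb k0 p ?x)\<bar> = bump r x * \<bar>ln (u ?x t) - ln (bb k0 p ?x)\<bar>"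
        using bump_nonneg[OF r, of x] by (simp add: abs_mult flip: right_diff_distrib)
      also have "\<dots> \<le> 15 / (2 * r ^ 3) * (c1 * (?g ?x * ((k0 + R0\<^sup>2) / (2 * p ^ 3))))"
        using bump_le[OF r, of x] l bump_nonneg[OF r, of x] r by (intro mult_mono) auto
      finally show ?thesis unfolding c_def by (simp only: mult_ac)
    qed
  qed
  moreover have "(LINT x|lborel. c * ?g (x0 + x)) = c * L1_gap k0 t"
    using lborel_integral_shift[OF gb, of x0] unfolding L1_gap_def p_def by simp
  moreover have "c = 15 / 4 * c1 * (k0 + R0\<^sup>2) / (r * p) ^ 3" unfolding c_def by (simp add: power_mult_distrib)
  ultimately show "\<bar>(LINT x|lborel. bump r x * ln (u (x0 + x) t)) - (LINT x|lborel. bump r x * ln (bb k0 (T - t) (x0 + x)))\<bar>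
     \<le> 15 / 4 * c1 * (k0 + R0\<^sup>2) / (r * (T - t)) ^ 3 * L1_gap k0 t" unfolding p_def[symmetric] by (simp only:)
qed

lemma mean_value_ln_u:
  assumes t: "t \<in> {0<..<T}" and r: "0 < \<sigma>" "\<sigma> \<le> r"
  shows "(LINT x|lborel. newton_diff \<sigma> r x * ut (x0 + x) t)
    = (LINT x|lborel. bump r x * ln (u (x0 + x) t)) - (LINT x|lborel. bump \<sigma> x * ln (u (x0 + x) t))"
proof -
  have ne: "u x t \<noteq> 0" for x using upos[OF t, of x] by simp
  have "(LINT x|lborel. newton_diff \<sigma> r x * (\<Sum>b\<in>Basis. H b (x0 + x) t / u (x0 + x) t - (g b (x0 + x) t / u (x0 + x) t)\<^sup>2))
    = (LINT x|lborel. bump r x * ln (u (x0 + x) t)) - (LINT x|lborel. bump \<sigma> x * ln (u (x0 + x) t))"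
  proof (rule mean_value_identity[where ?f1.0="\<lambda>b x. g b (x0 + x) t / u (x0 + x) t", OF _ _ _ _ _ r])
    fix b :: "real^3" assume b: "b \<in> Basis"
    show "has_dd (\<lambda>x. ln (u (x0 + x) t)) b (\<lambda>x. g b (x0 + x) t / u (x0 + x) t)"
      by (rule has_dd_shift[OF dd_ln(1)[OF t b]])
    show "has_dd (\<lambda>x. g b (x0 + x) t / u (x0 + x) t) b (\<lambda>x. H b (x0 + x) t / u (x0 + x) t - (g b (x0 + x) t / u (x0 + x) t)\<^sup>2)"
      by (rule has_dd_shift[OF dd_ln(2)[OF t b]])
    have "continuous_on UNIV (\<lambda>x. g b x t / u x t)"
      using ne by (intro continuous_intros sliceg sliceu t b) auto
    then show "continuous_on UNIV (\<lambda>x. g b (x0 + x) t / u (x0 + x) t)" by (rule shifted_continuous)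
    have "continuous_on UNIV (\<lambda>x. H b x t / u x t - (g b x t / u x t)\<^sup>2)"
      using ne by (intro continuous_intros sliceg sliceu sliceH t b) auto
    then show "continuous_on UNIV (\<lambda>x. H b (x0 + x) t / u (x0 + x) t - (g b (x0 + x) t / u (x0 + x) t)\<^sup>2)" by (rule shifted_continuous)
  qed (rule shifted_continuous[OF continuous_ln_u[OF t]])
  then show ?thesis unfolding pde[OF t, symmetric] .
qed

lemma integrable_newton_diff_mult:
  assumes "0 < \<sigma>" "\<sigma> \<le> r" "continuous_on UNIV f"
  shows "integrable lborel (\<lambda>x::real^3. newton_diff \<sigma> r x * f x)"
  by (rule integrable_continuous_cball[where R=r];
      (intro continuous_intros continuous_on_newton_diff assms)?; simp add: newton_diff_supp[OF assms(1,2)])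

lemma newton_diff_integral_le:
  fixes f :: "real^3 \<Rightarrow> real"
  assumes r: "0 < \<sigma>" "\<sigma> \<le> r" and f: "continuous_on UNIV f" "\<And>x. f x \<le> K" and K: "K \<ge> 0"
  shows "(LINT x|lborel. newton_diff \<sigma> r x * f x) \<le> K * (bump_mass * r\<^sup>2 / 6)"
proof -
  have "(LINT x|lborel. newton_diff \<sigma> r x * f x) \<le> (LINT x::real^3|lborel. newton_diff \<sigma> r x * K)"
    using f newton_diff_nonneg[OF r] by (intro integral_mono integrable_newton_diff_mult r mult_left_mono) (auto intro!: continuous_intros)
  also have "\<dots> = K * (LINT x::real^3|lborel. newton_diff \<sigma> r x)" by (simp add: mult.commute)
  also have "\<dots> \<le> K * (bump_mass * r\<^sup>2 / 6)" using K integral_newton_diff_le[OF r] by (intro mult_left_mono) auto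
  finally show ?thesis .
qed

lemma u_le_const: "t \<in> {0<..<T} \<Longrightarrow> u x t \<le> 2 * (T - t) ^ 3 / k2"
  using trap(2)[of t x] bb_le_const[OF k(1), of "T - t" x] by force

text \<open>The error is of order \<open>p ^ 3 * r^2 = p * (p * r)^2\<close> with
  \<open>p = T - t\<close>, which vanishes at extinction when the rescaled radius
  \<open>p * r\<close> is fixed.\<close>

lemma ln_u_lower:
  assumes t: "t \<in> {0<..<T}" and r: "r > 0"
  shows "(LINT x|lborel. bump r x * ln (u (x0 + x) t)) - 2 * (T - t) ^ 3 / k2 / t * (bump_mass * r\<^sup>2 / 6) \<le> bump_mass * ln (u x0 t)"
proof (rule field_le_epsilon)
  fix e :: real assume e: "e > 0"
  have "e / bump_mass > 0" using e bump_mass_pos by simp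
  from bump_average_limit[OF continuous_ln_u[OF t] this r, of x0]
  obtain \<sigma> where \<sigma>: "0 < \<sigma>" "\<sigma> \<le> r" "\<bar>(LINT x|lborel. bump \<sigma> x * ln (u (x0 + x) t)) - bump_mass * ln (u x0 t)\<bar> \<le> bump_mass * (e / bump_mass)" .
  have "(LINT x|lborel. newton_diff \<sigma> r x * ut (x0 + x) t) \<le> 2 * (T - t) ^ 3 / k2 / t * (bump_mass * r\<^sup>2 / 6)"
  proof (rule newton_diff_integral_le[OF \<sigma>(1,2) shifted_continuous[OF sliceut[OF t]]])
    show "ut (x0 + x) t \<le> 2 * (T - t) ^ 3 / k2 / t" for x
      using ut_le[OF t, of "x0 + x"] divide_right_mono[OF u_le_const[OF t, of "x0 + x"], of t] t by auto
    show "0 \<le> 2 * (T - t) ^ 3 / k2 / t" using t k by auto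
  qed
  then show "(LINT x|lborel. bump r x * ln (u (x0 + x) t)) - 2 * (T - t) ^ 3 / k2 / t * (bump_mass * r\<^sup>2 / 6) \<le> bump_mass * ln (u x0 t) + e"
    unfolding mean_value_ln_u[OF t \<sigma>(1,2)] using \<sigma>(3) bump_mass_pos by simp
qed

text \<open>Testing with \<open>newton_diff \<sigma> r\<close> and integrating over \<open>[t0, t1]\<close> replaces the lower bound on \<open>u\<^sub>t\<close> that is not
  available; the monotonicity of \<open>u / t\<close> carries the value at time \<open>t1\<close> back to all earlier times.\<close>

lemma ln_u_upper:
  assumes t: "0 < t0" "t0 < t1" "t1 < T" and r: "r > 0"
    and Q: "\<And>t. t0 \<le> t \<Longrightarrow> t \<le> t1 \<Longrightarrow> (LINT x|lborel. bump r x * ln (u (x0 + x) t)) \<le> Q"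
  shows "bump_mass * (ln (u x0 t1) - ln (t1 / t0)) \<le> Q + 2 * (T - t0) ^ 3 / k2 * (bump_mass * r\<^sup>2 / 6) / (t1 - t0)"
proof (rule field_le_epsilon)
  fix e :: real assume e: "e > 0"
  have in0: "t \<in> {0<..<T}" if "t0 \<le> t" "t \<le> t1" for t using that t by auto
  have t1: "t1 \<in> {0<..<T}" and t0: "t0 \<in> {0<..<T}" using t by auto
  have "e / bump_mass > 0" using e bump_mass_pos by simp
  from bump_average_limit[OF continuous_ln_u[OF t1] this r, of x0]
  obtain \<sigma> where \<sigma>: "0 < \<sigma>" "\<sigma> \<le> r" "\<bar>(LINT x|lborel. bump \<sigma> x * ln (u (x0 + x) t1)) - bump_mass * ln (u x0 t1)\<bar> \<le> bump_mass * (e / bump_mass)" .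
  define q where "q t = (LINT x|lborel. newton_diff \<sigma> r x * u (x0 + x) t)" for t
  have dq: "(q has_real_derivative (LINT x|lborel. newton_diff \<sigma> r x * ut (x0 + x) t)) (at t)" if "t \<in> {0<..<T}" for t
    unfolding q_def
  proof (rule leibniz_lborel[where a=0 and b=T and R=r])
    show "((\<lambda>t. newton_diff \<sigma> r x * u (x0 + x) t) has_real_derivative newton_diff \<sigma> r x * ut (x0 + x) t) (at t)"
      if "t \<in> {0<..<T}" for x t by (rule DERIV_cmult[OF dt[OF that]])
    show "continuous_on UNIV (\<lambda>x. newton_diff \<sigma> r x * u (x0 + x) t)" if "t \<in> {0<..<T}" for t
      by (intro continuous_intros continuous_on_newton_diff shifted_continuous[OF sliceu[OF that]])
    have a: "continuous_on (UNIV \<times> {0<..<T}) (\<lambda>z. newton_diff \<sigma> r (fst z))"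
      by (intro continuous_on_compose2[OF continuous_on_newton_diff] continuous_intros) auto
    have "continuous_on (UNIV \<times> {0<..<T}) ((\<lambda>(x, t). ut x t) \<circ> (\<lambda>z. (x0 + fst z, snd z)))"
      by (intro continuous_on_compose continuous_on_subset[OF contut] continuous_intros) auto
    then have b: "continuous_on (UNIV \<times> {0<..<T}) (\<lambda>z. ut (x0 + fst z) (snd z))" by (simp add: comp_def)
    show "continuous_on (UNIV \<times> {0<..<T}) (\<lambda>(x, t). newton_diff \<sigma> r x * ut (x0 + x) t)"
      unfolding split_beta by (intro continuous_intros a b)
  qed (use that newton_diff_supp[OF \<sigma>(1,2)] in auto)
  \<comment> \<open>At this single time the integral of \<open>newton_diff\<close> against
    \<open>ut\<close> is at least \<open>- q t0 / (t1 - t0)\<close>, because \<open>q t1\<close> is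
    nonnegative.\<close>
  obtain \<xi> where \<xi>: "t0 < \<xi>" "\<xi> < t1" "q t1 - q t0 = (t1 - t0) * (LINT x|lborel. newton_diff \<sigma> r x * ut (x0 + x) \<xi>)"
    using MVT2[OF t(2), of q "\<lambda>t. LINT x|lborel. newton_diff \<sigma> r x * ut (x0 + x) t"] dq in0 by blast
  have \<xi>': "\<xi> \<in> {0<..<T}" using \<xi> t by auto
  have q1: "q t1 \<ge> 0"
    unfolding q_def using newton_diff_nonneg[OF \<sigma>(1,2)] upos[OF t1]
    by (intro integral_nonneg_AE AE_I2 mult_nonneg_nonneg) (auto simp: less_imp_le)
  have q0: "q t0 \<le> 2 * (T - t0) ^ 3 / k2 * (bump_mass * r\<^sup>2 / 6)"
    unfolding q_def using t k
    by (intro newton_diff_integral_le[OF \<sigma>(1,2) shifted_continuous[OF sliceu[OF t0]]] u_le_const t0) auto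
  have low: "bump_mass * (ln (u x0 t1) - ln (t1 / t0)) - e \<le> (LINT x|lborel. bump \<sigma> x * ln (u (x0 + x) \<xi>))"
  proof -
    have "(LINT x|lborel. bump \<sigma> x * (ln (u (x0 + x) t1) - ln (t1 / t0))) \<le> (LINT x|lborel. bump \<sigma> x * ln (u (x0 + x) \<xi>))"
    proof (rule bump_integral_mono[OF \<sigma>(1)])
      show "continuous_on UNIV (\<lambda>x. ln (u (x0 + x) t1) - ln (t1 / t0))"
        by (intro continuous_intros shifted_continuous[OF continuous_ln_u[OF t1]])
      show "continuous_on UNIV (\<lambda>x. ln (u (x0 + x) \<xi>))" by (rule shifted_continuous[OF continuous_ln_u[OF \<xi>']])
      fix x
      have "\<xi> * u (x0 + x) t1 \<le> t1 * u (x0 + x) \<xi>" using \<xi> t by (intro benilan_crandall) auto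
      then have "ln (\<xi> * u (x0 + x) t1) \<le> ln (t1 * u (x0 + x) \<xi>)"
        using upos[OF t1, of "x0 + x"] \<xi> t by (intro ln_mono) auto
      then have "ln \<xi> + ln (u (x0 + x) t1) \<le> ln t1 + ln (u (x0 + x) \<xi>)"
        using upos[OF t1, of "x0 + x"] upos[OF \<xi>', of "x0 + x"] \<xi> t by (simp add: ln_mult)
      moreover have "ln t0 \<le> ln \<xi>" using \<xi> t by (intro ln_mono) auto
      ultimately show "ln (u (x0 + x) t1) - ln (t1 / t0) \<le> ln (u (x0 + x) \<xi>)" using t by (simp add: ln_div)
    qed
    moreover have "(LINT x|lborel. bump \<sigma> x * (ln (u (x0 + x) t1) - ln (t1 / t0)))
       = (LINT x|lborel. bump \<sigma> x * ln (u (x0 + x) t1)) - bump_mass * ln (t1 / t0)"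
      unfolding right_diff_distrib bump_integral_const[OF \<sigma>(1), symmetric]
      by (rule Bochner_Integration.integral_diff)
         (intro integrable_bump_mult \<sigma>(1) shifted_continuous[OF continuous_ln_u[OF t1]] continuous_on_const)+
    ultimately show ?thesis using \<sigma>(3) bump_mass_pos by (simp add: right_diff_distrib)
  qed
  have "q t1 - q t0 \<le> (t1 - t0) * (Q - (bump_mass * (ln (u x0 t1) - ln (t1 / t0)) - e))"
    unfolding \<xi>(3) mean_value_ln_u[OF \<xi>' \<sigma>(1,2)] using low Q[of \<xi>] \<xi> t by (intro mult_left_mono) auto
  then have "(t1 - t0) * (bump_mass * (ln (u x0 t1) - ln (t1 / t0)) - e - Q) \<le> 2 * (T - t0) ^ 3 / k2 * (bump_mass * r\<^sup>2 / 6)"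
    using q1 q0 by (simp add: algebra_simps)
  then have "bump_mass * (ln (u x0 t1) - ln (t1 / t0)) - e - Q \<le> 2 * (T - t0) ^ 3 / k2 * (bump_mass * r\<^sup>2 / 6) / (t1 - t0)"
  proof -
    have "X \<le> Y / d" if "d * X \<le> Y" "d > 0" for X Y d :: real
      using that by (simp add: pos_le_divide_eq mult.commute)
    then show "(t1 - t0) * X \<le> Y \<Longrightarrow> X \<le> Y / (t1 - t0)" for X Y using t by simp
  qed
  then show "bump_mass * (ln (u x0 t1) - ln (t1 / t0)) \<le> Q + 2 * (T - t0) ^ 3 / k2 * (bump_mass * r\<^sup>2 / 6) / (t1 - t0) + e" by linarith
qed

text \<open>Where \<open>p * norm x\<close> exceeds \<open>\<rho>0\<close>, both functions are at
  most \<open>\<epsilon> * p ^ 3\<close>. Elsewhere their logarithms are compared with a tolerance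
  \<open>e\<close>. The upper bound spends it in five parts of \<open>e / 5\<close>: the change of
  time \<open>\<tau>\<close>, the displacement \<open>\<rho>\<close>, the gap in the mean, the
  integrated Laplacian and the loss \<open>ln (t / t0)\<close>.\<close>

lemma uniform_gap:
  assumes k0: "k0 > 0" and \<epsilon>: "\<epsilon> > 0"
    and mass: "\<And>t. t \<in> {0<..<T} \<Longrightarrow> (LINT x|lborel. u x t - bb k0 (T - t) x) = 0"
  obtains t1 where "t1 \<in> {0<..<T}" "\<And>t x. t1 \<le> t \<Longrightarrow> t < T \<Longrightarrow> \<bar>u x t - bb k0 (T - t) x\<bar> \<le> \<epsilon> * (T - t) ^ 3"
proof -
  define \<kappa> where "\<kappa> = min k0 k2"
  have \<kappa>: "\<kappa> > 0" "\<kappa> \<le> k0" "\<kappa> \<le> k2" unfolding \<kappa>_def using k0 k by auto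
  \<comment> \<open>The logarithmic tolerance: \<open>2 * p ^ 3 / \<kappa>\<close> bounds both
    functions, and times \<open>e\<close> it is \<open>\<epsilon> * p ^ 3\<close>.\<close>
  define e where "e = \<epsilon> * \<kappa> / 2"
  have e: "e > 0" unfolding e_def using \<epsilon> \<kappa> by simp
  define \<rho>0 where "\<rho>0 = 1 + 2 / \<epsilon>"
  have \<rho>0: "\<rho>0 \<ge> 1" "2 / \<rho>0\<^sup>2 \<le> \<epsilon>"
  proof -
    show 1: "\<rho>0 \<ge> 1" unfolding \<rho>0_def using \<epsilon> by simp
    have "2 / \<epsilon> \<le> \<rho>0" unfolding \<rho>0_def by simp
    also have "\<dots> \<le> \<rho>0\<^sup>2" using 1 by (simp add: power2_eq_square)
    finally show "2 / \<rho>0\<^sup>2 \<le> \<epsilon>" using 1 \<epsilon> by (simp add: field_simps)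
  qed
  define L where "L = 3 + (2 + \<rho>0) * (3 * \<rho>0 + 2) / k0"
  have L: "L > 0" unfolding L_def using \<rho>0 k0 by (intro add_pos_nonneg) auto
  \<comment> \<open>The margin \<open>2 * \<rho>0 + 2\<close> leaves room for earlier times, at
    which the remaining time may be up to twice as long.\<close>
  obtain C where C: "C > 0" "\<And>t x0 r. t \<in> {0<..<T} \<Longrightarrow> r > 0 \<Longrightarrow> (T - t) * (norm x0 + r) \<le> 2 * \<rho>0 + 2 \<Longrightarrow>
    \<bar>(LINT x|lborel. bump r x * ln (u (x0 + x) t)) - (LINT x|lborel. bump r x * ln (bb k0 (T - t) (x0 + x)))\<bar>
     \<le> C / (r * (T - t)) ^ 3 * L1_gap k0 t"
    by (rule bump_ln_gap[OF k0]) blast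
  let ?m = bump_mass
  have m: "?m > 0" by (rule bump_mass_pos)
  define \<tau> where "\<tau> = min 1 (e / (5 * L))"
  have \<tau>: "0 < \<tau>" "\<tau> \<le> 1" "L * \<tau> \<le> e / 5"
  proof -
    show "0 < \<tau>" "\<tau> \<le> 1" unfolding \<tau>_def using e L by auto
    have "L * \<tau> \<le> L * (e / (5 * L))" unfolding \<tau>_def using L by (intro mult_left_mono) auto
    then show "L * \<tau> \<le> e / 5" using L by simp
  qed
  \<comment> \<open>The last entry makes the error of \<open>ln_u_upper\<close>, namely
    \<open>8 / (3 * k2) * \<rho>\<^sup>2 / \<tau>\<close>, at most \<open>e / 5\<close>; therefore
    \<open>\<rho>\<close> is chosen after \<open>\<tau>\<close>.\<close>
  define \<rho> where "\<rho> = min 1 (min (e / (5 * L)) (3 * k2 * \<tau> * e / 40))"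
  have \<rho>: "0 < \<rho>" "\<rho> \<le> 1" "L * \<rho> \<le> e / 5" "8 / (3 * k2) * \<rho>\<^sup>2 / \<tau> \<le> e / 5"
  proof -
    show r0: "0 < \<rho>" "\<rho> \<le> 1" unfolding \<rho>_def using e L k \<tau> by auto
    have "L * \<rho> \<le> L * (e / (5 * L))" unfolding \<rho>_def using L by (intro mult_left_mono) auto
    then show "L * \<rho> \<le> e / 5" using L by simp
    have "\<rho>\<^sup>2 \<le> \<rho>" using r0 by (simp add: power2_eq_square mult_left_le_one_le)
    also have "\<dots> \<le> 3 * k2 * \<tau> * e / 40" unfolding \<rho>_def by simp
    finally have "8 / (3 * k2) * \<rho>\<^sup>2 / \<tau> \<le> 8 / (3 * k2) * (3 * k2 * \<tau> * e / 40) / \<tau>"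
      using k \<tau> by (intro divide_right_mono mult_left_mono) auto
    also have "\<dots> = e / 5" using k \<tau> by simp
    finally show "8 / (3 * k2) * \<rho>\<^sup>2 / \<tau> \<le> e / 5" .
  qed
  \<comment> \<open>Chosen so that \<open>C / \<rho> ^ 3 * l = bump_mass * (e / 5)\<close>, where
    \<open>\<rho>\<close> will be the rescaled radius \<open>p * r\<close>.\<close>
  define l where "l = e * ?m * \<rho> ^ 3 / (5 * C)"
  have l: "l > 0" unfolding l_def using e m \<rho> C by simp
  obtain tl where tl: "tl \<in> {0<..<T}" "\<And>t. tl \<le> t \<Longrightarrow> t < T \<Longrightarrow> L1_gap k0 t \<le> l"
    by (rule L1_gap_tends_to_zero[OF k0 l mass]) blast+
  \<comment> \<open>In order, the entries keep \<open>t0\<close> above \<open>T / 2\<close>, keep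
    \<open>t0\<close> above \<open>tl\<close>, make the loss \<open>ln (t / t0)\<close> at most
    \<open>e / 5\<close>, and do the same for the error of \<open>ln_u_lower\<close>.\<close>
  define \<zeta> where "\<zeta> = min (T / 4) (min ((T - tl) / 2) (min (e * T / 10) (3 * k2 * T * e / 10)))"
  have \<zeta>: "\<zeta> > 0" "\<zeta> \<le> T / 4" "\<zeta> \<le> (T - tl) / 2" "\<zeta> \<le> e * T / 10" "\<zeta> \<le> 3 * k2 * T * e / 10"
  proof -
    show "\<zeta> > 0" unfolding \<zeta>_def using T tl e k by auto
    show "\<zeta> \<le> T / 4" "\<zeta> \<le> (T - tl) / 2" "\<zeta> \<le> e * T / 10" "\<zeta> \<le> 3 * k2 * T * e / 10"
    proof -
      have m4: "min a (min b (min c d)) \<le> a" "min a (min b (min c d)) \<le> b" "min a (min b (min c d)) \<le> c" "min a (min b (min c d)) \<le> d"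
        for a b c d :: real by linarith+
      show "\<zeta> \<le> T / 4" "\<zeta> \<le> (T - tl) / 2" "\<zeta> \<le> e * T / 10" "\<zeta> \<le> 3 * k2 * T * e / 10"
        unfolding \<zeta>_def by (rule m4)+
    qed
  qed
  show ?thesis
  proof (rule that[of "T - \<zeta>"])
    show "T - \<zeta> \<in> {0<..<T}" using \<zeta> T by auto
    fix t and x :: "real^3" assume t: "T - \<zeta> \<le> t" "t < T"
    define p where "p = T - t"
    have p: "0 < p" "p \<le> \<zeta>" using t unfolding p_def by auto
    have tT: "t \<in> {0<..<T}" "T / 2 \<le> t" using t \<zeta> T by auto
    define B where "B = bb k0 p x"
    have B: "B > 0" unfolding B_def by (rule bb_pos[OF k0 p(1)])
    have ux: "u x t > 0" by (rule upos[OF tT(1)])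
    show "\<bar>u x t - bb k0 (T - t) x\<bar> \<le> \<epsilon> * (T - t) ^ 3"
    proof (cases "p * norm x \<le> \<rho>0")
      case False
      then have x0: "x \<noteq> 0" using \<rho>0 by auto
      have far: "2 * p / (norm x)\<^sup>2 \<le> \<epsilon> * p ^ 3"
      proof -
        have "\<rho>0\<^sup>2 \<le> (p * norm x)\<^sup>2" using False \<rho>0 by (intro power_mono) auto
        then have "2 / (p * norm x)\<^sup>2 \<le> 2 / \<rho>0\<^sup>2" using \<rho>0 p x0 by (intro divide_left_mono mult_pos_pos zero_less_power) auto
        then have "p ^ 3 * (2 / (p * norm x)\<^sup>2) \<le> p ^ 3 * \<epsilon>" using \<rho>0 p by (intro mult_left_mono) auto
        moreover have "p ^ 3 * (2 / (p * norm x)\<^sup>2) = 2 * p / (norm x)\<^sup>2"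
          using p by (simp add: power_mult_distrib power2_eq_square power3_eq_cube)
        ultimately show ?thesis by (simp add: mult.commute)
      qed
      have "u x t \<le> 2 * p / (norm x)\<^sup>2"
        using trap(2)[OF tT(1), of x] bb_le_inverse_square[OF k(1) p(1) x0] unfolding p_def by linarith
      moreover have "B \<le> 2 * p / (norm x)\<^sup>2" unfolding B_def by (rule bb_le_inverse_square[OF k0 p(1) x0])
      ultimately have "\<bar>u x t - B\<bar> \<le> 2 * p / (norm x)\<^sup>2" using B ux by linarith
      then show ?thesis using far unfolding B_def p_def by linarith
    next
      case True
      define r where "r = \<rho> / p"
      have r: "r > 0" "p * r = \<rho>" unfolding r_def using \<rho> p by auto
      have C\<rho>: "C / \<rho> ^ 3 * l = ?m * (e / 5)" unfolding l_def using C \<rho> by simp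
      have r2: "p\<^sup>2 * r\<^sup>2 = \<rho>\<^sup>2" using r(2) by (simp flip: power_mult_distrib)
      have low: "ln B - e \<le> ln (u x t)"
      proof -
        have "(T - t) * (norm x + r) \<le> 2 * \<rho>0 + 2"
          using True r(2) \<rho> \<rho>0 unfolding p_def[symmetric] by (simp add: distrib_left)
        from C(2)[OF tT(1) r(1) this]
        have "(LINT y|lborel. bump r y * ln (bb k0 p (x + y))) - C / \<rho> ^ 3 * L1_gap k0 t \<le> (LINT y|lborel. bump r y * ln (u (x + y) t))"
          unfolding p_def[symmetric] mult.commute[of r p] r(2) by linarith
        moreover have "C / \<rho> ^ 3 * L1_gap k0 t \<le> C / \<rho> ^ 3 * l"
          using tl(2)[of t] t \<zeta> C \<rho> by (intro mult_left_mono) auto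
        moreover have "?m * (ln B - L * \<rho>) \<le> (LINT y|lborel. bump r y * ln (bb k0 p (x + y)))"
          unfolding bump_integral_const[OF r(1), symmetric]
        proof (rule bump_integral_mono[OF r(1)])
          show "continuous_on UNIV (\<lambda>y. ln (bb k0 p (x + y)))" by (rule shifted_continuous[OF continuous_ln_bb[OF k0 p(1)]])
          fix y :: "real^3" assume y: "norm y \<le> r"
          have "p * norm y \<le> \<rho>" using mult_left_mono[OF y, of p] p r(2) by simp
          then have "\<bar>ln (bb k0 p (x + y)) - ln (bb k0 p x)\<bar> \<le> L * (0 + \<rho>)"
            unfolding L_def using True \<rho> p by (intro ln_bb_close k0) auto
          then show "ln B - L * \<rho> \<le> ln (bb k0 p (x + y))" unfolding B_def by (simp add: abs_le_iff)
        qed simp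
        moreover have "(LINT y|lborel. bump r y * ln (u (x + y) t)) - 2 * p ^ 3 / k2 / t * (?m * r\<^sup>2 / 6) \<le> ?m * ln (u x t)"
          using ln_u_lower[OF tT(1) r(1), of x] unfolding p_def .
        moreover have "2 * p ^ 3 / k2 / t * (?m * r\<^sup>2 / 6) \<le> ?m * (e / 5)"
        proof -
          have "2 * p ^ 3 / k2 / t * (?m * r\<^sup>2 / 6) = ?m * (p * (p\<^sup>2 * r\<^sup>2) / (3 * k2 * t))"
            by (simp add: power2_eq_square power3_eq_cube)
          also have "\<dots> = ?m * (p * \<rho>\<^sup>2 / (3 * k2 * t))" unfolding r2 ..
          also have "\<dots> \<le> ?m * (\<zeta> * 1 / (3 * k2 * (T / 2)))"
            using m p \<zeta> \<rho> k tT T by (intro mult_left_mono frac_le mult_mono) (auto simp: power_le_one)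
          also have "\<dots> \<le> ?m * ((3 * k2 * T * e / 10) * 1 / (3 * k2 * (T / 2)))"
            using m \<zeta> k T by (intro mult_left_mono divide_right_mono) auto
          also have "\<dots> = ?m * (e / 5)" using k T by simp
          finally show ?thesis .
        qed
        ultimately have "?m * (ln B - L * \<rho>) - ?m * (e / 5) - ?m * (e / 5) \<le> ?m * ln (u x t)" unfolding C\<rho> by linarith
        then have "?m * (ln B - L * \<rho> - e / 5 - e / 5) \<le> ?m * ln (u x t)" by (simp add: algebra_simps)
        then have "ln B - L * \<rho> - e / 5 - e / 5 \<le> ln (u x t)" using m by simp
        then show ?thesis using \<rho>(3) e by linarith
      qed
      have up: "ln (u x t) \<le> ln B + e"
      proof -
        \<comment> \<open>A window proportional to the remaining time: over it the remaining time
          changes by the factor \<open>1 + \<tau>\<close> at most, yet it is long enough for the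
          mean Laplacian over it to be harmless.\<close>
        define t0 where "t0 = t - \<tau> * p"
        have "\<tau> * p \<le> 1 * p" using \<tau> p by (intro mult_right_mono) auto
        then have "t - p \<le> t0" unfolding t0_def by simp
        moreover have "T - 2 * \<zeta> \<le> t - p" using t p by linarith
        ultimately have t0: "0 < t0" "tl \<le> t0" "T / 2 \<le> t0" using \<zeta> T by auto
        have t0t: "t0 < t" unfolding t0_def using \<tau> p by simp
        have Tt0: "T - t0 = (1 + \<tau>) * p" unfolding t0_def p_def by (simp add: algebra_simps)
        have p2: "(1 + \<tau>) * p \<le> 2 * p" using \<tau> p by (intro mult_right_mono) auto
        define Q where "Q = ?m * (ln B + L * (\<tau> + \<rho>)) + ?m * (e / 5)"
        have Q: "(LINT y|lborel. bump r y * ln (u (x + y) s)) \<le> Q" if s: "t0 \<le> s" "s \<le> t" for s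
        proof -
          define q where "q = T - s"
          have sT: "s \<in> {0<..<T}" using s t0 t by auto
          have q: "p \<le> q" "q \<le> (1 + \<tau>) * p" "q > 0" using s Tt0 p unfolding p_def q_def by auto
          have q2: "q \<le> 2 * p" using q p2 by linarith
          have "q * (norm x + r) \<le> (2 * p) * (norm x + r)" using q2 r by (intro mult_right_mono) auto
          also have "\<dots> \<le> 2 * \<rho>0 + 2" using True r(2) \<rho> by (simp add: distrib_left)
          finally have cond: "(T - s) * (norm x + r) \<le> 2 * \<rho>0 + 2" unfolding q_def .
          have "C / (r * q) ^ 3 * L1_gap k0 s \<le> C / \<rho> ^ 3 * l"
          proof (rule mult_mono)
            have "\<rho> \<le> r * q" using mult_right_mono[OF q(1), of r] r by (simp add: mult.commute)
            then show "C / (r * q) ^ 3 \<le> C / \<rho> ^ 3"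
              using C \<rho> r q by (intro divide_left_mono power_mono mult_pos_pos zero_less_power) auto
            show "L1_gap k0 s \<le> l" using tl(2)[of s] s t0 t by auto
            show "0 \<le> L1_gap k0 s" unfolding L1_gap_def by (intro integral_nonneg_AE) auto
          qed (use C \<rho> in auto)
          moreover have "(LINT y|lborel. bump r y * ln (bb k0 q (x + y))) \<le> ?m * (ln B + L * (\<tau> + \<rho>))"
            unfolding bump_integral_const[OF r(1), symmetric]
          proof (rule bump_integral_mono[OF r(1)])
            show "continuous_on UNIV (\<lambda>y. ln (bb k0 q (x + y)))" by (rule shifted_continuous[OF continuous_ln_bb[OF k0 q(3)]])
            fix y :: "real^3" assume y: "norm y \<le> r"
            have "p * norm y \<le> \<rho>" using mult_left_mono[OF y, of p] p r(2) by simp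
            then have "\<bar>ln (bb k0 q (x + y)) - ln (bb k0 p x)\<bar> \<le> L * (\<tau> + \<rho>)"
              unfolding L_def using True \<rho> p q \<tau> by (intro ln_bb_close k0) auto
            then show "ln (bb k0 q (x + y)) \<le> ln B + L * (\<tau> + \<rho>)" unfolding B_def by (simp add: abs_le_iff)
          qed simp
          ultimately show ?thesis using C(2)[OF sT r(1) cond] C\<rho> unfolding Q_def q_def[symmetric] by linarith
        qed
        have "?m * (ln (u x t) - ln (t / t0)) \<le> Q + 2 * (T - t0) ^ 3 / k2 * (?m * r\<^sup>2 / 6) / (t - t0)"
          by (rule ln_u_upper[OF t0(1) t0t t(2) r(1) Q])
        also have "2 * (T - t0) ^ 3 / k2 * (?m * r\<^sup>2 / 6) / (t - t0) \<le> ?m * (e / 5)"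
        proof -
          have "(T - t0) ^ 3 \<le> (2 * p) ^ 3" unfolding Tt0 using p2 \<tau> p by (intro power_mono) auto
          then have "2 * (T - t0) ^ 3 / k2 * (?m * r\<^sup>2 / 6) / (t - t0) \<le> 2 * (2 * p) ^ 3 / k2 * (?m * r\<^sup>2 / 6) / (t - t0)"
            using k m t0t by (intro divide_right_mono mult_right_mono mult_left_mono) auto
          also have "2 * (2 * p) ^ 3 / k2 * (?m * r\<^sup>2 / 6) / (t - t0) = ?m * (8 / (3 * k2) * (p\<^sup>2 * r\<^sup>2) / \<tau>)"
            using p \<tau> by (simp add: t0_def power2_eq_square power3_eq_cube)
          also have "\<dots> \<le> ?m * (e / 5)" unfolding r2 using \<rho>(4) m by (intro mult_left_mono) auto
          finally show ?thesis .
        qed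
        finally have "?m * (ln (u x t) - ln (t / t0)) \<le> ?m * (ln B + L * (\<tau> + \<rho>) + e / 5 + e / 5)"
          unfolding Q_def by (simp add: algebra_simps)
        then have "ln (u x t) - ln (t / t0) \<le> ln B + L * (\<tau> + \<rho>) + e / 5 + e / 5" using m by simp
        moreover have "ln (t / t0) \<le> e / 5"
        proof -
          have "ln (t / t0) \<le> t / t0 - 1" using t0 t0t by (intro ln_le_minus_one) auto
          also have "\<dots> = \<tau> * p / t0" using t0 unfolding t0_def by (simp add: field_simps)
          also have "\<dots> \<le> 1 * \<zeta> / (T / 2)" using \<tau> p t0 T by (intro frac_le mult_mono) auto
          also have "\<dots> \<le> (e * T / 10) / (T / 2)" using \<zeta> T by (intro divide_right_mono) auto
          also have "\<dots> = e / 5" using T by simp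
          finally show ?thesis .
        qed
        moreover have "L * (\<tau> + \<rho>) \<le> e / 5 + e / 5" using \<tau>(3) \<rho>(3) by (simp add: distrib_left)
        ultimately show ?thesis by linarith
      qed
      have "\<bar>u x t - B\<bar> \<le> 2 * p ^ 3 / \<kappa> * \<bar>ln (u x t) - ln B\<bar>"
      proof (rule abs_diff_le_ln[OF ux B])
        have "u x t \<le> 2 * p ^ 3 / k2" using u_le_const[OF tT(1)] unfolding p_def .
        also have "\<dots> \<le> 2 * p ^ 3 / \<kappa>" using \<kappa> p k by (intro divide_left_mono) auto
        finally show "u x t \<le> 2 * p ^ 3 / \<kappa>" .
        have "B \<le> 2 * p ^ 3 / k0" unfolding B_def by (rule bb_le_const[OF k0 p(1)])
        also have "\<dots> \<le> 2 * p ^ 3 / \<kappa>" using \<kappa> p k0 by (intro divide_left_mono) auto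
        finally show "B \<le> 2 * p ^ 3 / \<kappa>" .
      qed
      also have "\<dots> \<le> 2 * p ^ 3 / \<kappa> * e" using low up p \<kappa> by (intro mult_left_mono) (auto simp: abs_le_iff)
      also have "\<dots> = \<epsilon> * p ^ 3" unfolding e_def using \<kappa> by simp
      finally show ?thesis unfolding B_def p_def .
    qed
  qed
qed

end

section \<open>The mass constant and the passage to the rescaled functions\<close>

lemma locally_integrable_measurable:
  fixes f :: "'a::euclidean_space \<Rightarrow> real"
  assumes "locally_integrable f"
  shows "f \<in> borel_measurable lebesgue"
proof (rule borel_measurable_LIMSEQ_real)
  fix n
  have "set_integrable lebesgue (cball 0 (real n)) f" using assms compact_cball unfolding locally_integrable_def by blast
  then show "(\<lambda>x. indicator (cball 0 (real n)) x * f x) \<in> borel_measurable lebesgue"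
    unfolding set_integrable_def by auto
next
  fix x :: 'a
  obtain N where N: "norm x \<le> real N" using real_arch_simple by blast
  have "\<forall>\<^sub>F n in sequentially. indicator (cball 0 (real n)) x * f x = f x"
    unfolding eventually_sequentially using N by (intro exI[of _ N]) (auto simp: indicator_def)
  then show "(\<lambda>n. indicator (cball 0 (real n)) x * f x) \<longlonglongrightarrow> f x" by (rule tendsto_eventually)
qed

lemma bb_diff:
  assumes "k > 0" "k' > 0"
  shows "bb k p x - bb k' p x = 2 * p ^ 3 * (k' - k) * (1 / ((k + p\<^sup>2 * (norm x)\<^sup>2) * (k' + p\<^sup>2 * (norm x)\<^sup>2)))"
  using pos_quad[OF assms(1), of "p\<^sup>2" x] pos_quad[OF assms(2), of "p\<^sup>2" x]
  unfolding bb_def by (simp add: divide_simps) (simp add: algebra_simps)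

text \<open>The integral of \<open>u0 - bb k T\<close> is strictly increasing in \<open>k\<close>,
  Lipschitz for \<open>k \<ge> k2\<close>, and changes sign between \<open>k2\<close> and
  \<open>k1\<close>. The condition is phrased with \<open>has_bochner_integral\<close>, so that the
  value 0 cannot stem from the convention for functions that are not integrable.\<close>

lemma unique_mass_constant:
  fixes u0 :: "real^3 \<Rightarrow> real"
  assumes T: "T > 0" and k: "k2 > 0" "k1 > k2"
    and u0: "\<And>x. bb k1 T x \<le> u0 x" "\<And>x. u0 x \<le> bb k2 T x" and m: "u0 \<in> borel_measurable lebesgue"
  shows "\<exists>!k0. k0 > 0 \<and> has_bochner_integral lebesgue (\<lambda>x. u0 x - bb k0 T x) 0"
proof -
  have mb: "(\<lambda>x::real^3. bb k T x) \<in> borel_measurable lebesgue" if "k > 0" for k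
    by (intro measurable_completion lborel_of_continuous continuous_on_bb that)
  have dec: "integrable lebesgue (\<lambda>x::real^3. 1 / (k + T\<^sup>2 * (norm x)\<^sup>2)\<^sup>2)" if "k > 0" for k
    using integrable_inverse_quartic_scaled[OF that, of "T\<^sup>2"] T by (simp add: integrable_completion)
  have int: "integrable lebesgue (\<lambda>x. u0 x - bb k0 T x)" if k0: "k0 > 0" for k0
  proof (rule Bochner_Integration.integrable_bound)
    show "integrable lebesgue (\<lambda>x::real^3. 2 * T ^ 3 * (k0 + k1) * (1 / (min k0 k2 + T\<^sup>2 * (norm x)\<^sup>2)\<^sup>2))"
      using k0 k by (intro integrable_mult_right dec) auto
    show "(\<lambda>x. u0 x - bb k0 T x) \<in> borel_measurable lebesgue" by (intro borel_measurable_diff m mb k0)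
    show "AE x in lebesgue. norm (u0 x - bb k0 T x) \<le> norm (2 * T ^ 3 * (k0 + k1) * (1 / (min k0 k2 + T\<^sup>2 * (norm x)\<^sup>2)\<^sup>2))"
    proof (rule AE_I2)
      fix x
      show "norm (u0 x - bb k0 T x) \<le> norm (2 * T ^ 3 * (k0 + k1) * (1 / (min k0 k2 + T\<^sup>2 * (norm x)\<^sup>2)\<^sup>2))"
        using order_trans[OF sandwich(4)[OF k0 k(1) less_imp_le[OF k(2)] T u0, of x] abs_ge_self] by simp
    qed
  qed
  define F where "F k = (LINT x|lebesgue. u0 x - bb k T x)" for k
  have hb: "has_bochner_integral lebesgue (\<lambda>x. u0 x - bb k0 T x) 0 \<longleftrightarrow> F k0 = 0" if "k0 > 0" for k0
    using int[OF that] unfolding F_def by (auto simp: has_bochner_integral_iff)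
  have mono: "F k < F k'" if "0 < k" "k < k'" for k k'
  proof (rule ccontr)
    let ?G = "\<lambda>x::real^3. bb k T x - bb k' T x"
    assume "\<not> F k < F k'"
    have G: "?G x > 0" for x
      using that T by (subst bb_diff) (auto intro!: mult_pos_pos divide_pos_pos pos_quad)
    have eq: "?G = (\<lambda>x. (u0 x - bb k' T x) - (u0 x - bb k T x))" by auto
    have iG: "integrable lebesgue ?G" unfolding eq using that by (intro Bochner_Integration.integrable_diff[OF int int]) linarith+
    have "(LINT x|lebesgue. ?G x) = F k' - F k"
      unfolding eq F_def using that by (intro Bochner_Integration.integral_diff[OF int int]) linarith+
    moreover have "0 \<le> (LINT x|lebesgue. ?G x)" using G by (intro integral_nonneg_AE) (auto simp: less_imp_le)
    ultimately have "(LINT x|lebesgue. ?G x) = 0" using \<open>\<not> F k < F k'\<close> by linarith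
    \<comment> \<open>\<open>?G\<close> is positive everywhere, so a vanishing integral would make
      the whole space a null set.\<close>
    then have "AE x in lebesgue. ?G x = 0"
      using iG G by (subst (asm) integral_nonneg_eq_0_iff_AE) (auto simp: less_imp_le)
    then have "AE x::real^3 in lebesgue. False"
      by eventually_elim (use G in \<open>metis less_irrefl\<close>)
    then have "emeasure lebesgue (space (lebesgue :: (real^3) measure)) = 0"
      by (simp add: eventually_False ae_filter_eq_bot_iff)
    then show False by (simp add: emeasure_lborel_UNIV)
  qed
  define J where "J = (LINT x::real^3|lebesgue. 1 / (k2 + T\<^sup>2 * (norm x)\<^sup>2)\<^sup>2)"
  have lip: "\<bar>F k - F k'\<bar> \<le> 2 * T ^ 3 * J * \<bar>k - k'\<bar>" if kk: "k2 \<le> k" "k2 \<le> k'" for k k'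
  proof -
    have "F k - F k' = (LINT x|lebesgue. (u0 x - bb k T x) - (u0 x - bb k' T x))"
      unfolding F_def using int kk k by (intro Bochner_Integration.integral_diff[symmetric]) auto
    moreover have "\<bar>LINT x|lebesgue. (u0 x - bb k T x) - (u0 x - bb k' T x)\<bar>
      \<le> (LINT x::real^3|lebesgue. 2 * T ^ 3 * \<bar>k - k'\<bar> * (1 / (k2 + T\<^sup>2 * (norm x)\<^sup>2)\<^sup>2))"
    proof (rule abs_integral_le[OF integrable_mult_right[OF dec[OF k(1)]]])
      fix x :: "real^3"
      have pk: "k > 0" "k' > 0" using kk k by auto
      have "1 / ((k + T\<^sup>2 * (norm x)\<^sup>2) * (k' + T\<^sup>2 * (norm x)\<^sup>2)) \<le> 1 / (k2 + T\<^sup>2 * (norm x)\<^sup>2)\<^sup>2"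
        unfolding power2_eq_square[of "k2 + _"] using pos_quad[OF k(1), of "T\<^sup>2" x] pos_quad[OF pk(1), of "T\<^sup>2" x] pos_quad[OF pk(2), of "T\<^sup>2" x] kk
        by (intro divide_left_mono mult_mono mult_pos_pos) auto
      then have "2 * T ^ 3 * \<bar>k - k'\<bar> * (1 / ((k + T\<^sup>2 * (norm x)\<^sup>2) * (k' + T\<^sup>2 * (norm x)\<^sup>2))) \<le> 2 * T ^ 3 * \<bar>k - k'\<bar> * (1 / (k2 + T\<^sup>2 * (norm x)\<^sup>2)\<^sup>2)"
        using T by (intro mult_left_mono) auto
      moreover have "\<bar>(u0 x - bb k T x) - (u0 x - bb k' T x)\<bar> = \<bar>bb k' T x - bb k T x\<bar>" by simp
      moreover have "\<dots> = 2 * T ^ 3 * \<bar>k - k'\<bar> * (1 / ((k + T\<^sup>2 * (norm x)\<^sup>2) * (k' + T\<^sup>2 * (norm x)\<^sup>2)))"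
        unfolding bb_diff[OF pk(2,1)] abs_mult using T pos_quad[OF pk(1), of "T\<^sup>2" x] pos_quad[OF pk(2), of "T\<^sup>2" x]
        by (simp add: mult.commute)
      ultimately show "\<bar>(u0 x - bb k T x) - (u0 x - bb k' T x)\<bar> \<le> 2 * T ^ 3 * \<bar>k - k'\<bar> * (1 / (k2 + T\<^sup>2 * (norm x)\<^sup>2)\<^sup>2)" by linarith
    qed
    moreover have "(LINT x::real^3|lebesgue. 2 * T ^ 3 * \<bar>k - k'\<bar> * (1 / (k2 + T\<^sup>2 * (norm x)\<^sup>2)\<^sup>2)) = 2 * T ^ 3 * J * \<bar>k - k'\<bar>"
      unfolding J_def integral_mult_right_zero by simp
    ultimately show ?thesis by simp
  qed
  have "continuous_on {k2..k1} F"
  proof (rule lipschitz_on_continuous_on[of "2 * T ^ 3 * J"], rule lipschitz_onI)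
    show "0 \<le> 2 * T ^ 3 * J" unfolding J_def using T by (intro mult_nonneg_nonneg integral_nonneg_AE) auto
  qed (use lip in \<open>auto simp: dist_real_def\<close>)
  moreover have "F k2 \<le> 0"
  proof -
    have "F k2 = - (LINT x|lebesgue. bb k2 T x - u0 x)"
      unfolding F_def by (subst Bochner_Integration.integral_minus[symmetric]) simp
    moreover have "0 \<le> (LINT x|lebesgue. bb k2 T x - u0 x)" using u0(2) by (intro integral_nonneg_AE) auto
    ultimately show ?thesis by linarith
  qed
  moreover have "F k1 \<ge> 0" unfolding F_def using u0(1) by (intro integral_nonneg_AE) auto
  ultimately obtain k0 where k0: "k2 \<le> k0" "F k0 = 0"
    using IVT'[of F k2 0 k1] k by auto
  show ?thesis
  proof (rule ex1I[of _ k0])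
    show "k0 > 0 \<and> has_bochner_integral lebesgue (\<lambda>x. u0 x - bb k0 T x) 0" using k0 k hb[of k0] by auto
    fix k' assume "k' > 0 \<and> has_bochner_integral lebesgue (\<lambda>x. u0 x - bb k' T x) 0"
    then have "k' > 0" "F k' = 0" using hb by auto
    then show "k' = k0" using mono[of k' k0] mono[of k0 k'] k0 k by (cases k' k0 rule: linorder_cases) auto
  qed
qed

lemma has_dd_pderiv_dir:
  assumes "\<And>x. pdiff_dir b f x"
  shows "has_dd f b (pderiv_dir b f)"
  using assms unfolding has_dd_def pdiff_dir_def pderiv_dir_def
  by (simp add: DERIV_deriv_iff_real_differentiable)

lemma pderiv_dir_eq: "has_dd f b f' \<Longrightarrow> pderiv_dir b f = f'"
  unfolding has_dd_def pderiv_dir_def by (auto intro!: DERIV_imp_deriv)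

text \<open>In dimension 3 the exponents \<open>N / (N - 2)\<close> and \<open>1 / (N - 2)\<close>
  are 3 and 1.\<close>

lemma rescaled_eq: "rescaled T u (x :: real^3) s = u ((1 / exp (- s)) *\<^sub>R x) (T - exp (- s)) / exp (- s) ^ 3"
  unfolding rescaled_def by (simp add: Let_def divide_inverse)

lemma rescaled_barenblatt_eq:
  "rescaled_barenblatt k (x :: real^3) = bb k (exp (- s)) ((1 / exp (- s)) *\<^sub>R x) / exp (- s) ^ 3"
  using bb_scale[of "exp (- s)" k x] unfolding rescaled_barenblatt_def bb_def by simp

theorem theorem1p1:
  fixes u :: "real^3 \<Rightarrow> real \<Rightarrow> real" and u0 :: "real^3 \<Rightarrow> real" and T k1 k2 :: real
  assumes "T > 0"
    and "k1 > k2" and "k2 > 0"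
    and "\<forall>x. barenblatt T k1 x 0 \<le> u0 x \<and> u0 x \<le> barenblatt T k2 x 0"
    and "log_diffusion_solution T u0 u"
    and "\<forall>x. \<forall>t\<in>{0<..<T}. barenblatt T k1 x t \<le> u x t \<and> u x t \<le> barenblatt T k2 x t"
  shows "(\<exists>!k0. k0 > 0 \<and> has_bochner_integral lebesgue (\<lambda>x. u0 x - barenblatt T k0 x 0) 0) \<and>
    (\<forall>k0 > 0. has_bochner_integral lebesgue (\<lambda>x. u0 x - barenblatt T k0 x 0) 0 \<longrightarrow>
       uniform_limit UNIV (\<lambda>s x. rescaled T u x s) (rescaled_barenblatt k0) at_top \<and>
       tendsto_L1 lebesgue (\<lambda>s x. rescaled T u x s) (rescaled_barenblatt k0) at_top)"
proof -
  have b0: "barenblatt T k (x :: real^3) 0 = bb k T x" for k x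
    using barenblatt_eq_bb[of 0 T k x] assms(1) by simp
  have sol: "locally_integrable u0" "\<And>x t. t \<in> {0<..<T} \<Longrightarrow> 0 < u x t" "C21 T u"
    "\<And>x t. t \<in> {0<..<T} \<Longrightarrow> deriv (u x) t = laplacian (\<lambda>y. ln (u y t)) x"
    "tendsto_L1_loc (\<lambda>t x. u x t) u0 (at_right 0)"
    using assms(5) unfolding log_diffusion_solution_def by auto
  let ?g = "\<lambda>b x t. pderiv_dir b (\<lambda>y. u y t) x"
  let ?H = "\<lambda>b x t. pderiv_dir b (pderiv_dir b (\<lambda>y. u y t)) x"
  have dx: "has_dd (\<lambda>x. u x t) b (\<lambda>x. ?g b x t)" and dxx: "has_dd (\<lambda>x. ?g b x t) b (\<lambda>x. ?H b x t)"
    if "t \<in> {0<..<T}" "b \<in> Basis" for b t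
    using sol(3) that unfolding C21_def by (intro has_dd_pderiv_dir; simp)+
  interpret trapped_solution T k1 k2 u "\<lambda>x t. deriv (u x) t" ?g ?H
  proof
    show "T > 0" "k2 > 0" "k2 < k1" using assms by auto
    show "bb k1 (T - t) x \<le> u x t" "u x t \<le> bb k2 (T - t) x" if "t \<in> {0<..<T}" for x t
      using assms(6) that by (auto simp: barenblatt_eq_bb)
    show "(u x has_real_derivative deriv (u x) t) (at t)" if "t \<in> {0<..<T}" for x t
      using sol(3) that unfolding C21_def by (simp add: DERIV_deriv_iff_real_differentiable)
    show "continuous_on (UNIV \<times> {0<..<T}) (\<lambda>(x, t). u x t)"
      "continuous_on (UNIV \<times> {0<..<T}) (\<lambda>(x, t). deriv (u x) t)"
      using sol(3) unfolding C21_def by blast+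
    show "continuous_on (UNIV \<times> {0<..<T}) (\<lambda>(x, t). ?g b x t)"
      "continuous_on (UNIV \<times> {0<..<T}) (\<lambda>(x, t). ?H b x t)" if "b \<in> Basis" for b
      using sol(3) that unfolding C21_def by blast+
    show "deriv (u x) t = (\<Sum>b\<in>Basis. ?H b x t / u x t - (?g b x t / u x t)\<^sup>2)" if t: "t \<in> {0<..<T}" for x t
    proof -
      \<comment> \<open>With existence of the derivatives known, \<open>pderiv_dir\<close> of
        \<open>ln u\<close> is evaluated by uniqueness of derivatives, which yields the expanded
        form of the equation.\<close>
      have "pderiv_dir b (pderiv_dir b (\<lambda>y. ln (u y t))) x = ?H b x t / u x t - (?g b x t / u x t)\<^sup>2" if b: "b \<in> Basis" for b
        using has_dd_ln[OF dx[OF t b] dxx[OF t b] sol(2)[OF t], THEN pderiv_dir_eq] by simp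
      then show ?thesis unfolding sol(4)[OF t] laplacian_def by simp
    qed
  qed (use dx dxx assms sol(3) in \<open>auto simp: C21_def\<close>)
  have "\<exists>!k0. k0 > 0 \<and> has_bochner_integral lebesgue (\<lambda>x. u0 x - bb k0 T x) 0"
    using assms(4) locally_integrable_measurable[OF sol(1)]
    by (intro unique_mass_constant[OF assms(1,3,2)]) (auto simp: b0)
  moreover have "uniform_limit UNIV (\<lambda>s x. rescaled T u x s) (rescaled_barenblatt k0) at_top \<and>
       tendsto_L1 lebesgue (\<lambda>s x. rescaled T u x s) (rescaled_barenblatt k0) at_top"
    if k0: "k0 > 0" and int: "has_bochner_integral lebesgue (\<lambda>x. u0 x - bb k0 T x) 0" for k0
  proof
    have mass: "(LINT x|lborel. u x t - bb k0 (T - t) x) = 0" if "t \<in> {0<..<T}" for t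
      by (rule mass_zero[OF k0 that _ _ sol(5)]) (use int in \<open>auto simp: has_bochner_integral_iff\<close>)
    have ev: "\<forall>\<^sub>F s in at_top. t1 \<le> T - exp (- s) \<and> T - exp (- s) \<in> {0<..<T}" if "t1 \<in> {0<..<T}" for t1
    proof -
      have "\<forall>\<^sub>F s in at_top. - ln (T - t1) \<le> s" by (rule eventually_ge_at_top)
      then show ?thesis
      proof eventually_elim
        case (elim s)
        then have "exp (- s) \<le> exp (ln (T - t1))" by (subst exp_le_cancel_iff) linarith
        also have "\<dots> = T - t1" using that by simp
        finally have "exp (- s) \<le> T - t1" .
        then show ?case using that by auto
      qed
    qed
    have diff: "rescaled T u x s - rescaled_barenblatt k0 x
      = (u ((1 / exp (- s)) *\<^sub>R x) (T - exp (- s)) - bb k0 (exp (- s)) ((1 / exp (- s)) *\<^sub>R x)) / exp (- s) ^ 3" for x s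
      unfolding rescaled_eq rescaled_barenblatt_eq[of k0 x s] by (simp add: diff_divide_distrib)
    show "uniform_limit UNIV (\<lambda>s x. rescaled T u x s) (rescaled_barenblatt k0) at_top"
    proof (rule uniform_limitI)
      fix e :: real assume e: "e > 0"
      then have "e / 2 > 0" by simp
      from uniform_gap[OF k0 this mass] obtain t1 where t1: "t1 \<in> {0<..<T}"
        "\<And>t x. t1 \<le> t \<Longrightarrow> t < T \<Longrightarrow> \<bar>u x t - bb k0 (T - t) x\<bar> \<le> e / 2 * (T - t) ^ 3" by blast
      from ev[OF t1(1)] show "\<forall>\<^sub>F s in at_top. \<forall>x\<in>UNIV. dist (rescaled T u x s) (rescaled_barenblatt k0 x) < e"
      proof eventually_elim
        case (elim s)
        define p where "p = exp (- s)"
        have p: "p > 0" "t1 \<le> T - p" using elim unfolding p_def by auto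
        have "\<bar>(u y (T - p) - bb k0 p y) / p ^ 3\<bar> < e" for y
        proof -
          have "\<bar>u y (T - p) - bb k0 p y\<bar> \<le> e / 2 * p ^ 3" using t1(2)[of "T - p" y] p by simp
          then have "\<bar>u y (T - p) - bb k0 p y\<bar> / p ^ 3 \<le> e / 2" using p by (simp add: pos_divide_le_eq)
          then have "\<bar>u y (T - p) - bb k0 p y\<bar> / p ^ 3 < e" using e by linarith
          then show ?thesis using p by (simp add: abs_divide)
        qed
        then show ?case unfolding dist_real_def diff p_def by blast
      qed
    qed
    \<comment> \<open>The factor \<open>exp (- s) ^ 3\<close> is the Jacobian of the rescaling, so
      the \<open>L1\<close> distance of the rescaled functions at \<open>s\<close> is the gap at
      \<open>t = T - exp (- s)\<close>.\<close>
    have gap: "integrable lebesgue (\<lambda>x. rescaled T u x s - rescaled_barenblatt k0 x)"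
      "(LINT x|lebesgue. \<bar>rescaled T u x s - rescaled_barenblatt k0 x\<bar>) = L1_gap k0 (T - exp (- s))"
      if s: "T - exp (- s) \<in> {0<..<T}" for s
    proof -
      define p where "p = exp (- s)"
      have p: "p > 0" unfolding p_def by simp
      define F where "F x = u x (T - p) - bb k0 p x" for x
      have F: "integrable lborel F" unfolding F_def[abs_def] using integrable_u_minus_bb[OF k0 s] unfolding p_def by simp
      have d: "rescaled T u x s - rescaled_barenblatt k0 x = F ((1 / p) *\<^sub>R x) / p ^ 3" for x
        unfolding diff F_def p_def ..
      have i: "integrable lborel (\<lambda>x. F ((1 / p) *\<^sub>R x) / p ^ 3)"
        using lborel_integrable_affine[OF F, of "1 / p" 0] p by simp
      then show "integrable lebesgue (\<lambda>x. rescaled T u x s - rescaled_barenblatt k0 x)"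
        unfolding d by (simp add: integrable_completion)
      have "(LINT x|lebesgue. \<bar>F ((1 / p) *\<^sub>R x) / p ^ 3\<bar>) = (LINT x|lborel. \<bar>F ((1 / p) *\<^sub>R x) / p ^ 3\<bar>)"
        using i by (intro integral_completion borel_measurable_abs) auto
      also have "\<dots> = (LINT x|lborel. \<bar>F ((1 / p) *\<^sub>R x)\<bar> / p ^ 3)" using p by (simp add: abs_divide)
      also have "\<dots> = (LINT x|lborel. \<bar>F x\<bar>)"
        using F by (intro rescale_integral[OF p, of "\<lambda>x. \<bar>F x\<bar>"]) auto
      also have "\<dots> = L1_gap k0 (T - exp (- s))" unfolding L1_gap_def F_def p_def by simp
      finally show "(LINT x|lebesgue. \<bar>rescaled T u x s - rescaled_barenblatt k0 x\<bar>) = L1_gap k0 (T - exp (- s))" unfolding d .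
    qed
    show "tendsto_L1 lebesgue (\<lambda>s x. rescaled T u x s) (rescaled_barenblatt k0) at_top"
      unfolding tendsto_L1_def
    proof
      have T2: "T / 2 \<in> {0<..<T}" using assms(1) by simp
      from ev[OF T2] show "\<forall>\<^sub>F s in at_top. integrable lebesgue (\<lambda>x. rescaled T u x s - rescaled_barenblatt k0 x)"
        by eventually_elim (use gap(1) in blast)
      show "((\<lambda>s. LINT x|lebesgue. \<bar>rescaled T u x s - rescaled_barenblatt k0 x\<bar>) \<longlongrightarrow> 0) at_top"
      proof (rule tendstoI)
        fix e :: real assume e: "e > 0"
        then have "e / 2 > 0" by simp
        from L1_gap_tends_to_zero[OF k0 this mass] obtain t1 where t1: "t1 \<in> {0<..<T}" "\<And>t. t1 \<le> t \<Longrightarrow> t < T \<Longrightarrow> L1_gap k0 t \<le> e / 2"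
          by blast
        from ev[OF t1(1)] show "\<forall>\<^sub>F s in at_top. dist (LINT x|lebesgue. \<bar>rescaled T u x s - rescaled_barenblatt k0 x\<bar>) 0 < e"
        proof eventually_elim
          case (elim s)
          have "0 \<le> L1_gap k0 (T - exp (- s))" unfolding L1_gap_def by (intro integral_nonneg_AE) auto
          moreover have "L1_gap k0 (T - exp (- s)) \<le> e / 2" using elim by (intro t1(2)) auto
          ultimately show ?case using elim gap(2)[of s] e by simp
        qed
      qed
    qed
  qed
  ultimately show ?thesis unfolding b0 by blast
qed

end
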